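(* Let $[\mathbf G,\mathbf o]$ be a unimodular graph. Add i.i.d. marks in $\{0,1\}$ to the vertices with Bernoulli distribution with parameter $p$, $0<p\le 1$. If $[\mathbf G,\mathbf o]$ is infinite a.s., then there exists a root-change that, when applied to the resulting marked random rooted network, gives a random rooted network that is the same (in distribution) as the marked network except that the mark of the root is forced to be $1$.
   Context: Networks. Fix a complete separable metric space $\Xi$ (the mark space). A network is a connected, locally finite (every vertex has finite degree) multigraph $G$ with vertex set $V(G)$, together with a mark in $\Xi$ for each vertex $v$ and for each pair $(v,e)$ with $e$ an edge incident to $v$. A rooted network $(G,o)$ is a network with a distinguished vertex $o$; a doubly-rooted network $(G,o,v)$ has an ordered pair of distinguished vertices. Isomorphisms preserve marks and distinguished vertices. $\mathcal G_*$ and $\mathcal G_{**}$ are the sets of isomorphism classes $[G,o]$ and $[G,o,v]$ of rooted and doubly-rooted networks, with their Borel sigma-fields for the (Polish) local topologies: $[G_n,o_n]\to[G,o]$ iff for all $r\in\mathbb N$ and $\varepsilon>0$, for all large $n$ there is a graph isomorphism between the balls of radius $r$ about the roots that maps root to root and for which corresponding marks are at distance less than $\varepsilon$; for $\mathcal G_{**}$ one uses balls about the first root, with $r$ at least the distance of the two roots in the limit, and isomorphisms must also map second root to second root. A random rooted network $[\mathbf G,\mathbf o]$ is a random element of $\mathcal G_*$; a random rooted graph is one with trivial marks. Unimodular: $[\mathbf G,\mathbf o]$ is unimodular if for all measurable $g:\mathcal G_{**}\to\mathbb R^{\ge0}$, $\mathbb E\big[\sum_{v\in V(\mathbf G)}g[\mathbf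 G,\mathbf o,v]\big]=\mathbb E\big[\sum_{v\in V(\mathbf G)}g[\mathbf G,v,\mathbf o]\big]$. Adding i.i.d. marks: given $[\mathbf G,\mathbf o]$, equip the vertices of a representative with i.i.d. marks $m(v)$ and take the isomorphism class of the resulting marked rooted network (its law does not depend on the representative). The network with the mark of the root forced to be $1$ is the marked network in which $m(\mathbf o)$ is replaced by $1$, all other marks being i.i.d. Bernoulli($p$) given $[\mathbf G,\mathbf o]$. Root-change: let $T:\mathcal G_{**}\to\mathbb R^{\ge0}$ be measurable, write $T_G(u,v)=T[G,u,v]$, and assume for a random rooted network $[\mathbf H,\mathbf o]$ that $\sum_{v\in V(\mathbf H)}T_{\mathbf H}(\mathbf o,v)=1$ a.s. The root-change of $[\mathbf H,\mathbf o]$ by kernel $T$ is any random rooted network with distribution $A\mapsto\mathbb E\big[\sum_{v\in V(\mathbf H)}T_{\mathbf H}(\mathbf o,v)1_A[\mathbf H,v]\big]$. *)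

theory Defs
  imports "HOL-Probability.Probability"
begin

instantiation bool :: metric_space
begin
definition dist_bool :: "bool \<Rightarrow> bool \<Rightarrow> real" where
  "dist_bool x y = of_bool (x \<noteq> y)"
definition uniformity_bool :: "(bool \<times> bool) filter" where
  "uniformity_bool = (INF e\<in>{0<..}. principal {(x, y). dist x y < e})"
instance
proof
  show "open U \<longleftrightarrow> (\<forall>x\<in>U. \<forall>\<^sub>F (x', y) in uniformity. x' = x \<longrightarrow> y \<in> U)"
    for U :: "bool set"
  proof -
    have "\<forall>\<^sub>F (x', y) in uniformity. x' = x \<longrightarrow> y \<in> U" if "x \<in> U" for x
      unfolding uniformity_bool_def
      by (rule eventually_INF1[of "1::real"])
        (use that in \<open>auto simp: eventually_principal dist_bool_def split: if_splits\<close>)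
    then show ?thesis using discrete_topology_class.open_discrete[of U] by blast
  qed
  show "dist x y = 0 \<longleftrightarrow> x = y" for x y :: bool
    by (simp add: dist_bool_def)
  show "dist x y \<le> dist x z + dist y z" for x y z :: bool
    by (auto simp: dist_bool_def)
qed (rule uniformity_bool_def)
end

instance bool :: polish_space
proof
  show "convergent X" if "Cauchy X" for X :: "nat \<Rightarrow> bool"
  proof -
    from that obtain N where N: "\<forall>m\<ge>N. \<forall>n\<ge>N. dist (X m) (X n) < 1"
      using metric_CauchyD[of X 1] by auto
    have "X n = X N" if "n \<ge> N" for n
    proof -
      have "dist (X n) (X N) < 1" using N that by blast
      then show ?thesis by (cases "X n"; cases "X N") (simp_all add: dist_bool_def)
    qed
    then have "X \<longlonglongrightarrow> X N"
      by (rule tendsto_eventually[OF eventually_sequentiallyI])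
    then show ?thesis by (auto simp: convergent_def)
  qed
  show "\<exists>B::bool set set. countable B \<and> open = generate_topology B"
  proof (intro exI conjI)
    show "(open :: bool set \<Rightarrow> bool) = generate_topology UNIV"
      by (rule ext) (simp add: discrete_topology_class.open_discrete generate_topology.Basis)
  qed (simp add: countable_finite)
qed

instantiation unit :: metric_space
begin
definition dist_unit :: "unit \<Rightarrow> unit \<Rightarrow> real" where
  "dist_unit x y = 0"
definition uniformity_unit :: "(unit \<times> unit) filter" where
  "uniformity_unit = (INF e\<in>{0<..}. principal {(x, y). dist x y < e})"
definition open_unit :: "unit set \<Rightarrow> bool" where
  "open_unit U = True"
instance
proof
  have *: "(uniformity :: (unit \<times> unit) filter) = (INF e\<in>{0<..}. principal {(x, y). dist x y < e})"
    by (rule uniformity_unit_def)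
  also have "\<dots> = (INF e\<in>{0::real<..}. principal UNIV)"
    by (intro INF_cong refl arg_cong[where f = principal]) (simp add: dist_unit_def)
  also have "\<dots> = principal UNIV"
    by (rule INF_const) (auto intro: exI[of _ "1::real"])
  finally have "(uniformity :: (unit \<times> unit) filter) = principal UNIV" .
  then show "open U \<longleftrightarrow> (\<forall>x\<in>U. \<forall>\<^sub>F (x', y) in uniformity. x' = x \<longrightarrow> y \<in> U)"
    for U :: "unit set"
    by (auto simp: open_unit_def eventually_principal)
  show "dist x y = 0 \<longleftrightarrow> x = y" for x y :: unit
    by (cases x; cases y) (simp add: dist_unit_def)
  show "dist x y \<le> dist x z + dist y z" for x y z :: unit
    by (simp add: dist_unit_def)
qed (rule uniformity_unit_def)
end

instance unit :: polish_space
proof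
  show "convergent X" for X :: "nat \<Rightarrow> unit"
  proof -
    have "X = (\<lambda>_. ())" by auto
    then show ?thesis by (auto intro: convergent_const)
  qed
  show "\<exists>B::unit set set. countable B \<and> open = generate_topology B"
    by (intro exI[of _ UNIV])
      (simp add: fun_eq_iff open_unit_def generate_topology.Basis countable_finite)
qed

text \<open>
  A connected locally finite multigraph has countably many vertices and edges, so every
  isomorphism class has a representative whose vertices and edges are natural numbers.
  \<open>ends G e\<close> is the set of end vertices of \<open>e\<close>; it is a singleton iff \<open>e\<close> is a loop.
  \<open>emark G v e\<close> is the mark of the pair \<open>(v, e)\<close> and is relevant only if \<open>v \<in> ends G e\<close>.
\<close>

datatype 'm network = Network
  (verts: "nat set") (edges: "nat set") (ends: "nat \<Rightarrow> nat set")
  (vmark: "nat \<Rightarrow> 'm") (emark: "nat \<Rightarrow> nat \<Rightarrow> 'm")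

definition adj :: "'m network \<Rightarrow> nat \<Rightarrow> nat \<Rightarrow> bool" where
  "adj G u v \<longleftrightarrow> (\<exists>e\<in>edges G. ends G e = {u, v})"

definition is_network :: "'m network \<Rightarrow> bool" where
  "is_network G \<longleftrightarrow>
     (\<forall>e\<in>edges G. ends G e \<subseteq> verts G \<and> card (ends G e) \<in> {1, 2}) \<and>
     (\<forall>u\<in>verts G. \<forall>v\<in>verts G. (adj G)\<^sup>*\<^sup>* u v) \<and>
     (\<forall>v\<in>verts G. finite {e \<in> edges G. v \<in> ends G e})"

text \<open>
  \<open>\<phi>\<close> and \<open>\<psi>\<close> form a multigraph isomorphism for which corresponding marks are related by \<open>R\<close>.
\<close>

definition network_iso ::
  "('m \<Rightarrow> 'm \<Rightarrow> bool) \<Rightarrow> 'm network \<Rightarrow> 'm network \<Rightarrow> (nat \<Rightarrow> nat) \<Rightarrow> (nat \<Rightarrow> nat) \<Rightarrow> bool"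
where
  "network_iso R G H \<phi> \<psi> \<longleftrightarrow>
     bij_betw \<phi> (verts G) (verts H) \<and> bij_betw \<psi> (edges G) (edges H) \<and>
     (\<forall>e\<in>edges G. ends H (\<psi> e) = \<phi> ` ends G e) \<and>
     (\<forall>v\<in>verts G. R (vmark G v) (vmark H (\<phi> v))) \<and>
     (\<forall>e\<in>edges G. \<forall>v\<in>ends G e. R (emark G v e) (emark H (\<phi> v) (\<psi> e)))"

text \<open>
  \<open>net_cball G u r\<close> is the subgraph induced by the vertices at graph distance at most \<open>r\<close> from \<open>u\<close>.
\<close>

definition net_cball :: "'m network \<Rightarrow> nat \<Rightarrow> nat \<Rightarrow> 'm network" where
  "net_cball G u r =
     (let B = {v. \<exists>n\<le>r. (adj G ^^ n) u v}
      in Network B {e \<in> edges G. ends G e \<subseteq> B} (ends G) (vmark G) (emark G))"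

lemma net_cball_simps [simp]:
  "verts (net_cball G u r) = {v. \<exists>n\<le>r. (adj G ^^ n) u v}"
  "edges (net_cball G u r) = {e \<in> edges G. ends G e \<subseteq> verts (net_cball G u r)}"
  "ends (net_cball G u r) = ends G"
  "vmark (net_cball G u r) = vmark G"
  "emark (net_cball G u r) = emark G"
  by (simp_all add: net_cball_def Let_def)

lemma network_iso_id: "network_iso (=) G G id id"
  by (auto simp: network_iso_def)

lemma network_isoD:
  assumes "network_iso R G H \<phi> \<psi>"
  shows "bij_betw \<phi> (verts G) (verts H)" "bij_betw \<psi> (edges G) (edges H)"
    and "\<And>v. v \<in> verts G \<Longrightarrow> \<phi> v \<in> verts H" "\<And>e. e \<in> edges G \<Longrightarrow> \<psi> e \<in> edges H"
    and "\<And>e. e \<in> edges G \<Longrightarrow> ends H (\<psi> e) = \<phi> ` ends G e"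
    and "\<And>v. v \<in> verts G \<Longrightarrow> R (vmark G v) (vmark H (\<phi> v))"
    and "\<And>e v. e \<in> edges G \<Longrightarrow> v \<in> ends G e \<Longrightarrow> R (emark G v e) (emark H (\<phi> v) (\<psi> e))"
  using assms unfolding network_iso_def bij_betw_def by blast+

lemma network_iso_comp:
  assumes 1: "network_iso R G H \<phi> \<psi>" and 2: "network_iso S H K \<phi>' \<psi>'"
    and "\<forall>e\<in>edges G. ends G e \<subseteq> verts G"
    and Q: "\<And>x y z. R x y \<Longrightarrow> S y z \<Longrightarrow> Q x z"
  shows "network_iso Q G K (\<phi>' \<circ> \<phi>) (\<psi>' \<circ> \<psi>)"
  unfolding network_iso_def
proof (intro conjI ballI)
  note d1 = network_isoD[OF 1] and d2 = network_isoD[OF 2]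
  show "bij_betw (\<phi>' \<circ> \<phi>) (verts G) (verts K)" "bij_betw (\<psi>' \<circ> \<psi>) (edges G) (edges K)"
    using d1(1,2) d2(1,2) by (auto intro: bij_betw_trans)
  show "ends K ((\<psi>' \<circ> \<psi>) e) = (\<phi>' \<circ> \<phi>) ` ends G e" if "e \<in> edges G" for e
    using d1(4,5)[OF that] d2(5)[of "\<psi> e"] by (simp add: image_comp)
  show "Q (vmark G v) (vmark K ((\<phi>' \<circ> \<phi>) v))" if "v \<in> verts G" for v
    using Q[OF d1(6)[OF that] d2(6)[OF d1(3)[OF that]]] by simp
  show "Q (emark G v e) (emark K ((\<phi>' \<circ> \<phi>) v) ((\<psi>' \<circ> \<psi>) e))" if "e \<in> edges G" "v \<in> ends G e" for e v
  proof -
    have "\<phi> v \<in> ends H (\<psi> e)" using d1(5) that by simp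
    then show ?thesis
      using Q[OF d1(7)[OF that] d2(7)[OF d1(4)[OF that(1)]]] by simp
  qed
qed

lemma network_iso_inv:
  assumes iso: "network_iso R G H \<phi> \<psi>"
    and ends: "\<forall>e\<in>edges G. ends G e \<subseteq> verts G"
    and "\<And>x y. R x y \<Longrightarrow> S y x"
  shows "network_iso S H G (inv_into (verts G) \<phi>) (inv_into (edges G) \<psi>)"
proof -
  let ?f = "inv_into (verts G) \<phi>" and ?g = "inv_into (edges G) \<psi>"
  have bij: "bij_betw \<phi> (verts G) (verts H)" "bij_betw \<psi> (edges G) (edges H)"
    using iso by (auto simp: network_iso_def)
  have g: "?g e \<in> edges G" "\<psi> (?g e) = e" if "e \<in> edges H" for e
    using that bij by (auto simp: bij_betw_def inv_into_into f_inv_into_f)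
  have f: "?f v \<in> verts G" "\<phi> (?f v) = v" if "v \<in> verts H" for v
    using that bij by (auto simp: bij_betw_def inv_into_into f_inv_into_f)
  have f': "?f (\<phi> v) = v" if "v \<in> verts G" for v
    using that bij by (auto simp: bij_betw_def)
  have e: "ends H e = \<phi> ` ends G (?g e)" if "e \<in> edges H" for e
    using g(2)[OF that] network_isoD(5)[OF iso g(1)[OF that]] by simp
  have e': "ends G (?g e) = ?f ` ends H e" if "e \<in> edges H" for e
  proof -
    have "ends G (?g e) \<subseteq> verts G" using g[OF that] ends by auto
    then have "?f ` \<phi> ` ends G (?g e) = ends G (?g e)"
      using f' by (force simp: image_image)
    then show ?thesis using e[OF that] by simp
  qed
  have "S (emark H v e) (emark G (?f v) (?g e))" if ev: "e \<in> edges H" "v \<in> ends H e" for v e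
  proof -
    have w: "?f v \<in> ends G (?g e)" using e'[OF ev(1)] ev(2) by auto
    moreover have "\<phi> (?f v) = v"
    proof -
      obtain x where x: "x \<in> ends G (?g e)" "v = \<phi> x" using e[OF ev(1)] ev(2) by blast
      then have "x \<in> verts G" using ends g(1)[OF ev(1)] by blast
      then show ?thesis using f' x(2) by simp
    qed
    ultimately show ?thesis
      using network_isoD(7)[OF iso g(1)[OF ev(1)] w] g(2)[OF ev(1)] assms(3) by simp
  qed
  moreover have "S (vmark H v) (vmark G (?f v))" if "v \<in> verts H" for v
    using f(2)[OF that] network_isoD(6)[OF iso f(1)[OF that]] assms(3) by simp
  ultimately show ?thesis
    using e' bij unfolding network_iso_def by (auto intro: bij_betw_inv_into)
qed

lemma network_iso_adj:
  assumes "network_iso R G H \<phi> \<psi>" "adj G u v"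
  shows "adj H (\<phi> u) (\<phi> v)"
proof -
  obtain e where e: "e \<in> edges G" "ends G e = {u, v}" using assms(2) by (auto simp: adj_def)
  then have "ends H (\<psi> e) = {\<phi> u, \<phi> v}" using network_isoD(5)[OF assms(1) e(1)] by simp
  then show ?thesis using network_isoD(4)[OF assms(1) e(1)] by (auto simp: adj_def)
qed

lemma network_iso_adj_pow:
  assumes "network_iso R G H \<phi> \<psi>" "(adj G ^^ n) u v"
  shows "(adj H ^^ n) (\<phi> u) (\<phi> v)"
  using assms(2)
proof (induction n arbitrary: v)
  case (Suc n)
  then show ?case using network_iso_adj[OF assms(1)] by (auto intro: relcomppI)
qed auto

lemma adj_pow_verts:
  assumes "\<forall>e\<in>edges G. ends G e \<subseteq> verts G" "u \<in> verts G" "(adj G ^^ n) u v"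
  shows "v \<in> verts G"
  using assms(3)
proof (induction n arbitrary: v)
  case (Suc n)
  then obtain w where "adj G w v" by auto
  then show ?case using assms(1) by (auto simp: adj_def)
qed (use assms in auto)

lemma net_cball_subset:
  assumes "is_network G" "u \<in> verts G"
  shows "verts (net_cball G u r) \<subseteq> verts G"
  using adj_pow_verts[of G u] assms by (auto simp: is_network_def)

lemma network_iso_cball:
  assumes iso: "network_iso R G H \<phi> \<psi>" and G: "is_network G" "u \<in> verts G"
  shows "network_iso R (net_cball G u r) (net_cball H (\<phi> u) r) \<phi> \<psi>"
proof -
  let ?f = "inv_into (verts G) \<phi>" and ?g = "inv_into (edges G) \<psi>"
  have ends: "\<forall>e\<in>edges G. ends G e \<subseteq> verts G" using G by (auto simp: is_network_def)
  have iso': "network_iso (\<lambda>x y. R y x) H G ?f ?g"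
    by (rule network_iso_inv[OF iso ends])
  have f': "?f (\<phi> v) = v" if "v \<in> verts G" for v
    using that network_isoD(1)[OF iso] by (simp add: bij_betw_def)
  have endsH: "\<forall>e\<in>edges H. ends H e \<subseteq> verts H"
  proof
    fix e assume "e \<in> edges H"
    then obtain e' where e': "e' \<in> edges G" "e = \<psi> e'"
      using network_isoD(2)[OF iso] by (auto simp: bij_betw_def)
    then have "ends H e = \<phi> ` ends G e'" using network_isoD(5)[OF iso] by simp
    also have "\<dots> \<subseteq> \<phi> ` verts G" by (rule image_mono) (use ends e'(1) in simp)
    also have "\<dots> = verts H" using network_isoD(1)[OF iso] by (simp add: bij_betw_def)
    finally show "ends H e \<subseteq> verts H" .
  qed
  have uH: "\<phi> u \<in> verts H" by (rule network_isoD(3)[OF iso G(2)])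
  let ?B = "verts (net_cball G u r)" and ?C = "verts (net_cball H (\<phi> u) r)"
  have BG: "?B \<subseteq> verts G" by (rule net_cball_subset[OF G])
  have img: "\<phi> ` ?B = ?C"
  proof
    show "\<phi> ` ?B \<subseteq> ?C" using network_iso_adj_pow[OF iso] by auto
    show "?C \<subseteq> \<phi> ` ?B"
    proof
      fix w assume "w \<in> ?C"
      then obtain n where n: "n \<le> r" "(adj H ^^ n) (\<phi> u) w" by auto
      have w: "w \<in> verts H" by (rule adj_pow_verts[OF endsH uH n(2)])
      have "(adj G ^^ n) u (?f w)"
        using network_iso_adj_pow[OF iso' n(2)] f'[OF G(2)] by simp
      moreover have "\<phi> (?f w) = w"
        using w network_isoD(1)[OF iso] by (auto simp: bij_betw_def f_inv_into_f)
      ultimately show "w \<in> \<phi> ` ?B" using n(1) by force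
    qed
  qed
  have inj: "inj_on \<phi> (verts G)" using network_isoD(1)[OF iso] by (simp add: bij_betw_def)
  have sub: "ends H (\<psi> e) \<subseteq> ?C \<longleftrightarrow> ends G e \<subseteq> ?B" if "e \<in> edges G" for e
  proof -
    have "ends H (\<psi> e) = \<phi> ` ends G e" using that iso by (auto simp: network_iso_def)
    then show ?thesis
      unfolding img[symmetric] using inj_on_image_subset_iff[OF inj] that ends BG by simp
  qed
  have imgE: "\<psi> ` edges G = edges H" "inj_on \<psi> (edges G)"
    using network_isoD(2)[OF iso] by (simp_all add: bij_betw_def)
  have "\<psi> ` edges (net_cball G u r) = edges (net_cball H (\<phi> u) r)"
  proof -
    have "edges (net_cball H (\<phi> u) r) = {e \<in> \<psi> ` edges G. ends H e \<subseteq> ?C}"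
      unfolding imgE(1) by (rule net_cball_simps(2))
    also have "\<dots> = \<psi> ` {e \<in> edges G. ends H (\<psi> e) \<subseteq> ?C}" by blast
    also have "{e \<in> edges G. ends H (\<psi> e) \<subseteq> ?C} = edges (net_cball G u r)"
      unfolding net_cball_simps(2) using sub by (rule Collect_cong[OF conj_cong[OF refl]])
    finally show ?thesis by (rule sym)
  qed
  then have "bij_betw \<psi> (edges (net_cball G u r)) (edges (net_cball H (\<phi> u) r))"
    using imgE(2) unfolding bij_betw_def
    by (auto intro: inj_on_subset)
  moreover have "bij_betw \<phi> ?B ?C"
    using img inj BG unfolding bij_betw_def by (auto intro: inj_on_subset)
  moreover have "e \<in> edges G" if "e \<in> edges (net_cball G u r)" for e
    using that unfolding net_cball_simps(2) by blast
  moreover have "v \<in> verts G" if "v \<in> ?B" for v using that BG by blast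
  ultimately show ?thesis
    unfolding network_iso_def net_cball_simps(3-5)
    by (intro conjI ballI network_isoD(5-7)[OF iso]; assumption?)
qed

definition rooted_iso :: "'m network \<times> nat \<Rightarrow> 'm network \<times> nat \<Rightarrow> bool" where
  "rooted_iso = (\<lambda>(G, u) (H, u'). is_network G \<and> is_network H \<and> u \<in> verts G \<and> u' \<in> verts H \<and>
     (\<exists>\<phi> \<psi>. network_iso (=) G H \<phi> \<psi> \<and> \<phi> u = u'))"

definition birooted_iso :: "'m network \<times> nat \<times> nat \<Rightarrow> 'm network \<times> nat \<times> nat \<Rightarrow> bool" where
  "birooted_iso = (\<lambda>(G, u, v) (H, u', v'). is_network G \<and> is_network H \<and>
     u \<in> verts G \<and> v \<in> verts G \<and> u' \<in> verts H \<and> v' \<in> verts H \<and>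
     (\<exists>\<phi> \<psi>. network_iso (=) G H \<phi> \<psi> \<and> \<phi> u = u' \<and> \<phi> v = v'))"

lemma rooted_isoI:
  assumes "network_iso (=) G H \<phi> \<psi>" "\<phi> u = u'"
    and "is_network G" "is_network H" "u \<in> verts G" "u' \<in> verts H"
  shows "rooted_iso (G, u) (H, u')"
  using assms by (auto simp: rooted_iso_def)

lemma birooted_isoI:
  assumes "network_iso (=) G H \<phi> \<psi>" "\<phi> u = u'" "\<phi> v = v'"
    and "is_network G" "is_network H" "u \<in> verts G" "u' \<in> verts H" "v \<in> verts G" "v' \<in> verts H"
  shows "birooted_iso (G, u, v) (H, u', v')"
  unfolding birooted_iso_def prod.case using assms by blast

lemma is_networkD: "is_network G \<Longrightarrow> \<forall>e\<in>edges G. ends G e \<subseteq> verts G"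
  by (auto simp: is_network_def)

lemma is_network_singleton: "is_network (Network {0} {} (\<lambda>_. {}) a b)"
  by (auto simp: is_network_def)

lemma inv_into_iso:
  assumes "network_iso R G H \<phi> \<psi>" "v \<in> verts G"
  shows "inv_into (verts G) \<phi> (\<phi> v) = v"
  using assms by (auto simp: network_iso_def bij_betw_def)

lemma rooted_iso_part_equivp: "part_equivp rooted_iso"
proof (rule part_equivpI)
  show "\<exists>x::'m network \<times> nat. rooted_iso x x"
    by (intro exI[of _ "(Network {0} {} (\<lambda>_. {}) undefined undefined, 0)"])
      (rule rooted_isoI[OF network_iso_id]; simp add: is_network_singleton)
  show "symp (rooted_iso :: 'm network \<times> nat \<Rightarrow> _)"
  proof (rule sympI)
    fix x y :: "'m network \<times> nat" assume "rooted_iso x y"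
    then obtain G u H \<phi> \<psi> where *: "x = (G, u)" "y = (H, \<phi> u)" "is_network G" "is_network H"
      "u \<in> verts G" "\<phi> u \<in> verts H" "network_iso (=) G H \<phi> \<psi>"
      by (auto simp: rooted_iso_def)
    have inv: "network_iso (=) H G (inv_into (verts G) \<phi>) (inv_into (edges G) \<psi>)"
      by (rule network_iso_inv[OF *(7) is_networkD[OF *(3)]]) auto
    then show "rooted_iso y x"
      using * by (simp add: rooted_isoI[OF inv] inv_into_iso[OF *(7) *(5)])
  qed
  show "transp (rooted_iso :: 'm network \<times> nat \<Rightarrow> _)"
  proof (rule transpI)
    fix x y z :: "'m network \<times> nat" assume "rooted_iso x y" "rooted_iso y z"
    then obtain G u H K \<phi> \<psi> \<phi>' \<psi>' where *: "x = (G, u)" "z = (K, \<phi>' (\<phi> u))"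
      "is_network G" "is_network K" "u \<in> verts G" "\<phi>' (\<phi> u) \<in> verts K"
      "network_iso (=) G H \<phi> \<psi>" "network_iso (=) H K \<phi>' \<psi>'"
      by (auto simp: rooted_iso_def)
    have comp: "network_iso (=) G K (\<phi>' \<circ> \<phi>) (\<psi>' \<circ> \<psi>)"
      by (rule network_iso_comp[OF *(7) *(8) is_networkD[OF *(3)]]) auto
    then show "rooted_iso x z"
      using * by (simp add: rooted_isoI[OF comp])
  qed
qed

lemma birooted_iso_part_equivp: "part_equivp birooted_iso"
proof (rule part_equivpI)
  show "\<exists>x::'m network \<times> nat \<times> nat. birooted_iso x x"
    by (intro exI[of _ "(Network {0} {} (\<lambda>_. {}) undefined undefined, 0, 0)"])
      (rule birooted_isoI[OF network_iso_id]; simp add: is_network_singleton)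
  show "symp (birooted_iso :: 'm network \<times> nat \<times> nat \<Rightarrow> _)"
  proof (rule sympI)
    fix x y :: "'m network \<times> nat \<times> nat" assume "birooted_iso x y"
    then obtain G u v H \<phi> \<psi> where *: "x = (G, u, v)" "y = (H, \<phi> u, \<phi> v)" "is_network G"
      "is_network H" "u \<in> verts G" "v \<in> verts G" "\<phi> u \<in> verts H" "\<phi> v \<in> verts H"
      "network_iso (=) G H \<phi> \<psi>"
      by (auto simp: birooted_iso_def)
    have inv: "network_iso (=) H G (inv_into (verts G) \<phi>) (inv_into (edges G) \<psi>)"
      by (rule network_iso_inv[OF *(9) is_networkD[OF *(3)]]) auto
    then show "birooted_iso y x"
      using * by (simp add: birooted_isoI[OF inv] inv_into_iso[OF *(9) *(5)] inv_into_iso[OF *(9) *(6)])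
  qed
  show "transp (birooted_iso :: 'm network \<times> nat \<times> nat \<Rightarrow> _)"
  proof (rule transpI)
    fix x y z :: "'m network \<times> nat \<times> nat" assume "birooted_iso x y" "birooted_iso y z"
    then obtain G u v H K \<phi> \<psi> \<phi>' \<psi>' where *: "x = (G, u, v)" "z = (K, \<phi>' (\<phi> u), \<phi>' (\<phi> v))"
      "is_network G" "is_network K" "u \<in> verts G" "v \<in> verts G"
      "\<phi>' (\<phi> u) \<in> verts K" "\<phi>' (\<phi> v) \<in> verts K"
      "network_iso (=) G H \<phi> \<psi>" "network_iso (=) H K \<phi>' \<psi>'"
      by (auto simp: birooted_iso_def)
    have comp: "network_iso (=) G K (\<phi>' \<circ> \<phi>) (\<psi>' \<circ> \<psi>)"
      by (rule network_iso_comp[OF *(9) *(10) is_networkD[OF *(3)]]) auto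
    then show "birooted_iso x z"
      using * by (simp add: birooted_isoI[OF comp])
  qed
qed

quotient_type 'm rooted_net = "'m network \<times> nat" / partial: rooted_iso
  by (rule rooted_iso_part_equivp)

quotient_type 'm birooted_net = "'m network \<times> nat \<times> nat" / partial: birooted_iso
  by (rule birooted_iso_part_equivp)

lift_definition infinite_net :: "'m rooted_net \<Rightarrow> bool" is
  "\<lambda>(G, u). infinite (verts G)"
  by (auto simp: rooted_iso_def network_iso_def dest: bij_betw_finite)

lift_definition swap_roots :: "'m birooted_net \<Rightarrow> 'm birooted_net" is
  "\<lambda>(G, u, v). (G, v, u)"
  by (auto simp: birooted_iso_def)

lift_definition second_rooted :: "'m birooted_net \<Rightarrow> 'm rooted_net" is
  "\<lambda>(G, u, v). (G, v)"
  by (auto simp: birooted_iso_def rooted_iso_def)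

text \<open>\<open>root_sum f [G, u]\<close> is the sum of \<open>f [G, u, v]\<close> over all vertices \<open>v\<close> of \<open>G\<close>.\<close>

lift_definition root_sum :: "('m birooted_net \<Rightarrow> ennreal) \<Rightarrow> 'm rooted_net \<Rightarrow> ennreal" is
  "\<lambda>f (G, u). \<integral>\<^sup>+ v. f (abs_birooted_net (G, u, v)) \<partial>count_space (verts G)"
proof -
  fix f :: "'m birooted_net \<Rightarrow> ennreal" and x y :: "'m network \<times> nat"
  assume "rooted_iso x y"
  then obtain G u H \<phi> \<psi> where *: "x = (G, u)" "y = (H, \<phi> u)" "is_network G" "is_network H"
      "u \<in> verts G" "\<phi> u \<in> verts H" "network_iso (=) G H \<phi> \<psi>"
    by (auto simp: rooted_iso_def)
  have bij: "bij_betw \<phi> (verts G) (verts H)" using *(7) by (auto simp: network_iso_def)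
  have "abs_birooted_net (G, u, v) = abs_birooted_net (H, \<phi> u, \<phi> v)" if "v \<in> verts G" for v
  proof (rule Quotient_rel_abs[OF Quotient_birooted_net])
    have "\<phi> v \<in> verts H" using bij that by (auto simp: bij_betw_def)
    then show "birooted_iso (G, u, v) (H, \<phi> u, \<phi> v)"
      using * that by (auto simp: birooted_iso_def)
  qed
  then have "(\<integral>\<^sup>+ v. f (abs_birooted_net (G, u, v)) \<partial>count_space (verts G)) =
      (\<integral>\<^sup>+ v. f (abs_birooted_net (H, \<phi> u, \<phi> v)) \<partial>count_space (verts G))"
    by (intro nn_integral_cong) auto
  also have "\<dots> = (\<integral>\<^sup>+ v. f (abs_birooted_net (H, \<phi> u, v)) \<partial>count_space (verts H))"
    by (rule nn_integral_bij_count_space[OF bij])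
  finally show "(case x of (G, u) \<Rightarrow> \<integral>\<^sup>+ v. f (abs_birooted_net (G, u, v)) \<partial>count_space (verts G)) =
      (case y of (G, u) \<Rightarrow> \<integral>\<^sup>+ v. f (abs_birooted_net (G, u, v)) \<partial>count_space (verts G))"
    using * by simp
qed

lemma root_in_cball: "u \<in> verts (net_cball G u r)"
  by (auto intro: exI[of _ 0])

lemma cball_iso_transfer:
  assumes G: "network_iso (=) G G' \<alpha> \<beta>" "is_network G" "u \<in> verts G"
    and H: "network_iso (=) H H' \<gamma> \<delta>" "is_network H" "w \<in> verts H"
    and iso: "network_iso R (net_cball G u r) (net_cball H w r) \<phi> \<psi>"
  shows "\<exists>\<phi>' \<psi>'. network_iso R (net_cball G' (\<alpha> u) r) (net_cball H' (\<gamma> w) r) \<phi>' \<psi>' \<and>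
    (\<forall>v\<in>verts (net_cball G u r). \<phi>' (\<alpha> v) = \<gamma> (\<phi> v))"
proof -
  have ends: "\<forall>e\<in>edges (net_cball K a r). ends (net_cball K a r) e \<subseteq> verts (net_cball K a r)"
    for K :: "'a network" and a
    by (simp only: net_cball_simps) blast
  note gi = network_iso_cball[OF G, of r] and hi = network_iso_cball[OF H, of r]
  let ?f = "inv_into (verts (net_cball G u r)) \<alpha>" and ?g = "inv_into (edges (net_cball G u r)) \<beta>"
  have gi': "network_iso (=) (net_cball G' (\<alpha> u) r) (net_cball G u r) ?f ?g"
    by (rule network_iso_inv[OF gi ends]) auto
  have "network_iso R (net_cball G' (\<alpha> u) r) (net_cball H w r) (\<phi> \<circ> ?f) (\<psi> \<circ> ?g)"
    by (rule network_iso_comp[OF gi' iso ends]) auto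
  then have "network_iso R (net_cball G' (\<alpha> u) r) (net_cball H' (\<gamma> w) r)
      (\<gamma> \<circ> (\<phi> \<circ> ?f)) (\<delta> \<circ> (\<psi> \<circ> ?g))"
    by (rule network_iso_comp[OF _ hi ends]) auto
  moreover have "?f (\<alpha> v) = v" if "v \<in> verts (net_cball G u r)" for v
    by (rule inv_into_iso[OF gi that])
  ultimately show ?thesis
    by (intro exI[of _ "\<gamma> \<circ> (\<phi> \<circ> ?f)"] exI[of _ "\<delta> \<circ> (\<psi> \<circ> ?g)"]) simp
qed

lift_definition ball_near :: "nat \<Rightarrow> real \<Rightarrow> 'm::polish_space rooted_net \<Rightarrow> 'm rooted_net \<Rightarrow> bool" is
  "\<lambda>r \<epsilon> (G, u) (H, u').
     \<exists>\<phi> \<psi>. network_iso (\<lambda>x y. dist x y < \<epsilon>) (net_cball G u r) (net_cball H u' r) \<phi> \<psi> \<and> \<phi> u = u'"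
proof -
  fix r :: nat and \<epsilon> :: real and x x' y y' :: "'m network \<times> nat"
  let ?P = "\<lambda>(G, u) (H, u').
     \<exists>\<phi> \<psi>. network_iso (\<lambda>x y::'m. dist x y < \<epsilon>) (net_cball G u r) (net_cball H u' r) \<phi> \<psi> \<and> \<phi> u = u'"
  have imp: "?P x' y'" if x: "rooted_iso x x'" and y: "rooted_iso y y'" and P: "?P x y" for x x' y y'
  proof -
    from x obtain G u G' \<alpha> \<beta> where x: "x = (G, u)" "x' = (G', \<alpha> u)"
      and G: "network_iso (=) G G' \<alpha> \<beta>" "is_network G" "u \<in> verts G"
      by (auto simp: rooted_iso_def)
    from y obtain H w H' \<gamma> \<delta> where y: "y = (H, w)" "y' = (H', \<gamma> w)"
      and H: "network_iso (=) H H' \<gamma> \<delta>" "is_network H" "w \<in> verts H"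
      by (auto simp: rooted_iso_def)
    from P obtain \<phi> \<psi> where
      iso: "network_iso (\<lambda>x y. dist x y < \<epsilon>) (net_cball G u r) (net_cball H w r) \<phi> \<psi>" and u: "\<phi> u = w"
      unfolding x y prod.case by blast
    show ?thesis
      unfolding x y prod.case using cball_iso_transfer[OF G H iso] root_in_cball[of u G r] u by metis
  qed
  assume xy: "rooted_iso x x'" "rooted_iso y y'"
  note yx = part_equivp_symp[OF rooted_iso_part_equivp xy(1)]
    part_equivp_symp[OF rooted_iso_part_equivp xy(2)]
  show "?P x y = ?P x' y'"
    by (rule iffI[OF imp[OF xy] imp[OF yx]])
qed

text \<open>
  The premise of \<open>ball_near2\<close> restricts its content to radii \<open>r\<close> that are at least the distance of
  the two roots of the first argument, which plays the role of the limit.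
\<close>

lift_definition ball_near2 ::
  "nat \<Rightarrow> real \<Rightarrow> 'm::polish_space birooted_net \<Rightarrow> 'm birooted_net \<Rightarrow> bool" is
  "\<lambda>r \<epsilon> (G, u, v) (H, u', v'). v \<in> verts (net_cball G u r) \<longrightarrow>
     (\<exists>\<phi> \<psi>. network_iso (\<lambda>x y. dist x y < \<epsilon>) (net_cball G u r) (net_cball H u' r) \<phi> \<psi> \<and>
        \<phi> u = u' \<and> \<phi> v = v')"
proof -
  fix r :: nat and \<epsilon> :: real and x x' y y' :: "'m network \<times> nat \<times> nat"
  let ?P = "\<lambda>(G, u, v) (H, u', v'). v \<in> verts (net_cball G u r) \<longrightarrow>
     (\<exists>\<phi> \<psi>. network_iso (\<lambda>x y::'m. dist x y < \<epsilon>) (net_cball G u r) (net_cball H u' r) \<phi> \<psi> \<and>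
        \<phi> u = u' \<and> \<phi> v = v')"
  have imp: "?P x' y'" if x: "birooted_iso x x'" and y: "birooted_iso y y'" and P: "?P x y" for x x' y y'
  proof -
    from x obtain G u v G' \<alpha> \<beta> where x: "x = (G, u, v)" "x' = (G', \<alpha> u, \<alpha> v)"
      and G: "network_iso (=) G G' \<alpha> \<beta>" "is_network G" "u \<in> verts G" and v: "v \<in> verts G"
      by (auto simp: birooted_iso_def)
    from y obtain H w z H' \<gamma> \<delta> where y: "y = (H, w, z)" "y' = (H', \<gamma> w, \<gamma> z)"
      and H: "network_iso (=) H H' \<gamma> \<delta>" "is_network H" "w \<in> verts H"
      by (auto simp: birooted_iso_def)
    show ?thesis
      unfolding x y prod.case
    proof
      assume "\<alpha> v \<in> verts (net_cball G' (\<alpha> u) r)"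
      then have "\<alpha> v \<in> \<alpha> ` verts (net_cball G u r)"
        using network_isoD(1)[OF network_iso_cball[OF G, of r]]
        by (simp add: bij_betw_def del: net_cball_simps)
      then obtain v' where v': "v' \<in> verts (net_cball G u r)" "\<alpha> v = \<alpha> v'"
        by blast
      have "v' \<in> verts G" using v'(1) net_cball_subset[OF G(2,3)] by blast
      then have "v = v'" using v'(2) v network_isoD(1)[OF G(1)] by (auto simp: bij_betw_def inj_on_def)
      then have v': "v \<in> verts (net_cball G u r)" using v'(1) by simp
      then obtain \<phi> \<psi> where
        iso: "network_iso (\<lambda>x y. dist x y < \<epsilon>) (net_cball G u r) (net_cball H w r) \<phi> \<psi>"
        and u: "\<phi> u = w" "\<phi> v = z"
        using P unfolding x y prod.case by blast
      show "\<exists>\<phi> \<psi>. network_iso (\<lambda>x y::'m. dist x y < \<epsilon>) (net_cball G' (\<alpha> u) r)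
          (net_cball H' (\<gamma> w) r) \<phi> \<psi> \<and> \<phi> (\<alpha> u) = \<gamma> w \<and> \<phi> (\<alpha> v) = \<gamma> z"
        using cball_iso_transfer[OF G H iso] root_in_cball[of u G r] v' u by metis
    qed
  qed
  assume xy: "birooted_iso x x'" "birooted_iso y y'"
  note yx = part_equivp_symp[OF birooted_iso_part_equivp xy(1)]
    part_equivp_symp[OF birooted_iso_part_equivp xy(2)]
  show "?P x y = ?P x' y'"
    by (rule iffI[OF imp[OF xy] imp[OF yx]])
qed

text \<open>
  The local topologies are metrizable, hence determined by their convergent sequences: a set is
  open iff every sequence converging locally to one of its points is eventually in it. The lemmas
  \<open>tendsto_rooted_net_iff\<close> and \<open>tendsto_birooted_net_iff\<close> below confirm that convergence of
  sequences in the resulting topological spaces is exactly local convergence.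
\<close>

definition local_conv :: "(nat \<Rightarrow> 'm::polish_space rooted_net) \<Rightarrow> 'm rooted_net \<Rightarrow> bool" where
  "local_conv X x \<longleftrightarrow> (\<forall>r. \<forall>\<epsilon>>0. \<forall>\<^sub>F n in sequentially. ball_near r \<epsilon> x (X n))"

definition local_conv2 :: "(nat \<Rightarrow> 'm::polish_space birooted_net) \<Rightarrow> 'm birooted_net \<Rightarrow> bool" where
  "local_conv2 X x \<longleftrightarrow> (\<forall>r. \<forall>\<epsilon>>0. \<forall>\<^sub>F n in sequentially. ball_near2 r \<epsilon> x (X n))"

instantiation rooted_net :: (polish_space) topological_space
begin
definition open_rooted_net :: "'a rooted_net set \<Rightarrow> bool" where
  "open_rooted_net U \<longleftrightarrow>
     (\<forall>x\<in>U. \<forall>X. local_conv X x \<longrightarrow> (\<forall>\<^sub>F n in sequentially. X n \<in> U))"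
instance
proof
  show "open (S \<inter> T)" if "open S" "open T" for S T :: "'a rooted_net set"
    using that unfolding open_rooted_net_def by (auto intro: eventually_conj)
  show "open (\<Union>K)" if "\<forall>S\<in>K. open S" for K :: "'a rooted_net set set"
    unfolding open_rooted_net_def
  proof (intro ballI allI impI)
    fix x X assume "x \<in> \<Union>K" "local_conv X x"
    then obtain S where S: "S \<in> K" "x \<in> S" by blast
    then have "open S" using that by blast
    then have "\<forall>\<^sub>F n in sequentially. X n \<in> S"
      unfolding open_rooted_net_def using S(2) \<open>local_conv X x\<close> by blast
    then show "\<forall>\<^sub>F n in sequentially. X n \<in> \<Union>K"
      by (rule eventually_mono) (use S(1) in blast)
  qed
qed (simp add: open_rooted_net_def)
end

instantiation birooted_net :: (polish_space) topological_space
begin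
definition open_birooted_net :: "'a birooted_net set \<Rightarrow> bool" where
  "open_birooted_net U \<longleftrightarrow>
     (\<forall>x\<in>U. \<forall>X. local_conv2 X x \<longrightarrow> (\<forall>\<^sub>F n in sequentially. X n \<in> U))"
instance
proof
  show "open (S \<inter> T)" if "open S" "open T" for S T :: "'a birooted_net set"
    using that unfolding open_birooted_net_def by (auto intro: eventually_conj)
  show "open (\<Union>K)" if "\<forall>S\<in>K. open S" for K :: "'a birooted_net set set"
    unfolding open_birooted_net_def
  proof (intro ballI allI impI)
    fix x X assume "x \<in> \<Union>K" "local_conv2 X x"
    then obtain S where S: "S \<in> K" "x \<in> S" by blast
    then have "open S" using that by blast
    then have "\<forall>\<^sub>F n in sequentially. X n \<in> S"
      unfolding open_birooted_net_def using S(2) \<open>local_conv2 X x\<close> by blast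
    then show "\<forall>\<^sub>F n in sequentially. X n \<in> \<Union>K"
      by (rule eventually_mono) (use S(1) in blast)
  qed
qed (simp add: open_birooted_net_def)
end

lemma rooted_net_cases:
  obtains G u where "x = abs_rooted_net (G, u)" "is_network G" "u \<in> verts G"
    "rooted_iso (G, u) (G, u)"
proof (induct x rule: rooted_net.abs_induct)
  case (1 y)
  then show ?case by (cases y) (auto simp: rooted_iso_def)
qed

lemma birooted_net_cases:
  obtains G u v where "x = abs_birooted_net (G, u, v)" "is_network G" "u \<in> verts G" "v \<in> verts G"
    "birooted_iso (G, u, v) (G, u, v)"
proof (induct x rule: birooted_net.abs_induct)
  case (1 y)
  then show ?case by (cases y) (auto simp: birooted_iso_def)
qed

lemma finite_cball:
  assumes G: "is_network G" "u \<in> verts G"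
  shows "finite (verts (net_cball G u r))" "finite (edges (net_cball G u r))"
proof -
  have fe: "finite (ends G e)" "ends G e \<noteq> {}" if "e \<in> edges G" for e
  proof -
    have "card (ends G e) \<in> {1, 2}" using G(1) that unfolding is_network_def by blast
    then have "card (ends G e) > 0" by auto
    then show "finite (ends G e)" "ends G e \<noteq> {}" by (auto simp: card_gt_0_iff)
  qed
  have inc: "finite {e \<in> edges G. v \<in> ends G e}" if "v \<in> verts G" for v
    using G(1) that unfolding is_network_def by blast
  have fin: "finite {v. (adj G ^^ n) u v}" for n
  proof (induction n)
    case (Suc n)
    let ?S = "{v. (adj G ^^ n) u v}"
    have sub: "w \<in> verts G" if "w \<in> ?S" for w
      using adj_pow_verts[OF is_networkD[OF G(1)] G(2)] that by blast
    have "finite (\<Union>w\<in>?S. \<Union>e\<in>{e \<in> edges G. w \<in> ends G e}. ends G e)"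
      using Suc inc[OF sub] fe(1) by (intro finite_UN_I) auto
    moreover have "{v. (adj G ^^ Suc n) u v} \<subseteq> (\<Union>w\<in>?S. \<Union>e\<in>{e \<in> edges G. w \<in> ends G e}. ends G e)"
      by (auto simp: adj_def relcompp.simps)
    ultimately show ?case by (rule finite_subset[rotated])
  qed simp
  have "verts (net_cball G u r) = (\<Union>n\<in>{..r}. {v. (adj G ^^ n) u v})" by auto
  then show V: "finite (verts (net_cball G u r))" using fin by simp
  have "edges (net_cball G u r) \<subseteq> (\<Union>v\<in>verts (net_cball G u r). {e \<in> edges G. v \<in> ends G e})"
    unfolding net_cball_simps(2) using fe(2) by fast
  moreover have "finite (\<Union>v\<in>verts (net_cball G u r). {e \<in> edges G. v \<in> ends G e})"
    by (intro finite_UN_I[OF V] inc subsetD[OF net_cball_subset[OF G]])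
  ultimately show "finite (edges (net_cball G u r))" by (rule finite_subset)
qed

lemma finite_uniform_gap:
  fixes D :: "real set"
  assumes "finite D" "\<And>d. d \<in> D \<Longrightarrow> d < \<epsilon>"
  shows "\<exists>\<delta>>0. \<forall>d\<in>D. d + \<delta> \<le> \<epsilon>"
proof (cases "D = {}")
  case False
  then have "Max D < \<epsilon>" using assms by simp
  moreover have "d \<le> Max D" if "d \<in> D" for d using that assms(1) by simp
  ultimately show ?thesis by (intro exI[of _ "\<epsilon> - Max D"]) force
qed (auto intro: exI[of _ 1])

lemma cball_iso_gap:
  fixes G H :: "'m::polish_space network"
  assumes G: "is_network G" "u \<in> verts G"
    and iso: "network_iso (\<lambda>x y. dist x y < \<epsilon>) (net_cball G u r) K \<phi> \<psi>"
  shows "\<exists>\<delta>>0. \<forall>L \<phi>' \<psi>'. network_iso (\<lambda>x y. dist x y < \<delta>) K L \<phi>' \<psi>' \<longrightarrow>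
     network_iso (\<lambda>x y. dist x y < \<epsilon>) (net_cball G u r) L (\<phi>' \<circ> \<phi>) (\<psi>' \<circ> \<psi>)"
proof -
  let ?B = "net_cball G u r"
  let ?D1 = "(\<lambda>v. dist (vmark ?B v) (vmark K (\<phi> v))) ` verts ?B"
  let ?D2 = "(\<lambda>(e, v). dist (emark ?B v e) (emark K (\<phi> v) (\<psi> e))) ` (SIGMA e:edges ?B. ends ?B e)"
  have sub: "\<forall>e\<in>edges ?B. ends ?B e \<subseteq> verts ?B"
    by (simp only: net_cball_simps) blast
  have "finite (SIGMA e:edges ?B. ends ?B e)"
    by (intro finite_SigmaI finite_cball[OF G] finite_subset[OF bspec[OF sub] finite_cball(1)[OF G]])
  then have "finite (?D1 \<union> ?D2)" using finite_cball(1)[OF G] by blast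
  moreover have "d < \<epsilon>" if "d \<in> ?D1 \<union> ?D2" for d
    using that network_isoD(6,7)[OF iso] by (auto simp del: net_cball_simps)
  ultimately obtain \<delta> where \<delta>: "\<delta> > 0" "\<forall>d\<in>?D1 \<union> ?D2. d + \<delta> \<le> \<epsilon>"
    using finite_uniform_gap[of "?D1 \<union> ?D2" \<epsilon>] by blast
  have iso': "network_iso (\<lambda>x y. dist x y + \<delta> \<le> \<epsilon>) ?B K \<phi> \<psi>"
    using network_isoD(1,2,5)[OF iso] \<delta>(2) unfolding network_iso_def
    by (auto simp del: net_cball_simps)
  have "network_iso (\<lambda>x y. dist x y < \<epsilon>) ?B L (\<phi>' \<circ> \<phi>) (\<psi>' \<circ> \<psi>)"
    if "network_iso (\<lambda>x y. dist x y < \<delta>) K L \<phi>' \<psi>'" for L \<phi>' \<psi>'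
  proof (rule network_iso_comp[OF iso' that sub])
    fix x y z :: 'm assume "dist x y + \<delta> \<le> \<epsilon>" "dist y z < \<delta>"
    then show "dist x z < \<epsilon>" using dist_triangle[of x z y] by linarith
  qed
  then show ?thesis using \<delta>(1) by blast
qed

lemma network_iso_dist_refl: "\<epsilon> > 0 \<Longrightarrow> network_iso (\<lambda>x y. dist x y < \<epsilon>) K K id id"
  for K :: "'m::metric_space network"
  by (auto simp: network_iso_def)

lemma ball_near_refl: "\<epsilon> > 0 \<Longrightarrow> ball_near r \<epsilon> x x"
proof (cases x rule: rooted_net_cases)
  case (1 G u)
  then show "\<epsilon> > 0 \<Longrightarrow> ball_near r \<epsilon> x x"
    using network_iso_dist_refl[of \<epsilon> "net_cball G u r"]
    by (auto simp: ball_near.abs_eq intro!: exI[of _ id])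
qed

lemma ball_near2_refl: "\<epsilon> > 0 \<Longrightarrow> ball_near2 r \<epsilon> x x"
proof (cases x rule: birooted_net_cases)
  case (1 G u v)
  have "v \<in> verts (net_cball G u r) \<longrightarrow> (\<exists>\<phi> \<psi>. network_iso (\<lambda>x y. dist x y < \<epsilon>)
      (net_cball G u r) (net_cball G u r) \<phi> \<psi> \<and> \<phi> u = u \<and> \<phi> v = v)" if "\<epsilon> > 0"
    by (intro impI exI[of _ id] conjI network_iso_dist_refl[OF that] id_apply)
  with 1 show "\<epsilon> > 0 \<Longrightarrow> ball_near2 r \<epsilon> x x"
    by (simp add: ball_near2.abs_eq del: net_cball_simps)
qed

lemma ball_near_gap:
  assumes "ball_near r \<epsilon> x y"
  shows "\<exists>\<delta>>0. \<forall>z. ball_near r \<delta> y z \<longrightarrow> ball_near r \<epsilon> x z"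
proof -
  obtain G u where x: "x = abs_rooted_net (G, u)" "is_network G" "u \<in> verts G" "rooted_iso (G, u) (G, u)"
    by (cases x rule: rooted_net_cases) (rule that)
  obtain H w where y: "y = abs_rooted_net (H, w)" "rooted_iso (H, w) (H, w)"
    by (cases y rule: rooted_net_cases) (rule that)
  obtain \<phi> \<psi> where iso: "network_iso (\<lambda>x y. dist x y < \<epsilon>) (net_cball G u r) (net_cball H w r) \<phi> \<psi>"
    and u: "\<phi> u = w"
    using assms unfolding x(1) y(1) ball_near.abs_eq[OF x(4) y(2)] prod.case by blast
  obtain \<delta> where \<delta>: "\<delta> > 0" "\<And>L \<phi>' \<psi>'. network_iso (\<lambda>x y. dist x y < \<delta>) (net_cball H w r) L \<phi>' \<psi>' \<Longrightarrow>
     network_iso (\<lambda>x y. dist x y < \<epsilon>) (net_cball G u r) L (\<phi>' \<circ> \<phi>) (\<psi>' \<circ> \<psi>)"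
    using cball_iso_gap[OF x(2,3) iso] by blast
  have "ball_near r \<epsilon> x z" if near: "ball_near r \<delta> y z" for z
  proof -
    obtain K a where z: "z = abs_rooted_net (K, a)" "rooted_iso (K, a) (K, a)"
      by (cases z rule: rooted_net_cases) (rule that)
    obtain \<phi>' \<psi>' where "network_iso (\<lambda>x y. dist x y < \<delta>) (net_cball H w r) (net_cball K a r) \<phi>' \<psi>'" "\<phi>' w = a"
      using near unfolding y(1) z(1) ball_near.abs_eq[OF y(2) z(2)] prod.case by blast
    then have "network_iso (\<lambda>x y. dist x y < \<epsilon>) (net_cball G u r) (net_cball K a r) (\<phi>' \<circ> \<phi>) (\<psi>' \<circ> \<psi>)"
      "(\<phi>' \<circ> \<phi>) u = a"
      using \<delta>(2) u by auto
    then show ?thesis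
      unfolding x(1) z(1) ball_near.abs_eq[OF x(4) z(2)] prod.case by blast
  qed
  then show ?thesis using \<delta>(1) by blast
qed

lemma ball_near2_gap:
  assumes "ball_near2 r \<epsilon> x y"
  shows "\<exists>\<delta>>0. \<forall>z. ball_near2 r \<delta> y z \<longrightarrow> ball_near2 r \<epsilon> x z"
proof -
  obtain G u v where x: "x = abs_birooted_net (G, u, v)" "is_network G" "u \<in> verts G"
    "birooted_iso (G, u, v) (G, u, v)"
    by (cases x rule: birooted_net_cases) (rule that)
  show ?thesis
  proof (cases "v \<in> verts (net_cball G u r)")
    case False
    have "ball_near2 r \<epsilon> x z" for z
    proof -
      obtain K a b where z: "z = abs_birooted_net (K, a, b)" "birooted_iso (K, a, b) (K, a, b)"
        by (cases z rule: birooted_net_cases) (rule that)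
      show ?thesis
        unfolding x(1) z(1) ball_near2.abs_eq[OF x(4) z(2)] prod.case using False by blast
    qed
    then show ?thesis using zero_less_one by blast
  next
    case True
    obtain H w t where y: "y = abs_birooted_net (H, w, t)" "birooted_iso (H, w, t) (H, w, t)"
      by (cases y rule: birooted_net_cases) (rule that)
    obtain \<phi> \<psi> where iso: "network_iso (\<lambda>x y. dist x y < \<epsilon>) (net_cball G u r) (net_cball H w r) \<phi> \<psi>"
      and u: "\<phi> u = w" "\<phi> v = t"
      using assms True unfolding x(1) y(1) ball_near2.abs_eq[OF x(4) y(2)] prod.case by blast
    have t: "t \<in> verts (net_cball H w r)" using network_isoD(3)[OF iso True] u(2) by blast
    obtain \<delta> where \<delta>: "\<delta> > 0" "\<And>L \<phi>' \<psi>'. network_iso (\<lambda>x y. dist x y < \<delta>) (net_cball H w r) L \<phi>' \<psi>' \<Longrightarrow>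
       network_iso (\<lambda>x y. dist x y < \<epsilon>) (net_cball G u r) L (\<phi>' \<circ> \<phi>) (\<psi>' \<circ> \<psi>)"
      using cball_iso_gap[OF x(2,3) iso] by blast
    have "ball_near2 r \<epsilon> x z" if near: "ball_near2 r \<delta> y z" for z
    proof -
      obtain K a b where z: "z = abs_birooted_net (K, a, b)" "birooted_iso (K, a, b) (K, a, b)"
        by (cases z rule: birooted_net_cases) (rule that)
      obtain \<phi>' \<psi>' where "network_iso (\<lambda>x y. dist x y < \<delta>) (net_cball H w r) (net_cball K a r) \<phi>' \<psi>'"
        "\<phi>' w = a" "\<phi>' t = b"
        using near t unfolding y(1) z(1) ball_near2.abs_eq[OF y(2) z(2)] prod.case by blast
      then have "network_iso (\<lambda>x y. dist x y < \<epsilon>) (net_cball G u r) (net_cball K a r) (\<phi>' \<circ> \<phi>) (\<psi>' \<circ> \<psi>)"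
        "(\<phi>' \<circ> \<phi>) u = a" "(\<phi>' \<circ> \<phi>) v = b"
        using \<delta>(2) u by auto
      then show ?thesis
        unfolding x(1) z(1) ball_near2.abs_eq[OF x(4) z(2)] prod.case by blast
    qed
    then show ?thesis using \<delta>(1) by blast
  qed
qed

lemma tendsto_rooted_net_iff: "X \<longlonglongrightarrow> x \<longleftrightarrow> local_conv X x"
  for x :: "'m::polish_space rooted_net"
proof
  assume X: "X \<longlonglongrightarrow> x"
  show "local_conv X x"
    unfolding local_conv_def
  proof (intro allI impI)
    fix r and \<epsilon> :: real assume "\<epsilon> > 0"
    let ?S = "{y. ball_near r \<epsilon> x y}"
    have "open ?S"
      unfolding open_rooted_net_def
    proof (intro ballI allI impI)
      fix y Y assume "y \<in> ?S" and Y: "local_conv Y y"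
      then obtain \<delta> where \<delta>: "\<delta> > 0" "\<And>z. ball_near r \<delta> y z \<Longrightarrow> ball_near r \<epsilon> x z"
        using ball_near_gap[of r \<epsilon> x y] by blast
      have "\<forall>\<^sub>F n in sequentially. ball_near r \<delta> y (Y n)"
        using Y \<delta>(1) unfolding local_conv_def by blast
      then show "\<forall>\<^sub>F n in sequentially. Y n \<in> ?S"
        by (rule eventually_mono) (use \<delta>(2) in blast)
    qed
    moreover have "x \<in> ?S" using ball_near_refl[OF \<open>\<epsilon> > 0\<close>] by blast
    ultimately show "\<forall>\<^sub>F n in sequentially. ball_near r \<epsilon> x (X n)"
      using topological_tendstoD[OF X, of ?S] by simp
  qed
next
  assume "local_conv X x"
  then show "X \<longlonglongrightarrow> x"
    by (intro topological_tendstoI) (simp add: open_rooted_net_def)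
qed

lemma tendsto_birooted_net_iff: "X \<longlonglongrightarrow> x \<longleftrightarrow> local_conv2 X x"
  for x :: "'m::polish_space birooted_net"
proof
  assume X: "X \<longlonglongrightarrow> x"
  show "local_conv2 X x"
    unfolding local_conv2_def
  proof (intro allI impI)
    fix r and \<epsilon> :: real assume "\<epsilon> > 0"
    let ?S = "{y. ball_near2 r \<epsilon> x y}"
    have "open ?S"
      unfolding open_birooted_net_def
    proof (intro ballI allI impI)
      fix y Y assume "y \<in> ?S" and Y: "local_conv2 Y y"
      then obtain \<delta> where \<delta>: "\<delta> > 0" "\<And>z. ball_near2 r \<delta> y z \<Longrightarrow> ball_near2 r \<epsilon> x z"
        using ball_near2_gap[of r \<epsilon> x y] by blast
      have "\<forall>\<^sub>F n in sequentially. ball_near2 r \<delta> y (Y n)"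
        using Y \<delta>(1) unfolding local_conv2_def by blast
      then show "\<forall>\<^sub>F n in sequentially. Y n \<in> ?S"
        by (rule eventually_mono) (use \<delta>(2) in blast)
    qed
    moreover have "x \<in> ?S" using ball_near2_refl[OF \<open>\<epsilon> > 0\<close>] by blast
    ultimately show "\<forall>\<^sub>F n in sequentially. ball_near2 r \<epsilon> x (X n)"
      using topological_tendstoD[OF X, of ?S] by simp
  qed
next
  assume "local_conv2 X x"
  then show "X \<longlonglongrightarrow> x"
    by (intro topological_tendstoI) (simp add: open_birooted_net_def)
qed

text \<open>
  The notions below depend on a random rooted network only through its law and are therefore stated
  for laws on the Borel sigma-algebra of \<^typ>\<open>'m rooted_net\<close>. A graph is a network with marks in
  \<^typ>\<open>unit\<close>.
\<close>

definition unimodular :: "'m::polish_space rooted_net measure \<Rightarrow> bool" where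
  "unimodular \<mu> \<longleftrightarrow>
     (\<forall>g :: 'm birooted_net \<Rightarrow> real. g \<in> borel_measurable borel \<longrightarrow> (\<forall>d. 0 \<le> g d) \<longrightarrow>
        (\<integral>\<^sup>+ x. root_sum (\<lambda>d. ennreal (g d)) x \<partial>\<mu>) =
        (\<integral>\<^sup>+ x. root_sum (\<lambda>d. ennreal (g (swap_roots d))) x \<partial>\<mu>))"

text \<open>Marks 0 and 1 are \<open>False\<close> and \<open>True\<close>; the irrelevant marks of pairs \<open>(v, e)\<close> are constant.\<close>

definition mark_vertices :: "unit network \<Rightarrow> (nat \<Rightarrow> bool) \<Rightarrow> bool network" where
  "mark_vertices G m = Network (verts G) (edges G) (ends G) m (\<lambda>_ _. False)"

lemma mark_vertices_simps [simp]:
  "verts (mark_vertices G m) = verts G" "edges (mark_vertices G m) = edges G"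
  "ends (mark_vertices G m) = ends G" "vmark (mark_vertices G m) = m"
  "emark (mark_vertices G m) v e = False"
  by (simp_all add: mark_vertices_def)

lemma is_network_cong:
  assumes "verts G = verts H" "edges G = edges H" "ends G = ends H"
  shows "is_network G \<longleftrightarrow> is_network H"
proof -
  have "adj G = adj H" using assms by (auto simp: adj_def fun_eq_iff)
  then show ?thesis using assms by (simp add: is_network_def)
qed

lemma distr_transport:
  assumes [measurable]: "t \<in> measurable P P'" "s \<in> measurable P' P"
    and distr: "distr P P' t = P'"
    and ts: "\<And>y. y \<in> space P' \<Longrightarrow> t (s y) = y"
    and f: "\<And>x. x \<in> space P \<Longrightarrow> f' (t x) = f x"
  shows "distr P' N f' = distr P N f"
proof -
  have "emeasure P' (f' -` A \<inter> space P') = emeasure P (f -` A \<inter> space P)" for A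
  proof -
    let ?B = "f' -` A \<inter> space P'" and ?C = "f -` A \<inter> space P"
    have C: "?C = t -` ?B \<inter> space P"
      using f measurable_space[OF assms(1)] by auto
    show ?thesis
    proof (cases "?B \<in> sets P'")
      case True
      have "emeasure P' ?B = emeasure (distr P P' t) ?B" by (simp add: distr)
      also have "\<dots> = emeasure P ?C"
        unfolding C by (rule emeasure_distr[OF assms(1) True])
      finally show ?thesis .
    next
      case False
      have "?C \<notin> sets P"
      proof
        assume "?C \<in> sets P"
        then have "s -` ?C \<inter> space P' \<in> sets P'" by (rule measurable_sets[OF assms(2)])
        moreover have "s -` ?C \<inter> space P' = ?B"
          unfolding C using ts measurable_space[OF assms(2)] by auto
        ultimately show False using False by simp
      qed
      with False show ?thesis by (simp add: emeasure_notin_sets)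
    qed
  qed
  then show ?thesis by (simp add: distr_def)
qed

text \<open>\<open>iid_marking p [G, u]\<close> is the law of \<open>[G, u]\<close> with i.i.d. Bernoulli(\<open>p\<close>) vertex marks.\<close>

lift_definition iid_marking :: "real \<Rightarrow> unit rooted_net \<Rightarrow> bool rooted_net measure" is
  "\<lambda>p (G, u). distr (\<Pi>\<^sub>M v\<in>verts G. measure_pmf (bernoulli_pmf p)) borel
     (\<lambda>m. abs_rooted_net (mark_vertices G m, u))"
proof -
  fix p :: real and x y :: "unit network \<times> nat"
  let ?\<mu> = "\<lambda>V. \<Pi>\<^sub>M v\<in>V. measure_pmf (bernoulli_pmf p)"
  let ?m = "\<lambda>G u m. abs_rooted_net (mark_vertices G m, u)"
  assume "rooted_iso x y"
  then obtain G u H \<phi> \<psi> where *: "x = (G, u)" "y = (H, \<phi> u)" "is_network G" "is_network H"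
      "u \<in> verts G" "\<phi> u \<in> verts H" "network_iso (=) G H \<phi> \<psi>"
    by (auto simp: rooted_iso_def)
  let ?f = "inv_into (verts G) \<phi>"
  let ?t = "\<lambda>\<omega>. \<lambda>v\<in>verts G. \<omega> (\<phi> v)" and ?s = "\<lambda>\<omega>. \<lambda>v\<in>verts H. \<omega> (?f v)"
  have bij: "bij_betw \<phi> (verts G) (verts H)" by (rule network_isoD(1)[OF *(7)])
  have \<phi>: "\<phi> v \<in> verts H" "?f (\<phi> v) = v" if "v \<in> verts G" for v
    using that bij by (auto simp: bij_betw_def)
  have f: "?f v \<in> verts G" if "v \<in> verts H" for v
    using that bij by (auto simp: bij_betw_def inv_into_into)
  have "distr (?\<mu> (verts G)) borel (?m G u) = distr (?\<mu> (verts H)) borel (?m H (\<phi> u))"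
  proof (rule distr_transport[where t = ?t and s = ?s])
    show "?t \<in> measurable (?\<mu> (verts H)) (?\<mu> (verts G))"
      using \<phi>(1) by (intro measurable_restrict measurable_component_singleton) auto
    show "?s \<in> measurable (?\<mu> (verts G)) (?\<mu> (verts H))"
      using f by (intro measurable_restrict measurable_component_singleton) auto
    show "distr (?\<mu> (verts H)) (?\<mu> (verts G)) ?t = ?\<mu> (verts G)"
      using \<phi>(1) bij
      by (intro distr_PiM_reindex) (auto simp: bij_betw_def intro: measure_pmf.prob_space_axioms)
    show "?t (?s \<omega>) = \<omega>" if "\<omega> \<in> space (?\<mu> (verts G))" for \<omega>
      using that \<phi> by (auto simp: space_PiM PiE_def extensional_def fun_eq_iff)
    show "?m G u (?t \<omega>) = ?m H (\<phi> u) \<omega>" for \<omega>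
    proof (rule Quotient_rel_abs[OF Quotient_rooted_net], rule rooted_isoI[where \<phi> = \<phi> and \<psi> = \<psi>])
      show "network_iso (=) (mark_vertices G (?t \<omega>)) (mark_vertices H \<omega>) \<phi> \<psi>"
        using network_isoD(1,2,5)[OF *(7)] by (simp add: network_iso_def)
      show "is_network (mark_vertices G (?t \<omega>))"
        using *(3) is_network_cong[of G "mark_vertices G (?t \<omega>)"] by simp
      show "is_network (mark_vertices H \<omega>)"
        using *(4) is_network_cong[of H "mark_vertices H \<omega>"] by simp
    qed (use * in simp_all)
  qed
  then show "(case x of (G, u) \<Rightarrow> distr (?\<mu> (verts G)) borel (?m G u)) =
      (case y of (G, u) \<Rightarrow> distr (?\<mu> (verts G)) borel (?m G u))"
    using * by simp
qed

definition iid_marked :: "real \<Rightarrow> unit rooted_net measure \<Rightarrow> bool rooted_net measure" where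
  "iid_marked p \<mu> = \<mu> \<bind> iid_marking p"

lift_definition force_root_mark :: "bool rooted_net \<Rightarrow> bool rooted_net" is
  "\<lambda>(G, u). (Network (verts G) (edges G) (ends G) ((vmark G)(u := True)) (emark G), u)"
proof -
  fix x y :: "bool network \<times> nat"
  let ?F = "\<lambda>(G, u). (Network (verts G) (edges G) (ends G) ((vmark G)(u := True)) (emark G), u)"
  assume "rooted_iso x y"
  then obtain G u H \<phi> \<psi> where *: "x = (G, u)" "y = (H, \<phi> u)" "is_network G" "is_network H"
      "u \<in> verts G" "\<phi> u \<in> verts H" "network_iso (=) G H \<phi> \<psi>"
    by (auto simp: rooted_iso_def)
  let ?G = "fst (?F (G, u))" and ?H = "fst (?F (H, \<phi> u))"
  have inj: "\<phi> v = \<phi> u \<longleftrightarrow> v = u" if "v \<in> verts G" for v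
    using that *(5) network_isoD(1)[OF *(7)] by (auto simp: bij_betw_def inj_on_def)
  have "network_iso (=) ?G ?H \<phi> \<psi>"
    unfolding network_iso_def
  proof (intro conjI ballI)
    show "vmark ?G v = vmark ?H (\<phi> v)" if "v \<in> verts ?G" for v
      using that inj[of v] network_isoD(6)[OF *(7), of v] by (simp add: fun_upd_def)
    show "emark ?G v e = emark ?H (\<phi> v) (\<psi> e)" if "e \<in> edges ?G" "v \<in> ends ?G e" for e v
      using that network_isoD(7)[OF *(7), of e v] by simp
  qed (use network_isoD(1,2,5)[OF *(7)] in simp_all)
  moreover have "is_network ?G"
    by (rule is_network_cong[THEN iffD1, OF _ _ _ *(3)]) simp_all
  moreover have "is_network ?H"
    by (rule is_network_cong[THEN iffD1, OF _ _ _ *(4)]) simp_all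
  ultimately have "rooted_iso (?G, u) (?H, \<phi> u)"
    by (rule rooted_isoI[OF _ refl]) (use *(5,6) in simp_all)
  then show "rooted_iso (?F x) (?F y)"
    using *(1,2) by simp
qed

text \<open>\<open>root_change T \<mu> \<nu>\<close>: \<open>\<nu>\<close> is the law of the root-change by kernel \<open>T\<close> of a network with law \<open>\<mu>\<close>.\<close>

definition root_change ::
  "('m::polish_space birooted_net \<Rightarrow> real) \<Rightarrow> 'm rooted_net measure \<Rightarrow> 'm rooted_net measure \<Rightarrow> bool"
where
  "root_change T \<mu> \<nu> \<longleftrightarrow>
     T \<in> borel_measurable borel \<and> (\<forall>d. 0 \<le> T d) \<and>
     (AE x in \<mu>. root_sum (\<lambda>d. ennreal (T d)) x = 1) \<and>
     sets \<nu> = sets borel \<and>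
     (\<forall>A\<in>sets borel. emeasure \<nu> A =
        (\<integral>\<^sup>+ x. root_sum (\<lambda>d. ennreal (T d) * indicator A (second_rooted d)) x \<partial>\<mu>))"

end

theory Submission
  imports Defs
begin

text \<open>
  Let \<open>P\<close> be the law of the marked network. It is unimodular again. Hence a transport \<open>T\<close> under which
  almost surely every vertex sends out mass \<open>1\<close> and every vertex \<open>v\<close> receives mass \<open>1/p\<close> or \<open>0\<close>,
  according to whether \<open>v\<close> has mark \<open>1\<close> or \<open>0\<close>, is a root-change kernel, and by mass transport the law
  of the new rooted network has density \<open>1{m(o) = 1} / p\<close> with respect to \<open>P\<close>. Since the mark of the
  root is independent of everything else, this is the law of the network with the root mark forced to
  be \<open>1\<close> (\<open>emeasure_iid_marked_root_mark\<close>). It remains to construct \<open>T\<close>.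

  The transport is obtained greedily. Fix a symmetric positive kernel \<open>K\<close> of total mass at most \<open>1\<close>. In
  each of infinitely many rounds, every vertex \<open>u\<close> sends to every vertex \<open>v\<close> the fraction \<open>K(u,v)\<close> of
  the minimum of the supply left at \<open>u\<close> and the demand left at \<open>v\<close>. In the limit, supply left at \<open>u\<close> and
  demand left at \<open>v\<close> cannot both be positive, as otherwise a fixed positive amount would travel from
  \<open>u\<close> to \<open>v\<close> in every round. So on each network either all supply is used or all demand is met
  (\<open>maximal_transport_exists\<close>).

  Let \<open>I\<close> be the event that all supply is used. It does not depend on the root. If the mark of the root
  is independent of such events, the mean supply \<open>P(I)\<close> and the mean demand \<open>P(I, m(o) = 1) / p\<close> on
  \<open>I\<close> coincide, and so do they on the complement. As mass transport preserves means on \<open>I\<close> and on its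
  complement, nothing is left over on either side.

  The independence (\<open>invariant_indep_root_mark\<close>) is where unimodularity meets infiniteness. For a fixed
  graph, let \<open>D(v)\<close> be the covariance of \<open>1\<^sub>I\<close> with the mark of \<open>v\<close>. The centred marks are orthogonal
  with variance at most \<open>1\<close>, so Bessel's inequality gives \<open>\<Sum>\<^sub>v D(v)\<^sup>2 \<le> 1\<close>. If every vertex sends mass
  \<open>D(v)\<^sup>2\<close> to every vertex \<open>v\<close>, the root sends out at most \<open>1\<close> but receives \<open>D(o)\<^sup>2\<close> from
  infinitely many vertices; therefore \<open>D(o) = 0\<close> almost surely.

  Measurability rests on one observation. For marks in a two-point space, every open set of
  doubly-rooted networks is a countable union of sets that are decided by a ball of some fixed
  radius about the first root (\<open>local_set\<close>). These sets are closed under intersection, so for sums over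
  vertices and for the marking kernel it suffices to look at functions of a finite ball.
\<close>

section \<open>Balls in networks\<close>

lemma adj_sym: "adj G u v \<Longrightarrow> adj G v u"
  by (auto simp: adj_def insert_commute)

lemma adj_pow_sym: "(adj G ^^ n) u v \<Longrightarrow> (adj G ^^ n) v u"
proof (induction n arbitrary: v)
  case (Suc n)
  then obtain w where "(adj G ^^ n) u w" "adj G w v" by auto
  then show ?case using Suc.IH adj_sym relpowp_Suc_I2 by metis
qed simp

lemma verts_in_some_cball:
  assumes "is_network G" "u \<in> verts G" "v \<in> verts G"
  obtains r where "v \<in> verts (net_cball G u r)"
proof -
  have "(adj G)\<^sup>*\<^sup>* u v" using assms by (auto simp: is_network_def)
  then obtain n where "(adj G ^^ n) u v" by (auto simp: rtranclp_power)
  then show thesis by (intro that[of n]) auto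
qed

lemma in_cball_sym: "v \<in> verts (net_cball G u r) \<Longrightarrow> u \<in> verts (net_cball G v r)"
  using adj_pow_sym[of _ G u v] by auto

lemma verts_cball_mono: "r \<le> s \<Longrightarrow> verts (net_cball G u r) \<subseteq> verts (net_cball G u s)"
  by (auto intro: order_trans)

lemma in_cball_trans:
  assumes "v \<in> verts (net_cball G u d)" "w \<in> verts (net_cball G v r)"
  shows "w \<in> verts (net_cball G u (d + r))"
proof -
  obtain m n where "m \<le> d" "(adj G ^^ m) u v" "n \<le> r" "(adj G ^^ n) v w"
    using assms by auto
  then have "m + n \<le> d + r" "(adj G ^^ (m + n)) u w"
    by (auto simp: relpowp_add)
  then show ?thesis by auto
qed

lemma adj_cball:
  "adj (net_cball G u R) v w \<longleftrightarrow>
     adj G v w \<and> v \<in> verts (net_cball G u R) \<and> w \<in> verts (net_cball G u R)"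
proof -
  have "ends G e \<subseteq> B \<longleftrightarrow> v \<in> B \<and> w \<in> B" if "ends G e = {v, w}" for e B
    using that by simp
  then show ?thesis
    unfolding adj_def net_cball_simps(2,3) by fast
qed

text \<open>
  Walks of length \<open>n\<close> from \<open>v\<close> stay within distance \<open>d + n\<close> of \<open>u\<close>.
\<close>

lemma adj_cball_pow:
  assumes "v \<in> verts (net_cball G u d)" "d + n \<le> R" "(adj G ^^ n) v w"
  shows "(adj (net_cball G u R) ^^ n) v w"
  using assms(2,3)
proof (induction n arbitrary: w)
  case (Suc n)
  then obtain w' where w': "(adj G ^^ n) v w'" "adj G w' w" by auto
  have "w' \<in> verts (net_cball G v n)" "w \<in> verts (net_cball G v (Suc n))"
    using w'(1) Suc.prems(2) unfolding net_cball_simps by blast+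
  then have "w' \<in> verts (net_cball G u (d + n))" "w \<in> verts (net_cball G u (d + Suc n))"
    using in_cball_trans[OF assms(1)] by blast+
  then have "w' \<in> verts (net_cball G u R)" "w \<in> verts (net_cball G u R)"
    using Suc.prems(1) verts_cball_mono[of "d + n" R G u] verts_cball_mono[of "d + Suc n" R G u]
    by (simp_all add: subset_iff del: net_cball_simps)
  then show ?case
    using Suc w' adj_cball[of G u R w' w] by (auto intro: relcomppI)
qed simp

lemma adj_pow_cballD: "(adj (net_cball G u R) ^^ n) v w \<Longrightarrow> (adj G ^^ n) v w"
  by (erule relpowp_mono[rotated]) (simp only: adj_cball)

text \<open>
  Walks of length at most \<open>r\<close> from \<open>v\<close> do not leave the ball of radius \<open>R\<close> about \<open>u\<close>, so restricting
  the network to that ball does not affect the ball of radius \<open>r\<close> about \<open>v\<close>.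
\<close>

lemma cball_cball:
  assumes "v \<in> verts (net_cball G u d)" "d + r \<le> R"
  shows "net_cball (net_cball G u R) v r = net_cball G v r"
proof -
  have "(adj (net_cball G u R) ^^ n) v w \<longleftrightarrow> (adj G ^^ n) v w" if "n \<le> r" for n w
    using adj_cball_pow[OF assms(1), of n R w] adj_pow_cballD[of n G u R v w] that assms(2) by linarith
  then have V: "verts (net_cball (net_cball G u R) v r) = verts (net_cball G v r)"
    unfolding net_cball_simps(1)[of _ v r] by blast
  have "verts (net_cball G v r) \<subseteq> verts (net_cball G u R)"
    using in_cball_trans[OF assms(1)] verts_cball_mono[OF assms(2), of G u] by blast
  then have "edges (net_cball (net_cball G u R) v r) = edges (net_cball G v r)"
    unfolding net_cball_simps(2)[of _ v r] V net_cball_simps(3) net_cball_simps(2)[of G u R] by blast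
  with V show ?thesis
    by (intro network.expand conjI) (simp_all del: net_cball_simps(1,2))
qed

lemma is_network_cball:
  assumes "is_network G" "u \<in> verts G"
  shows "is_network (net_cball G u R)"
  unfolding is_network_def
proof (intro conjI ballI)
  let ?B = "net_cball G u R"
  have BG: "verts ?B \<subseteq> verts G" by (rule net_cball_subset[OF assms])
  have edge: "e \<in> edges G" "ends G e \<subseteq> verts ?B" if "e \<in> edges ?B" for e
    using that unfolding net_cball_simps(2) by blast+
  show "ends ?B e \<subseteq> verts ?B" if "e \<in> edges ?B" for e
    using edge[OF that] by (simp del: net_cball_simps(1))
  show "card (ends ?B e) \<in> {1, 2}" if "e \<in> edges ?B" for e
    using edge[OF that] assms(1) unfolding is_network_def net_cball_simps(3) by blast
  show "finite {e \<in> edges ?B. v \<in> ends ?B e}" if "v \<in> verts ?B" for v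
  proof (rule finite_subset)
    show "{e \<in> edges ?B. v \<in> ends ?B e} \<subseteq> {e \<in> edges G. v \<in> ends G e}"
      using edge(1) unfolding net_cball_simps(3) by blast
    show "finite {e \<in> edges G. v \<in> ends G e}"
      using BG that assms(1) unfolding is_network_def by blast
  qed
  have "(adj ?B)\<^sup>*\<^sup>* u a \<and> (adj ?B)\<^sup>*\<^sup>* a u" if a: "a \<in> verts ?B" for a
  proof -
    obtain n where "n \<le> R" "(adj G ^^ n) u a" using a by auto
    then have "(adj ?B ^^ n) u a"
      using adj_cball_pow[OF root_in_cball, of 0 n R G u a] by simp
    then show ?thesis using adj_pow_sym relpowp_imp_rtranclp by metis
  qed
  then show "(adj ?B)\<^sup>*\<^sup>* a b" if "a \<in> verts ?B" "b \<in> verts ?B" for a b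
    using that rtranclp_trans by metis
qed

text \<open>
  This is how an isomorphism of large balls about one root yields an isomorphism of smaller balls
  about any other vertex. All continuity statements about moving the root rest on it.
\<close>

lemma cball_iso_shift:
  assumes iso: "network_iso S (net_cball G u R) (net_cball H (\<phi> u) R) \<phi> \<psi>"
    and G: "is_network G" "u \<in> verts G"
    and v: "v \<in> verts (net_cball G u d)" and le: "d + r \<le> R"
  shows "network_iso S (net_cball G v r) (net_cball H (\<phi> v) r) \<phi> \<psi>"
proof -
  have vR: "v \<in> verts (net_cball G u R)"
    using v le verts_cball_mono[of d R G u] by auto
  obtain n where n: "n \<le> d" "(adj G ^^ n) u v" using v by auto
  then have "(adj (net_cball G u R) ^^ n) u v"
    using adj_cball_pow[OF root_in_cball, of 0 n R G u v] le by simp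
  then have "(adj (net_cball H (\<phi> u) R) ^^ n) (\<phi> u) (\<phi> v)"
    by (rule network_iso_adj_pow[OF iso])
  then have "(adj H ^^ n) (\<phi> u) (\<phi> v)"
    by (rule adj_pow_cballD)
  then have "\<phi> v \<in> verts (net_cball H (\<phi> u) d)" using n(1) by auto
  then show ?thesis
    using network_iso_cball[OF iso is_network_cball[OF G] vR, of r]
    by (simp only: cball_cball[OF v le] cball_cball[OF _ le])
qed

section \<open>Roots, and continuity of moving them\<close>

lemma rooted_iso_refl: "is_network G \<Longrightarrow> u \<in> verts G \<Longrightarrow> rooted_iso (G, u) (G, u)"
  by (rule rooted_isoI[OF network_iso_id]) simp_all

lemma birooted_iso_refl:
  "is_network G \<Longrightarrow> u \<in> verts G \<Longrightarrow> v \<in> verts G \<Longrightarrow> birooted_iso (G, u, v) (G, u, v)"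
  by (rule birooted_isoI[OF network_iso_id]) simp_all

lemma second_rooted_abs:
  assumes "is_network G" "u \<in> verts G" "v \<in> verts G"
  shows "second_rooted (abs_birooted_net (G, u, v)) = abs_rooted_net (G, v)"
  by (simp add: second_rooted.abs_eq[OF birooted_iso_refl[OF assms]])

lemma swap_roots_abs:
  assumes "is_network G" "u \<in> verts G" "v \<in> verts G"
  shows "swap_roots (abs_birooted_net (G, u, v)) = abs_birooted_net (G, v, u)"
  by (simp add: swap_roots.abs_eq[OF birooted_iso_refl[OF assms]])

lemma root_sum_abs:
  assumes "is_network G" "u \<in> verts G"
  shows "root_sum f (abs_rooted_net (G, u)) =
    (\<integral>\<^sup>+ v. f (abs_birooted_net (G, u, v)) \<partial>count_space (verts G))"
  by (simp add: root_sum.abs_eq[OF rooted_iso_refl[OF assms]])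

lemma ball_near_abs:
  assumes "is_network G" "u \<in> verts G" "is_network H" "w \<in> verts H"
  shows "ball_near r \<epsilon> (abs_rooted_net (G, u)) (abs_rooted_net (H, w)) \<longleftrightarrow>
    (\<exists>\<phi> \<psi>. network_iso (\<lambda>x y. dist x y < \<epsilon>) (net_cball G u r) (net_cball H w r) \<phi> \<psi> \<and> \<phi> u = w)"
  by (simp only: ball_near.abs_eq[OF rooted_iso_refl[OF assms(1,2)] rooted_iso_refl[OF assms(3,4)]] prod.case)

lemma ball_near2_abs:
  assumes "is_network G" "u \<in> verts G" "v \<in> verts G" "is_network H" "w \<in> verts H" "t \<in> verts H"
  shows "ball_near2 r \<epsilon> (abs_birooted_net (G, u, v)) (abs_birooted_net (H, w, t)) \<longleftrightarrow>
    (v \<in> verts (net_cball G u r) \<longrightarrow>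
      (\<exists>\<phi> \<psi>. network_iso (\<lambda>x y. dist x y < \<epsilon>) (net_cball G u r) (net_cball H w r) \<phi> \<psi> \<and>
        \<phi> u = w \<and> \<phi> v = t))"
  by (simp only: prod.case
    ball_near2.abs_eq[OF birooted_iso_refl[OF assms(1-3)] birooted_iso_refl[OF assms(4-6)]])

definition first_rooted :: "'m birooted_net \<Rightarrow> 'm rooted_net" where
  "first_rooted d = second_rooted (swap_roots d)"

lemma first_rooted_abs:
  assumes "is_network G" "u \<in> verts G" "v \<in> verts G"
  shows "first_rooted (abs_birooted_net (G, u, v)) = abs_rooted_net (G, u)"
  by (simp add: first_rooted_def swap_roots_abs second_rooted_abs assms)

lemma swap_roots_swap_roots [simp]: "swap_roots (swap_roots d) = d"
  by (cases d rule: birooted_net_cases) (simp add: swap_roots_abs)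

lemma rooted_swap_roots [simp]:
  "first_rooted (swap_roots d) = second_rooted d" "second_rooted (swap_roots d) = first_rooted d"
  by (simp_all add: first_rooted_def)

lift_definition double_root :: "'m rooted_net \<Rightarrow> 'm birooted_net" is "\<lambda>(G, u). (G, u, u)"
  by (auto simp: birooted_iso_def rooted_iso_def)

lemma double_root_abs:
  assumes "is_network G" "u \<in> verts G"
  shows "double_root (abs_rooted_net (G, u)) = abs_birooted_net (G, u, u)"
  by (simp add: double_root.abs_eq[OF rooted_iso_refl[OF assms]])

text \<open>
  The premise of \<^const>\<open>ball_near2\<close> holds exactly for the doubly-rooted networks with
  \<open>near_roots r\<close>; outside this set \<open>ball_near2 r\<close> is trivially true.
\<close>

lift_definition near_roots :: "nat \<Rightarrow> 'm birooted_net \<Rightarrow> bool" is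
  "\<lambda>r (G, u, v). v \<in> verts (net_cball G u r)"
proof -
  fix r and x y :: "'m network \<times> nat \<times> nat"
  let ?P = "\<lambda>(G, u, v). v \<in> verts (net_cball G u r)"
  have imp: "?P y" if "birooted_iso x y" "?P x" for x y :: "'m network \<times> nat \<times> nat"
    using that network_iso_adj_pow by (fastforce simp: birooted_iso_def)
  assume "birooted_iso x y"
  then show "?P x = ?P y"
    using imp[of x y] imp[of y x] part_equivp_symp[OF birooted_iso_part_equivp] by blast
qed

lemma near_roots_abs:
  assumes "is_network G" "u \<in> verts G" "v \<in> verts G"
  shows "near_roots r (abs_birooted_net (G, u, v)) \<longleftrightarrow> v \<in> verts (net_cball G u r)"
  by (simp only: near_roots.abs_eq[OF birooted_iso_refl[OF assms]] prod.case)

lemma near_roots_exists: "\<exists>r. near_roots r d"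
proof (cases d rule: birooted_net_cases)
  case (1 G u v)
  then show ?thesis
    using verts_in_some_cball[OF 1(2-4)] by (metis near_roots_abs)
qed

lemma near_roots_mono: "near_roots r d \<Longrightarrow> r \<le> s \<Longrightarrow> near_roots s d"
  using verts_cball_mono[of r s]
  by (cases d rule: birooted_net_cases) (auto simp: near_roots_abs simp del: net_cball_simps)

lemma near_roots_swap_roots [simp]: "near_roots r (swap_roots d) \<longleftrightarrow> near_roots r d"
  using in_cball_sym
  by (cases d rule: birooted_net_cases) (auto simp: near_roots_abs swap_roots_abs simp del: net_cball_simps)

lemma first_double_root [simp]: "first_rooted (double_root x) = x"
  by (cases x rule: rooted_net_cases) (auto simp: first_rooted_abs double_root_abs)

lemma second_double_root [simp]: "second_rooted (double_root x) = x"
  by (cases x rule: rooted_net_cases) (auto simp: second_rooted_abs double_root_abs)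

text \<open>
  Representatives can be chosen such that the second pair of roots is literally the image of the
  first one under the isomorphism of the balls.
\<close>

lemma ball_near2_cases:
  assumes "ball_near2 r \<epsilon> x y" "near_roots r x"
  obtains G u v H \<phi> \<psi> where
    "x = abs_birooted_net (G, u, v)" "is_network G" "u \<in> verts G" "v \<in> verts G"
    "y = abs_birooted_net (H, \<phi> u, \<phi> v)" "is_network H" "\<phi> u \<in> verts H" "\<phi> v \<in> verts H"
    "v \<in> verts (net_cball G u r)"
    "network_iso (\<lambda>x y. dist x y < \<epsilon>) (net_cball G u r) (net_cball H (\<phi> u) r) \<phi> \<psi>"
proof -
  obtain G u v where x: "x = abs_birooted_net (G, u, v)" "is_network G" "u \<in> verts G" "v \<in> verts G"
    by (cases x rule: birooted_net_cases) (rule that)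
  obtain H w t where y: "y = abs_birooted_net (H, w, t)" "is_network H" "w \<in> verts H" "t \<in> verts H"
    by (cases y rule: birooted_net_cases) (rule that)
  have v: "v \<in> verts (net_cball G u r)"
    using assms(2) unfolding x(1) near_roots_abs[OF x(2-4)] .
  obtain \<phi> \<psi> where "network_iso (\<lambda>x y. dist x y < \<epsilon>) (net_cball G u r) (net_cball H w r) \<phi> \<psi>"
    "\<phi> u = w" "\<phi> v = t"
    using assms(1) v unfolding x(1) y(1) ball_near2_abs[OF x(2-4) y(2-4)] by blast
  with x y v show thesis by (intro that[of G u v H \<phi> \<psi>]) simp_all
qed

lemma ball_near_cases:
  assumes "ball_near r \<epsilon> x y"
  obtains G u H \<phi> \<psi> where
    "x = abs_rooted_net (G, u)" "is_network G" "u \<in> verts G"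
    "y = abs_rooted_net (H, \<phi> u)" "is_network H" "\<phi> u \<in> verts H"
    "network_iso (\<lambda>x y. dist x y < \<epsilon>) (net_cball G u r) (net_cball H (\<phi> u) r) \<phi> \<psi>"
proof -
  obtain G u where x: "x = abs_rooted_net (G, u)" "is_network G" "u \<in> verts G"
    by (cases x rule: rooted_net_cases) (rule that)
  obtain H w where y: "y = abs_rooted_net (H, w)" "is_network H" "w \<in> verts H"
    by (cases y rule: rooted_net_cases) (rule that)
  obtain \<phi> \<psi> where "network_iso (\<lambda>x y. dist x y < \<epsilon>) (net_cball G u r) (net_cball H w r) \<phi> \<psi>" "\<phi> u = w"
    using assms unfolding x(1) y(1) ball_near_abs[OF x(2,3) y(2,3)] by blast
  with x y show thesis by (intro that[of G u H \<phi> \<psi>]) simp_all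
qed

lemma ball_near2_near_roots:
  assumes "ball_near2 r \<epsilon> x y" "near_roots r x"
  shows "near_roots r y"
  using assms
proof (cases rule: ball_near2_cases)
  case (1 G u v H \<phi> \<psi>)
  show ?thesis
    unfolding 1(5) near_roots_abs[OF 1(6-8)] by (rule network_isoD(3)[OF 1(10,9)])
qed

lemma ball_near2_mono:
  assumes "ball_near2 s \<epsilon> x y" "near_roots r x" "r \<le> s"
  shows "ball_near2 r \<epsilon> x y"
  using assms(1) near_roots_mono[OF assms(2,3)]
proof (cases rule: ball_near2_cases)
  case (1 G u v H \<phi> \<psi>)
  show ?thesis
    unfolding 1(1,5) ball_near2_abs[OF 1(2-4) 1(6-8)]
    using cball_iso_shift[where d = 0, OF 1(10) 1(2,3) root_in_cball, of r] assms(3) by auto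
qed

text \<open>
  The roots are at distance at most \<open>d\<close>, so the ball of radius \<open>d + r\<close> about the first root contains
  the ball of radius \<open>r\<close> about the second one.
\<close>

lemma ball_near2_swap_roots:
  assumes "ball_near2 (d + r) \<epsilon> x y" "near_roots d x"
  shows "ball_near2 r \<epsilon> (swap_roots x) (swap_roots y)"
  using assms(1) near_roots_mono[OF assms(2) le_add1]
proof (cases rule: ball_near2_cases)
  case (1 G u v H \<phi> \<psi>)
  have "v \<in> verts (net_cball G u d)" using assms(2) unfolding 1(1) near_roots_abs[OF 1(2-4)] .
  from cball_iso_shift[OF 1(10) 1(2,3) this order_refl] show ?thesis
    unfolding 1(1,5) swap_roots_abs[OF 1(2-4)] swap_roots_abs[OF 1(6-8)]
      ball_near2_abs[OF 1(2,4,3) 1(6,8,7)] by blast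
qed

lemma ball_near_second_rooted:
  assumes "ball_near2 (d + r) \<epsilon> x y" "near_roots d x"
  shows "ball_near r \<epsilon> (second_rooted x) (second_rooted y)"
  using assms(1) near_roots_mono[OF assms(2) le_add1]
proof (cases rule: ball_near2_cases)
  case (1 G u v H \<phi> \<psi>)
  have "v \<in> verts (net_cball G u d)" using assms(2) unfolding 1(1) near_roots_abs[OF 1(2-4)] .
  from cball_iso_shift[OF 1(10) 1(2,3) this order_refl] show ?thesis
    unfolding 1(1,5) second_rooted_abs[OF 1(2-4)] second_rooted_abs[OF 1(6-8)]
      ball_near_abs[OF 1(2,4) 1(6,8)] by blast
qed

lemma ball_near2_double_root:
  assumes "ball_near r \<epsilon> x y"
  shows "ball_near2 r \<epsilon> (double_root x) (double_root y)"
  using assms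
proof (cases rule: ball_near_cases)
  case (1 G u H \<phi> \<psi>)
  then show ?thesis
    unfolding 1(1,4) double_root_abs[OF 1(2,3)] double_root_abs[OF 1(5,6)]
      ball_near2_abs[OF 1(2,3,3) 1(5,6,6)] by blast
qed

text \<open>
  A locally convergent sequence is eventually within every tolerance, so a tolerance as coarse as \<open>1\<close> may
  witness that a set is open.
\<close>

lemma open_rooted_localI:
  assumes "\<And>x. x \<in> U \<Longrightarrow> \<exists>r. \<forall>y. ball_near r 1 x y \<longrightarrow> y \<in> U"
  shows "open U"
  unfolding open_rooted_net_def
proof (intro ballI allI impI)
  fix x X assume "x \<in> U" "local_conv X x"
  then obtain r where r: "\<forall>y. ball_near r 1 x y \<longrightarrow> y \<in> U"
    and "\<forall>\<^sub>F n in sequentially. ball_near r 1 x (X n)"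
    using assms unfolding local_conv_def by (meson zero_less_one)
  from this(2) show "\<forall>\<^sub>F n in sequentially. X n \<in> U"
    by (rule eventually_mono) (use r in blast)
qed

lemma open_birooted_localI:
  assumes "\<And>x. x \<in> U \<Longrightarrow> \<exists>r. \<forall>y. ball_near2 r 1 x y \<longrightarrow> y \<in> U"
  shows "open U"
  unfolding open_birooted_net_def
proof (intro ballI allI impI)
  fix x X assume "x \<in> U" "local_conv2 X x"
  then obtain r where r: "\<forall>y. ball_near2 r 1 x y \<longrightarrow> y \<in> U"
    and "\<forall>\<^sub>F n in sequentially. ball_near2 r 1 x (X n)"
    using assms unfolding local_conv2_def by (meson zero_less_one)
  from this(2) show "\<forall>\<^sub>F n in sequentially. X n \<in> U"
    by (rule eventually_mono) (use r in blast)
qed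

lemma measurable_near_roots [measurable]:
  "Measurable.pred borel (near_roots r :: 'm::polish_space birooted_net \<Rightarrow> bool)"
proof -
  have "open {x :: 'm::polish_space birooted_net. near_roots r x}"
    by (rule open_birooted_localI) (use ball_near2_near_roots in blast)
  then show ?thesis by (simp add: pred_def borel_open)
qed

lemma measurable_swap_roots [measurable]:
  "(swap_roots :: 'm::polish_space birooted_net \<Rightarrow> _) \<in> borel_measurable borel"
proof (rule borel_measurableI)
  fix U :: "'m birooted_net set" assume U: "open U"
  have "open (swap_roots -` U)"
    unfolding open_birooted_net_def
  proof (intro ballI allI impI)
    fix x X assume x: "x \<in> swap_roots -` U" and X: "local_conv2 X x"
    obtain d where d: "near_roots d x" using near_roots_exists by blast
    have "local_conv2 (\<lambda>n. swap_roots (X n)) (swap_roots x)"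
      unfolding local_conv2_def
    proof (intro allI impI)
      fix r and \<epsilon> :: real assume "\<epsilon> > 0"
      then have "\<forall>\<^sub>F n in sequentially. ball_near2 (d + r) \<epsilon> x (X n)"
        using X unfolding local_conv2_def by blast
      then show "\<forall>\<^sub>F n in sequentially. ball_near2 r \<epsilon> (swap_roots x) (swap_roots (X n))"
        by (rule eventually_mono) (rule ball_near2_swap_roots[OF _ d])
    qed
    then show "\<forall>\<^sub>F n in sequentially. X n \<in> swap_roots -` U"
      using U x unfolding open_birooted_net_def by simp
  qed
  then show "swap_roots -` U \<inter> space borel \<in> sets borel" by simp
qed

lemma measurable_second_rooted [measurable]:
  "(second_rooted :: 'm::polish_space birooted_net \<Rightarrow> _) \<in> borel_measurable borel"
proof (rule borel_measurableI)
  fix U :: "'m rooted_net set" assume U: "open U"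
  have "open (second_rooted -` U)"
    unfolding open_birooted_net_def
  proof (intro ballI allI impI)
    fix x X assume x: "x \<in> second_rooted -` U" and X: "local_conv2 X x"
    obtain d where d: "near_roots d x" using near_roots_exists by blast
    have "local_conv (\<lambda>n. second_rooted (X n)) (second_rooted x)"
      unfolding local_conv_def
    proof (intro allI impI)
      fix r and \<epsilon> :: real assume "\<epsilon> > 0"
      then have "\<forall>\<^sub>F n in sequentially. ball_near2 (d + r) \<epsilon> x (X n)"
        using X unfolding local_conv2_def by blast
      then show "\<forall>\<^sub>F n in sequentially. ball_near r \<epsilon> (second_rooted x) (second_rooted (X n))"
        by (rule eventually_mono) (rule ball_near_second_rooted[OF _ d])
    qed
    then show "\<forall>\<^sub>F n in sequentially. X n \<in> second_rooted -` U"
      using U x unfolding open_rooted_net_def by simp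
  qed
  then show "second_rooted -` U \<inter> space borel \<in> sets borel" by simp
qed

lemma measurable_first_rooted [measurable]:
  "(first_rooted :: 'm::polish_space birooted_net \<Rightarrow> _) \<in> borel_measurable borel"
  unfolding first_rooted_def[abs_def] by measurable

lemma measurable_double_root [measurable]:
  "(double_root :: 'm::polish_space rooted_net \<Rightarrow> _) \<in> borel_measurable borel"
proof (rule borel_measurableI)
  fix U :: "'m birooted_net set" assume U: "open U"
  have "open (double_root -` U)"
    unfolding open_rooted_net_def
  proof (intro ballI allI impI)
    fix x X assume x: "x \<in> double_root -` U" and X: "local_conv X x"
    have "local_conv2 (\<lambda>n. double_root (X n)) (double_root x)"
      unfolding local_conv2_def
    proof (intro allI impI)
      fix r and \<epsilon> :: real assume "\<epsilon> > 0"
      then have "\<forall>\<^sub>F n in sequentially. ball_near r \<epsilon> x (X n)"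
        using X unfolding local_conv_def by blast
      then show "\<forall>\<^sub>F n in sequentially. ball_near2 r \<epsilon> (double_root x) (double_root (X n))"
        by (rule eventually_mono) (rule ball_near2_double_root)
    qed
    then show "\<forall>\<^sub>F n in sequentially. X n \<in> double_root -` U"
      using U x unfolding open_birooted_net_def by simp
  qed
  then show "double_root -` U \<inter> space borel \<in> sets borel" by simp
qed

section \<open>Marks in a two-point space and local sets\<close>

lift_definition root_mark :: "'m rooted_net \<Rightarrow> 'm" is "\<lambda>(G, u). vmark G u"
  by (auto simp: rooted_iso_def network_iso_def)

lemma root_mark_abs:
  assumes "is_network G" "u \<in> verts G"
  shows "root_mark (abs_rooted_net (G, u)) = vmark G u"
  by (simp add: root_mark.abs_eq[OF rooted_iso_refl[OF assms]])

lemma dist_bool_less_1 [simp]: "dist x y < 1 \<longleftrightarrow> x = y" for x y :: bool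
  by (simp add: dist_bool_def)

lemma measurable_root_mark [measurable]: "Measurable.pred borel (root_mark :: bool rooted_net \<Rightarrow> bool)"
proof -
  have "root_mark y" if "root_mark x" "ball_near 0 1 x y" for x y :: "bool rooted_net"
    using that(2)
  proof (cases rule: ball_near_cases)
    case (1 G u H \<phi> \<psi>)
    have "vmark G u = vmark H (\<phi> u)"
      using network_isoD(6)[OF 1(7) root_in_cball] by simp
    then show ?thesis
      using that(1) unfolding 1(1,4) root_mark_abs[OF 1(2,3)] root_mark_abs[OF 1(5,6)] by simp
  qed
  then have "open {x :: bool rooted_net. root_mark x}"
    by (intro open_rooted_localI) blast
  then show ?thesis by (simp add: pred_def borel_open)
qed

abbreviation force_mark :: "bool network \<Rightarrow> nat \<Rightarrow> bool network" where
  "force_mark G u \<equiv> Network (verts G) (edges G) (ends G) ((vmark G)(u := True)) (emark G)"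

lemma is_network_force_mark: "is_network G \<Longrightarrow> is_network (force_mark G u)"
  using is_network_cong[of "force_mark G u" G] by simp

lemma force_root_mark_abs:
  assumes "is_network G" "u \<in> verts G"
  shows "force_root_mark (abs_rooted_net (G, u)) = abs_rooted_net (force_mark G u, u)"
  by (simp add: force_root_mark.abs_eq[OF rooted_iso_refl[OF assms]])

lemma net_cball_force_mark:
  "net_cball (force_mark G u) w r = force_mark (net_cball G w r) u"
proof -
  have "adj (force_mark G u) = adj G" by (auto simp: adj_def fun_eq_iff)
  then show ?thesis by (simp add: net_cball_def Let_def)
qed

lemma ball_near_force_root_mark:
  assumes "ball_near r \<epsilon> x y" "\<epsilon> > 0"
  shows "ball_near r \<epsilon> (force_root_mark x) (force_root_mark y)"
  using assms(1)
proof (cases rule: ball_near_cases)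
  case (1 G u H \<phi> \<psi>)
  let ?B = "net_cball G u r"
  have inj: "\<phi> v = \<phi> u \<longleftrightarrow> v = u" if "v \<in> verts ?B" for v
    using that network_isoD(1)[OF 1(7)] root_in_cball[of u G r]
    unfolding bij_betw_def inj_on_def by blast
  have "network_iso (\<lambda>x y. dist x y < \<epsilon>) (force_mark ?B u) (force_mark (net_cball H (\<phi> u) r) (\<phi> u)) \<phi> \<psi>"
    unfolding network_iso_def network.sel
  proof (intro conjI ballI)
    show "dist (((vmark ?B)(u := True)) v) (((vmark (net_cball H (\<phi> u) r))(\<phi> u := True)) (\<phi> v)) < \<epsilon>"
      if "v \<in> verts ?B" for v
      using inj[OF that] network_isoD(6)[OF 1(7) that] assms(2) by simp
  qed (use network_isoD(1,2,5,7)[OF 1(7)] in blast)+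
  then show ?thesis
    unfolding 1(1,4) force_root_mark_abs[OF 1(2,3)] force_root_mark_abs[OF 1(5,6)]
    using 1(2,3,5,6)
    by (subst ball_near_abs) (auto simp: is_network_force_mark net_cball_force_mark simp del: net_cball_simps)
qed

lemma measurable_force_root_mark [measurable]: "force_root_mark \<in> borel_measurable borel"
proof (rule borel_measurableI)
  fix U :: "bool rooted_net set" assume U: "open U"
  have "open (force_root_mark -` U)"
    unfolding open_rooted_net_def
  proof (intro ballI allI impI)
    fix x X assume x: "x \<in> force_root_mark -` U" and X: "local_conv X x"
    have "local_conv (\<lambda>n. force_root_mark (X n)) (force_root_mark x)"
      unfolding local_conv_def
    proof (intro allI impI)
      fix r and \<epsilon> :: real assume "\<epsilon> > 0"
      then have "\<forall>\<^sub>F n in sequentially. ball_near r \<epsilon> x (X n)"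
        using X unfolding local_conv_def by blast
      then show "\<forall>\<^sub>F n in sequentially. ball_near r \<epsilon> (force_root_mark x) (force_root_mark (X n))"
        by (rule eventually_mono) (rule ball_near_force_root_mark[OF _ \<open>\<epsilon> > 0\<close>])
    qed
    then show "\<forall>\<^sub>F n in sequentially. X n \<in> force_root_mark -` U"
      using U x unfolding open_rooted_net_def by simp
  qed
  then show "force_root_mark -` U \<inter> space borel \<in> sets borel" by simp
qed

lemma cball_ends: "\<forall>e\<in>edges (net_cball G u r). ends (net_cball G u r) e \<subseteq> verts (net_cball G u r)"
  unfolding net_cball_simps(2,3) by blast

lemma ball_near2_sym:
  assumes "ball_near2 r \<epsilon> x y" "near_roots r x"
  shows "ball_near2 r \<epsilon> y x"
  using assms
proof (cases rule: ball_near2_cases)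
  case (1 G u v H \<phi> \<psi>)
  let ?f = "inv_into (verts (net_cball G u r)) \<phi>" and ?g = "inv_into (edges (net_cball G u r)) \<psi>"
  have "network_iso (\<lambda>x y. dist x y < \<epsilon>) (net_cball H (\<phi> u) r) (net_cball G u r) ?f ?g"
    by (rule network_iso_inv[OF 1(10) cball_ends]) (simp add: dist_commute)
  then show ?thesis
    unfolding 1(1,5) ball_near2_abs[OF 1(6-8) 1(2-4)]
    using inv_into_iso[OF 1(10) root_in_cball] inv_into_iso[OF 1(10) 1(9)] by blast
qed

text \<open>
  For two-point marks, tolerance \<open>1\<close> means equality of marks. This makes \<open>ball_near2 r 1\<close> an
  equivalence relation on the doubly-rooted networks with \<open>near_roots r\<close>.
\<close>

lemma ball_near2_trans:
  fixes x y z :: "bool birooted_net"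
  assumes xy: "ball_near2 r 1 x y" "near_roots r x" and yz: "ball_near2 r 1 y z"
  shows "ball_near2 r 1 x z"
proof -
  obtain G u v where x: "x = abs_birooted_net (G, u, v)" "is_network G" "u \<in> verts G" "v \<in> verts G"
    by (cases x rule: birooted_net_cases) (rule that)
  obtain H w t where y: "y = abs_birooted_net (H, w, t)" "is_network H" "w \<in> verts H" "t \<in> verts H"
    by (cases y rule: birooted_net_cases) (rule that)
  obtain K a b where z: "z = abs_birooted_net (K, a, b)" "is_network K" "a \<in> verts K" "b \<in> verts K"
    by (cases z rule: birooted_net_cases) (rule that)
  have v: "v \<in> verts (net_cball G u r)"
    using xy(2) unfolding x(1) near_roots_abs[OF x(2-4)] .
  have t: "t \<in> verts (net_cball H w r)"
    using ball_near2_near_roots[OF xy] unfolding y(1) near_roots_abs[OF y(2-4)] .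
  obtain \<phi> \<psi> where 1: "network_iso (\<lambda>x y. dist x y < 1) (net_cball G u r) (net_cball H w r) \<phi> \<psi>"
    "\<phi> u = w" "\<phi> v = t"
    using xy(1) v unfolding x(1) y(1) ball_near2_abs[OF x(2-4) y(2-4)] by blast
  obtain \<phi>' \<psi>' where 2: "network_iso (\<lambda>x y. dist x y < 1) (net_cball H w r) (net_cball K a r) \<phi>' \<psi>'"
    "\<phi>' w = a" "\<phi>' t = b"
    using yz t unfolding y(1) z(1) ball_near2_abs[OF y(2-4) z(2-4)] by blast
  have "network_iso (\<lambda>x y. dist x y < 1) (net_cball G u r) (net_cball K a r) (\<phi>' \<circ> \<phi>) (\<psi>' \<circ> \<psi>)"
    by (rule network_iso_comp[OF 1(1) 2(1) cball_ends]) simp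
  moreover have "(\<phi>' \<circ> \<phi>) u = a" "(\<phi>' \<circ> \<phi>) v = b" using 1 2 by simp_all
  ultimately show ?thesis
    unfolding x(1) z(1) ball_near2_abs[OF x(2-4) z(2-4)] by blast
qed

lemma ball_near2_1_imp: "ball_near2 r 1 x y \<Longrightarrow> \<epsilon> > 0 \<Longrightarrow> near_roots r x \<Longrightarrow> ball_near2 r \<epsilon> x y"
  for x y :: "bool birooted_net"
proof -
  assume "ball_near2 r 1 x y" "\<epsilon> > 0" "near_roots r x"
  from this(1,3) show ?thesis
  proof (cases rule: ball_near2_cases)
    case (1 G u v H \<phi> \<psi>)
    have "network_iso (\<lambda>x y. dist x y < \<epsilon>) (net_cball G u r) (net_cball H (\<phi> u) r) \<phi> \<psi>"
      using network_isoD[OF 1(10)] \<open>\<epsilon> > 0\<close> unfolding network_iso_def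
      by (simp del: net_cball_simps)
    then show ?thesis
      unfolding 1(1,5) ball_near2_abs[OF 1(2-4) 1(6-8)] by blast
  qed
qed

text \<open>
  The sets of doubly-rooted networks that are decided by the ball of radius \<open>r\<close> about the first root.
  They are required to lie in \<open>near_roots r\<close>, because the ball says nothing about a second root outside it;
  therefore complements are only taken relative to \<open>near_roots r\<close>.
\<close>

definition local_set :: "nat \<Rightarrow> bool birooted_net set \<Rightarrow> bool" where
  "local_set r A \<longleftrightarrow> (\<forall>x\<in>A. near_roots r x \<and> (\<forall>y. ball_near2 r 1 x y \<longrightarrow> y \<in> A))"

lemma local_set_mono: "local_set r A \<Longrightarrow> r \<le> s \<Longrightarrow> local_set s A"
  unfolding local_set_def using ball_near2_mono near_roots_mono by blast

lemma local_set_Int: "local_set r A \<Longrightarrow> local_set r B \<Longrightarrow> local_set r (A \<inter> B)"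
  unfolding local_set_def by blast

lemma local_set_near_roots: "local_set r {x. near_roots r x}"
  unfolding local_set_def using ball_near2_near_roots by blast

lemma open_local_set: "local_set r A \<Longrightarrow> open A"
  unfolding local_set_def by (rule open_birooted_localI) blast

lemma Int_stable_local_sets: "Int_stable {A. \<exists>r. local_set r A}"
proof (rule Int_stableI)
  fix A B assume "A \<in> {A. \<exists>r. local_set r A}" "B \<in> {A. \<exists>r. local_set r A}"
  then obtain r s where "local_set r A" "local_set s B" by blast
  then have "local_set (max r s) (A \<inter> B)"
    by (intro local_set_Int local_set_mono[of r A "max r s"] local_set_mono[of s B "max r s"]) simp_all
  then show "A \<inter> B \<in> {A. \<exists>r. local_set r A}" by blast
qed

text \<open>
  Take for \<open>L r\<close> the points whose whole class under \<open>ball_near2 r 1\<close> lies in \<open>U\<close>. A point of \<open>U\<close> in none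
  of these would be the limit of a sequence outside \<open>U\<close>.
\<close>

lemma open_eq_Union_local_sets:
  fixes U :: "bool birooted_net set"
  assumes "open U"
  shows "\<exists>L. (\<forall>r. local_set r (L r)) \<and> U = (\<Union>r. L r)"
proof -
  define L where "L r = {x. near_roots r x \<and> (\<forall>y. ball_near2 r 1 x y \<longrightarrow> y \<in> U)}" for r
  have "local_set r (L r)" for r
    unfolding local_set_def L_def
    using ball_near2_near_roots ball_near2_trans by blast
  moreover have "L r \<subseteq> U" for r
    unfolding L_def using ball_near2_refl[OF zero_less_one] by blast
  moreover have "\<exists>r. x \<in> L r" if x: "x \<in> U" for x
  proof (rule ccontr)
    assume "\<nexists>r. x \<in> L r"
    then have "\<forall>r. \<exists>y. near_roots r x \<longrightarrow> ball_near2 r 1 x y \<and> y \<notin> U"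
      unfolding L_def by blast
    then obtain Y where Y: "\<And>r. near_roots r x \<Longrightarrow> ball_near2 r 1 x (Y r) \<and> Y r \<notin> U"
      by metis
    obtain d where d: "near_roots d x" using near_roots_exists by blast
    have "local_conv2 Y x"
      unfolding local_conv2_def
    proof (intro allI impI)
      fix r and \<epsilon> :: real assume e: "\<epsilon> > 0"
      have "ball_near2 r \<epsilon> x (Y n)" if n: "n \<ge> max d r" for n
      proof (cases "near_roots r x")
        case True
        have "near_roots n x" using near_roots_mono[OF d] n by simp
        then have "ball_near2 n 1 x (Y n)" using Y by blast
        then have "ball_near2 r 1 x (Y n)" by (rule ball_near2_mono[OF _ True]) (use n in simp)
        then show ?thesis by (rule ball_near2_1_imp[OF _ e True])
      next
        case False
        obtain G u v where x: "x = abs_birooted_net (G, u, v)" "is_network G" "u \<in> verts G" "v \<in> verts G"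
          by (cases x rule: birooted_net_cases) (rule that)
        obtain H w t where y: "Y n = abs_birooted_net (H, w, t)" "is_network H" "w \<in> verts H" "t \<in> verts H"
          by (cases "Y n" rule: birooted_net_cases) (rule that)
        show ?thesis
          using False unfolding x(1) y(1) ball_near2_abs[OF x(2-4) y(2-4)] near_roots_abs[OF x(2-4)]
          by blast
      qed
      then show "\<forall>\<^sub>F n in sequentially. ball_near2 r \<epsilon> x (Y n)"
        unfolding eventually_sequentially by blast
    qed
    then have "\<forall>\<^sub>F n in sequentially. Y n \<in> U"
      using assms x unfolding open_birooted_net_def by blast
    then obtain N where "\<And>n. n \<ge> N \<Longrightarrow> Y n \<in> U" unfolding eventually_sequentially by blast
    then have "Y (max N d) \<in> U" by simp
    then show False using Y near_roots_mono[OF d, of "max N d"] by simp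
  qed
  ultimately have "U = (\<Union>r. L r)" by (intro equalityI subsetI) auto
  with \<open>\<And>r. local_set r (L r)\<close> show ?thesis by blast
qed

lemma sets_borel_local:
  "sets (borel :: bool birooted_net measure) = sigma_sets UNIV {A. \<exists>r. local_set r A}"
proof -
  have "U \<in> sigma_sets UNIV {A. \<exists>r. local_set r A}" if U: "open U" for U :: "bool birooted_net set"
  proof -
    obtain L where L: "\<forall>r. local_set r (L r)" "U = (\<Union>r. L r)"
      using open_eq_Union_local_sets[OF U] by blast
    have "(\<Union>r. L r) \<in> sigma_sets UNIV {A. \<exists>r. local_set r A}"
      by (rule sigma_sets.Union) (use L(1) in \<open>blast intro: sigma_sets.Basic\<close>)
    then show ?thesis using L(2) by simp
  qed
  then have "sigma_sets UNIV {S. open S} \<subseteq> sigma_sets UNIV {A. \<exists>r. local_set r A}"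
    by (intro sigma_sets_mono) blast
  moreover have "sigma_sets UNIV {A. \<exists>r. local_set r A} \<subseteq> sigma_sets UNIV {S. open S}"
    by (intro sigma_sets_mono) (auto intro: open_local_set)
  ultimately show ?thesis by (simp add: borel_def)
qed

section \<open>Sums over the vertices of a network\<close>

lemma first_rooted_eq_absD:
  assumes "first_rooted d = abs_rooted_net (G, u)" "is_network G" "u \<in> verts G"
  shows "\<exists>v\<in>verts G. d = abs_birooted_net (G, u, v)"
proof (cases d rule: birooted_net_cases)
  case h: (1 H w t)
  have "abs_rooted_net (H, w) = abs_rooted_net (G, u)"
    using assms(1) unfolding h(1) first_rooted_abs[OF h(2-4)] .
  then have "rooted_iso (H, w) (G, u)"
    using Quotient_rel[OF Quotient_rooted_net, of "(H, w)" "(G, u)"]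
      rooted_iso_refl[OF h(2,3)] rooted_iso_refl[OF assms(2,3)] by blast
  then obtain \<phi> \<psi> where iso: "network_iso (=) H G \<phi> \<psi>" "\<phi> w = u"
    by (auto simp: rooted_iso_def)
  have t: "\<phi> t \<in> verts G" using network_isoD(3)[OF iso(1) h(4)] .
  then have "birooted_iso (H, w, t) (G, u, \<phi> t)"
    by (intro birooted_isoI[OF iso(1) iso(2) refl]) (use h assms in auto)
  then have "d = abs_birooted_net (G, u, \<phi> t)"
    unfolding h(1) by (rule Quotient_rel_abs[OF Quotient_birooted_net])
  with t show ?thesis by blast
qed

text \<open>
  Having a common network is transitive: two vertices seen from the same root are seen from each other.
  Root-invariance of an event on rooted networks is derived from this.
\<close>

lemma same_network_trans:
  assumes "first_rooted d = first_rooted e"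
  obtains d' where "first_rooted d' = second_rooted d" "second_rooted d' = second_rooted e"
proof (cases d rule: birooted_net_cases)
  case (1 G u v)
  obtain w where w: "w \<in> verts G" "e = abs_birooted_net (G, u, w)"
    using assms first_rooted_eq_absD[of e G u] 1 by (auto simp: first_rooted_abs)
  show thesis
    by (rule that[of "abs_birooted_net (G, v, w)"])
      (use 1 w in \<open>simp_all add: first_rooted_abs second_rooted_abs\<close>)
qed

text \<open>
  A sum over the second root is an integral over a counting measure. Through this the algebraic rules for
  \<^const>\<open>root_sum\<close> reduce to those for \<open>nn_integral\<close>, with all functions measurable.
\<close>

lemma root_sum_cases:
  obtains V :: "nat set" and e where
    "\<And>f. root_sum f x = (\<integral>\<^sup>+ v. f (e v) \<partial>count_space V)"
    "\<And>v. v \<in> V \<Longrightarrow> first_rooted (e v) = x"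
    "\<And>d. first_rooted d = x \<Longrightarrow> d \<in> e ` V"
proof (cases x rule: rooted_net_cases)
  case (1 G u)
  have "d \<in> (\<lambda>v. abs_birooted_net (G, u, v)) ` verts G" if "first_rooted d = x" for d
    using that first_rooted_eq_absD[OF _ 1(2,3)] unfolding 1(1) by blast
  moreover have "root_sum f x = (\<integral>\<^sup>+ v. f (abs_birooted_net (G, u, v)) \<partial>count_space (verts G))" for f
    unfolding 1(1) by (rule root_sum_abs[OF 1(2,3)])
  moreover have "first_rooted (abs_birooted_net (G, u, v)) = x" if "v \<in> verts G" for v
    unfolding 1(1) by (rule first_rooted_abs[OF 1(2,3) that])
  ultimately show ?thesis
    by (intro that[where V = "verts G" and e = "\<lambda>v. abs_birooted_net (G, u, v)"])
qed

lemma root_sum_add: "root_sum (\<lambda>d. f d + g d) x = root_sum f x + root_sum g x"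
proof (cases x rule: root_sum_cases)
  case (1 V e)
  then show ?thesis by (simp add: nn_integral_add)
qed

lemma root_sum_first_mult:
  "root_sum (\<lambda>d. h (first_rooted d) * f d) x = h x * root_sum f x"
proof (cases x rule: root_sum_cases)
  case V: (1 V e)
  have "root_sum (\<lambda>d. h (first_rooted d) * f d) x = (\<integral>\<^sup>+ v. h x * f (e v) \<partial>count_space V)"
    unfolding V(1) using V(2) by (intro nn_integral_cong) simp
  then show ?thesis by (simp add: V(1) nn_integral_cmult)
qed

lemma root_sum_cmult: "root_sum (\<lambda>d. c * f d) x = c * root_sum f x"
  using root_sum_first_mult[of "\<lambda>_. c" f x] by simp

lemma root_sum_mono_first:
  assumes "\<And>d. first_rooted d = x \<Longrightarrow> f d \<le> g d"
  shows "root_sum f x \<le> root_sum g x"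
proof (cases x rule: root_sum_cases)
  case V: (1 V e)
  show ?thesis
    unfolding V(1) using V(2) assms by (intro nn_integral_mono) simp
qed

lemma root_sum_mono: "(\<And>d. f d \<le> g d) \<Longrightarrow> root_sum f x \<le> root_sum g x"
  by (rule root_sum_mono_first)

lemma root_sum_cong_first:
  "(\<And>d. first_rooted d = x \<Longrightarrow> f d = g d) \<Longrightarrow> root_sum f x = root_sum g x"
  by (intro antisym root_sum_mono_first) simp_all

lemma root_sum_ge: "f d \<le> root_sum f (first_rooted d)"
proof (cases "first_rooted d" rule: root_sum_cases)
  case V: (1 V e)
  obtain v where v: "v \<in> V" "d = e v" using V(3)[OF refl] by blast
  have "f (e v) \<le> (\<integral>\<^sup>+ v. f (e v) \<partial>count_space V)"
    using nn_integral_ge_point[OF v(1), of "\<lambda>v. f (e v)"] .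
  then show ?thesis using V(1)[of f] v(2) by simp
qed

lemma root_sum_suminf: "root_sum (\<lambda>d. \<Sum>n. f n d) x = (\<Sum>n. root_sum (f n) x)"
proof (cases x rule: root_sum_cases)
  case (1 V e)
  then show ?thesis by (simp add: nn_integral_suminf)
qed

lemma root_sum_SUP:
  assumes "\<And>d. incseq (\<lambda>n. f n d)"
  shows "root_sum (\<lambda>d. SUP n. f n d) x = (SUP n. root_sum (f n) x)"
proof (cases x rule: root_sum_cases)
  case (1 V e)
  then show ?thesis
    using assms by (simp add: nn_integral_monotone_convergence_SUP incseq_def le_fun_def)
qed

lemma root_sum_eq_0_iff: "root_sum f x = 0 \<longleftrightarrow> (\<forall>d. first_rooted d = x \<longrightarrow> f d = 0)"
proof
  show "\<forall>d. first_rooted d = x \<longrightarrow> f d = 0" if "root_sum f x = 0"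
    using that root_sum_ge[of f] by (metis le_zero_eq)
  show "root_sum f x = 0" if "\<forall>d. first_rooted d = x \<longrightarrow> f d = 0"
    using that root_sum_cong_first[of x f "\<lambda>d. 0 * f d"] root_sum_cmult[of 0 f x] by simp
qed

lemma root_sum_near_roots_abs:
  assumes "is_network G" "u \<in> verts G" "\<And>d. f d \<noteq> 0 \<Longrightarrow> near_roots r d"
  shows "root_sum f (abs_rooted_net (G, u)) =
    (\<integral>\<^sup>+ v. f (abs_birooted_net (G, u, v)) \<partial>count_space (verts (net_cball G u r)))"
  unfolding root_sum_abs[OF assms(1,2)]
proof (rule nn_integral_count_space_eq)
  show "f (abs_birooted_net (G, u, v)) = 0" if "v \<in> verts G - verts (net_cball G u r)" for v
    using that assms(3) near_roots_abs[OF assms(1,2)] by blast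
  show "f (abs_birooted_net (G, u, v)) = 0" if "v \<in> verts (net_cball G u r) - verts G" for v
    using that net_cball_subset[OF assms(1,2)] by blast
qed

definition ball_size :: "nat \<Rightarrow> 'm rooted_net \<Rightarrow> ennreal" where
  "ball_size r = root_sum (indicator {d. near_roots r d})"

lemma ball_size_abs:
  assumes "is_network G" "u \<in> verts G"
  shows "ball_size r (abs_rooted_net (G, u)) = of_nat (card (verts (net_cball G u r)))"
proof -
  let ?B = "verts (net_cball G u r)"
  have "ball_size r (abs_rooted_net (G, u)) =
      (\<integral>\<^sup>+ v. indicator {d. near_roots r d} (abs_birooted_net (G, u, v)) \<partial>count_space ?B)"
    unfolding ball_size_def
    by (rule root_sum_near_roots_abs[OF assms]) (simp add: indicator_def split: if_splits)
  also have "\<dots> = (\<integral>\<^sup>+ v. 1 \<partial>count_space ?B)"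
  proof (rule nn_integral_cong)
    fix v assume "v \<in> space (count_space ?B)"
    then have "v \<in> ?B" by (simp del: net_cball_simps)
    moreover then have "v \<in> verts G" using net_cball_subset[OF assms] by blast
    ultimately show "indicator {d. near_roots r d} (abs_birooted_net (G, u, v)) = (1 :: ennreal)"
      using assms by (simp add: near_roots_abs del: net_cball_simps)
  qed
  also have "\<dots> = of_nat (card ?B)"
    using finite_cball(1)[OF assms, of r] by (simp add: emeasure_count_space_finite del: net_cball_simps)
  finally show ?thesis .
qed

lemma ball_size_bounds: "1 \<le> ball_size r x" "ball_size r x < \<infinity>"
proof -
  have "1 \<le> ball_size r x \<and> ball_size r x < \<infinity>"
  proof (cases x rule: rooted_net_cases)
    case (1 G u)
    have "card (verts (net_cball G u r)) > 0"
      using finite_cball(1)[OF 1(2,3), of r] root_in_cball[of u G r] card_gt_0_iff by blast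
    then show ?thesis
      unfolding 1(1) ball_size_abs[OF 1(2,3)]
      using of_nat_mono[of 1 "card (verts (net_cball G u r))", where 'a = ennreal]
      by (simp add: of_nat_less_top del: net_cball_simps)
  qed
  then show "1 \<le> ball_size r x" "ball_size r x < \<infinity>" by blast+
qed

lemma measurable_ball_size [measurable]:
  "ball_size r \<in> borel_measurable (borel :: 'm::polish_space rooted_net measure)"
proof (rule borel_measurableI)
  fix S :: "ennreal set"
  have "ball_size r x = ball_size r y" if "ball_near r 1 x y" for x y :: "'m rooted_net"
    using that
  proof (cases rule: ball_near_cases)
    case (1 G u H \<phi> \<psi>)
    show ?thesis
      unfolding 1(1,4) ball_size_abs[OF 1(2,3)] ball_size_abs[OF 1(5,6)]
      using bij_betw_same_card[OF network_isoD(1)[OF 1(7)]] by simp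
  qed
  then have "open (ball_size r -` S :: 'm rooted_net set)"
    by (intro open_rooted_localI) (auto intro!: exI[of _ r])
  then show "ball_size r -` S \<inter> space borel \<in> sets (borel :: 'm rooted_net measure)" by simp
qed

lemma SUP_ball_size: "(SUP r. ball_size r x) = root_sum (\<lambda>_. 1) x"
proof -
  have "(SUP r. indicator {d. near_roots r d} d) = (1 :: ennreal)" for d :: "'a birooted_net"
  proof -
    obtain r where "near_roots r d" using near_roots_exists by blast
    then show ?thesis
      by (intro antisym SUP_least SUP_upper2[of r]) (auto simp: indicator_def)
  qed
  moreover have "incseq (\<lambda>r. indicator {d. near_roots r d} d :: ennreal)" for d :: "'a birooted_net"
    using near_roots_mono by (auto simp: incseq_def indicator_def)
  ultimately show ?thesis
    unfolding ball_size_def using root_sum_SUP[of "\<lambda>r. indicator {d. near_roots r d}" x] by simp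
qed

text \<open>
  Via \<open>SUP_ball_size\<close> this makes infiniteness a measurable event.
\<close>

lemma infinite_net_iff: "infinite_net x \<longleftrightarrow> root_sum (\<lambda>_. 1) x = \<infinity>"
proof (cases x rule: rooted_net_cases)
  case (1 G u)
  show ?thesis
    unfolding 1(1) infinite_net.abs_eq[OF 1(4)] root_sum_abs[OF 1(2,3)] prod.case
    by (cases "finite (verts G)") (simp_all add: of_nat_less_top less_imp_neq)
qed

lemma measurable_infinite_net [measurable]:
  "Measurable.pred borel (infinite_net :: 'm::polish_space rooted_net \<Rightarrow> bool)"
  unfolding infinite_net_iff[abs_def] SUP_ball_size[symmetric] by measurable

text \<open>
  The vertices that contribute all lie in the ball of radius \<open>r\<close>, and the isomorphism of balls matches
  them.
\<close>

lemma root_sum_local_set: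
  assumes A: "local_set r A" and xy: "ball_near r 1 x y"
  shows "root_sum (indicator A) x = root_sum (indicator A) y"
  using xy
proof (cases rule: ball_near_cases)
  case (1 G u H \<phi> \<psi>)
  have A': "near_roots r d" if "indicator A d \<noteq> (0::ennreal)" for d
    using that A unfolding local_set_def by (auto simp: indicator_def split: if_splits)
  have sum: "root_sum (indicator A) (abs_rooted_net (G, u)) =
      (\<integral>\<^sup>+ v. indicator A (abs_birooted_net (G, u, v)) \<partial>count_space (verts (net_cball G u r)))"
    if "is_network G" "u \<in> verts G" for G u
    using that by (rule root_sum_near_roots_abs) (rule A')
  have bij: "bij_betw \<phi> (verts (net_cball G u r)) (verts (net_cball H (\<phi> u) r))"
    using network_isoD(1)[OF 1(7)] .
  have "abs_birooted_net (G, u, v) \<in> A \<longleftrightarrow> abs_birooted_net (H, \<phi> u, \<phi> v) \<in> A"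
    if v: "v \<in> verts (net_cball G u r)" for v
  proof -
    have vG: "v \<in> verts G" and vH: "\<phi> v \<in> verts H"
      using v net_cball_subset[OF 1(2,3)] network_isoD(3)[OF 1(7) v] net_cball_subset[OF 1(5,6)]
      by blast+
    have near: "ball_near2 r 1 (abs_birooted_net (G, u, v)) (abs_birooted_net (H, \<phi> u, \<phi> v))"
      unfolding ball_near2_abs[OF 1(2,3) vG 1(5,6) vH] using 1(7) by blast
    moreover have "near_roots r (abs_birooted_net (G, u, v))"
      using v unfolding near_roots_abs[OF 1(2,3) vG] .
    ultimately show ?thesis
      using A ball_near2_sym unfolding local_set_def by blast
  qed
  then have "root_sum (indicator A) x =
      (\<integral>\<^sup>+ v. indicator A (abs_birooted_net (H, \<phi> u, \<phi> v)) \<partial>count_space (verts (net_cball G u r)))"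
    unfolding 1(1) sum[OF 1(2,3)]
    by (intro nn_integral_cong) (simp add: indicator_def del: net_cball_simps)
  also have "\<dots> = root_sum (indicator A) y"
    unfolding 1(4) sum[OF 1(5,6)]
    by (rule nn_integral_bij_count_space[OF bij])
  finally show ?thesis .
qed

lemma measurable_root_sum_local_set:
  assumes "local_set r A"
  shows "root_sum (indicator A) \<in> borel_measurable borel"
proof (rule borel_measurableI)
  fix S :: "ennreal set"
  have "open (root_sum (indicator A) -` S)"
    by (rule open_rooted_localI) (use root_sum_local_set[OF assms] in \<open>auto intro!: exI[of _ r]\<close>)
  then show "root_sum (indicator A) -` S \<inter> space borel \<in> sets borel" by simp
qed

text \<open>
  Dynkin's argument over local sets. The restriction to \<open>near_roots r\<close> keeps the sums finite, as is
  required for complements.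
\<close>

lemma measurable_root_sum_near_roots:
  fixes A :: "bool birooted_net set"
  assumes "A \<in> sets borel"
  shows "root_sum (indicator (A \<inter> {d. near_roots r d})) \<in> borel_measurable borel"
proof -
  let ?D = "{d :: bool birooted_net. near_roots r d}"
  have D: "root_sum (indicator ?D) \<in> borel_measurable borel"
    by (rule measurable_root_sum_local_set[OF local_set_near_roots])
  have "A \<in> sigma_sets UNIV {A. \<exists>r. local_set r A}" using assms unfolding sets_borel_local .
  with Int_stable_local_sets have "Int_stable {A. \<exists>r. local_set r A}"
    "{A. \<exists>r. local_set r A} \<subseteq> Pow UNIV" "A \<in> sigma_sets UNIV {A. \<exists>r. local_set r A}"
    by simp_all
  then show ?thesis
  proof (induction rule: sigma_sets_induct_disjoint)
    case (basic A)
    then obtain s where "local_set s A" by blast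
    then have "local_set (max r s) (A \<inter> ?D)"
      using local_set_near_roots[of r]
      by (intro local_set_Int local_set_mono[of s A "max r s"] local_set_mono[of r ?D "max r s"]) simp_all
    then show ?case by (rule measurable_root_sum_local_set)
  next
    case empty
    have "root_sum (indicator {}) = (\<lambda>x :: bool rooted_net. 0)"
      using root_sum_cmult[of 0 "\<lambda>_ :: bool birooted_net. 0"] by (simp add: fun_eq_iff indicator_def[abs_def])
    then show ?case by (simp only: Int_empty_left borel_measurable_const)
  next
    case (compl A)
    have "root_sum (indicator ((UNIV - A) \<inter> ?D)) x =
        root_sum (indicator ?D) x - root_sum (indicator (A \<inter> ?D)) x" for x
    proof -
      have "indicator ?D = (\<lambda>d. indicator ((UNIV - A) \<inter> ?D) d + indicator (A \<inter> ?D) d :: ennreal)"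
        by (auto simp: fun_eq_iff indicator_def)
      then have sum: "root_sum (indicator ?D) x =
          root_sum (indicator ((UNIV - A) \<inter> ?D)) x + root_sum (indicator (A \<inter> ?D)) x"
        using root_sum_add[of "indicator ((UNIV - A) \<inter> ?D)" "indicator (A \<inter> ?D)" x] by simp
      moreover have "root_sum (indicator (A \<inter> ?D)) x \<noteq> \<infinity>"
        using sum ball_size_bounds(2)[of r x] unfolding ball_size_def by auto
      ultimately show ?thesis by (simp add: ennreal_add_diff_cancel_right)
    qed
    then have "root_sum (indicator ((UNIV - A) \<inter> ?D)) =
        (\<lambda>x. root_sum (indicator ?D) x - root_sum (indicator (A \<inter> ?D)) x)" by blast
    then show ?case using D compl by simp
  next
    case (union A)
    have Int: "\<Union> (range A) \<inter> ?D = (\<Union>i. A i \<inter> ?D)" by blast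
    have "indicator (\<Union>i. A i \<inter> ?D) = (\<lambda>d. \<Sum>i. indicator (A i \<inter> ?D) d :: ennreal)"
    proof
      fix d
      have "disjoint_family (\<lambda>i. A i \<inter> ?D)" using union(1) by (auto simp: disjoint_family_on_def)
      from suminf_indicator[OF this, of d, symmetric]
      show "indicator (\<Union>i. A i \<inter> ?D) d = (\<Sum>i. indicator (A i \<inter> ?D) d :: ennreal)"
        by simp
    qed
    then have sum: "root_sum (indicator (\<Union>i. A i \<inter> ?D)) = (\<lambda>x. \<Sum>i. root_sum (indicator (A i \<inter> ?D)) x)"
      by (intro ext) (simp only: root_sum_suminf)
    show ?case
      unfolding Int sum by (rule borel_measurable_suminf_order) (rule union(3))
  qed
qed

lemma measurable_root_sum [measurable (raw)]:
  fixes f :: "bool birooted_net \<Rightarrow> ennreal"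
  assumes "f \<in> borel_measurable borel"
  shows "root_sum f \<in> borel_measurable borel"
proof -
  let ?D = "\<lambda>r. {d :: bool birooted_net. near_roots r d}"
  have "root_sum (\<lambda>d. f d * indicator (?D r) d) \<in> borel_measurable borel" for r
    using assms
  proof (induction rule: borel_measurable_induct)
    case (cong f g)
    then show ?case by (simp add: ext[of f g])
  next
    case (set A)
    have "indicator (A \<inter> ?D r) = (\<lambda>d. indicator A d * indicator (?D r) d :: ennreal)"
      by (rule ext) (rule indicator_inter_arith)
    then show ?case using measurable_root_sum_near_roots[OF set, of r] by simp
  next
    case (mult u c)
    then show ?case by (simp add: mult.assoc root_sum_cmult[abs_def])
  next
    case (add u v)
    then show ?case by (simp add: distrib_right root_sum_add[abs_def])
  next
    case (seq U)
    have "root_sum (\<lambda>d. (SUP i. U i) d * indicator (?D r) d) x =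
        (SUP i. root_sum (\<lambda>d. U i d * indicator (?D r) d) x)" for x
      using seq(3)
      by (subst root_sum_SUP[symmetric])
        (auto simp: incseq_def le_fun_def SUP_mult_right_ennreal image_comp intro!: mult_right_mono)
    then show ?case using seq by (simp add: borel_measurable_SUP[of UNIV] cong: measurable_cong)
  qed
  moreover have "root_sum f x = (SUP r. root_sum (\<lambda>d. f d * indicator (?D r) d) x)" for x
  proof -
    have "f d = (SUP r. f d * indicator (?D r) d)" for d
    proof -
      obtain r where "near_roots r d" using near_roots_exists by blast
      then show ?thesis
        by (intro antisym SUP_least SUP_upper2[of r]) (auto simp: indicator_def)
    qed
    then have "root_sum f x = root_sum (\<lambda>d. SUP r. f d * indicator (?D r) d) x" by simp
    also have "\<dots> = (SUP r. root_sum (\<lambda>d. f d * indicator (?D r) d) x)"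
      using near_roots_mono by (intro root_sum_SUP) (auto simp: incseq_def indicator_def)
    finally show ?thesis .
  qed
  ultimately show ?thesis by (simp add: borel_measurable_SUP[of UNIV] cong: measurable_cong)
qed

section \<open>The kernel of i.i.d. markings\<close>

lemma is_network_mark_vertices [simp]: "is_network (mark_vertices G m) \<longleftrightarrow> is_network G"
  by (rule is_network_cong) simp_all

lemma network_iso_mark_vertices:
  assumes "network_iso R G H \<phi> \<psi>" "\<And>v. v \<in> verts G \<Longrightarrow> m v = m' (\<phi> v)"
  shows "network_iso (=) (mark_vertices G m) (mark_vertices H m') \<phi> \<psi>"
  using network_isoD(1,2,5)[OF assms(1)] assms(2) by (simp add: network_iso_def)

lemma net_cball_mark_vertices: "net_cball (mark_vertices G m) u r = mark_vertices (net_cball G u r) m"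
proof -
  have "adj (mark_vertices G m) = adj G" by (auto simp: adj_def fun_eq_iff)
  then show ?thesis by (simp add: net_cball_def mark_vertices_def Let_def)
qed

abbreviation coins :: "real \<Rightarrow> nat set \<Rightarrow> (nat \<Rightarrow> bool) measure" where
  "coins p V \<equiv> \<Pi>\<^sub>M v\<in>V. measure_pmf (bernoulli_pmf p)"

lemma prob_space_coins: "prob_space (coins p V)"
  by (intro prob_space_PiM measure_pmf.prob_space_axioms)

lemma measurable_coins_component [measurable]: "v \<in> V \<Longrightarrow> (\<lambda>m. m v) \<in> measurable (coins p V) (count_space UNIV)"
  using measurable_component_singleton[of v V "\<lambda>_. measure_pmf (bernoulli_pmf p)"]
    measurable_cong_sets[OF refl, of "measure_pmf (bernoulli_pmf p)" "count_space UNIV" "coins p V"]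
  by simp

lemma distr_coins_reindex:
  assumes "inj_on \<phi> B" "\<phi> ` B \<subseteq> V"
  shows "distr (coins p V) (coins p B) (\<lambda>m. \<lambda>v\<in>B. m (\<phi> v)) = coins p B"
  using assms by (intro distr_PiM_reindex) (auto intro: measure_pmf.prob_space_axioms)

lemma measurable_coins_reindex:
  assumes "\<phi> ` B \<subseteq> V"
  shows "(\<lambda>m. \<lambda>v\<in>B. m (\<phi> v)) \<in> measurable (coins p V) (coins p B)"
  using assms by (intro measurable_restrict measurable_component_singleton) auto

lemma sets_coins_finite:
  assumes "finite B" "S \<subseteq> space (coins p B)"
  shows "S \<in> sets (coins p B)"
proof -
  have "space (coins p B) = (\<Pi>\<^sub>E i\<in>B. UNIV)" by (simp add: space_PiM)
  then have fin: "finite S"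
    using assms finite_PiE[of B "\<lambda>_. UNIV :: bool set"] by (auto intro: finite_subset)
  have "{m} \<in> sets (coins p B)" if "m \<in> S" for m
  proof -
    have "(\<Pi>\<^sub>E i\<in>B. {m i}) = {m}"
      using that assms(2) by (intro PiE_singleton) (auto simp: space_PiM PiE_def)
    moreover have "(\<Pi>\<^sub>E i\<in>B. {m i}) \<in> sets (coins p B)"
      by (intro sets_PiM_I_finite assms(1)) simp
    ultimately show ?thesis by simp
  qed
  then have "(\<Union>m\<in>S. {m}) \<in> sets (coins p B)"
    using fin by (intro sets.finite_UN) auto
  then show ?thesis by simp
qed

text \<open>
  The law of \<open>[G, u, v]\<close> with i.i.d. vertex marks. Two roots are kept because the mean over the marks of
  a mass transport on marked networks must again be a mass transport, and because it determines
  \<^const>\<open>iid_marking\<close> (\<open>iid_marking_eq_distr\<close>).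
\<close>

lift_definition iid_marking2 :: "real \<Rightarrow> unit birooted_net \<Rightarrow> bool birooted_net measure" is
  "\<lambda>p (G, u, v). distr (coins p (verts G)) borel (\<lambda>m. abs_birooted_net (mark_vertices G m, u, v))"
proof -
  fix p :: real and x y :: "unit network \<times> nat \<times> nat"
  let ?m = "\<lambda>G u v m. abs_birooted_net (mark_vertices G m, u, v)"
  assume "birooted_iso x y"
  then obtain G u v H \<phi> \<psi> where *: "x = (G, u, v)" "y = (H, \<phi> u, \<phi> v)" "is_network G" "is_network H"
      "u \<in> verts G" "\<phi> u \<in> verts H" "v \<in> verts G" "\<phi> v \<in> verts H" "network_iso (=) G H \<phi> \<psi>"
    by (auto simp: birooted_iso_def)
  let ?f = "inv_into (verts G) \<phi>"
  have bij: "bij_betw \<phi> (verts G) (verts H)" by (rule network_isoD(1)[OF *(9)])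
  then have \<phi>: "inj_on \<phi> (verts G)" "\<phi> ` verts G = verts H" by (auto simp: bij_betw_def)
  have f: "?f ` verts H \<subseteq> verts G" using bij by (auto simp: bij_betw_def inv_into_into)
  have "distr (coins p (verts G)) borel (?m G u v) = distr (coins p (verts H)) borel (?m H (\<phi> u) (\<phi> v))"
  proof (rule distr_transport)
    show "(\<lambda>\<omega>. \<lambda>v\<in>verts G. \<omega> (\<phi> v)) \<in> measurable (coins p (verts H)) (coins p (verts G))"
      by (rule measurable_coins_reindex) (use \<phi> in simp)
    show "(\<lambda>\<omega>. \<lambda>v\<in>verts H. \<omega> (?f v)) \<in> measurable (coins p (verts G)) (coins p (verts H))"
      by (rule measurable_coins_reindex[OF f])
    show "distr (coins p (verts H)) (coins p (verts G)) (\<lambda>\<omega>. \<lambda>v\<in>verts G. \<omega> (\<phi> v)) = coins p (verts G)"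
      by (rule distr_coins_reindex) (use \<phi> in simp_all)
    show "(\<lambda>v\<in>verts G. (\<lambda>v\<in>verts H. \<omega> (?f v)) (\<phi> v)) = \<omega>" if "\<omega> \<in> space (coins p (verts G))" for \<omega>
      using that \<phi> by (auto simp: space_PiM PiE_def extensional_def fun_eq_iff)
    show "?m G u v (\<lambda>v\<in>verts G. \<omega> (\<phi> v)) = ?m H (\<phi> u) (\<phi> v) \<omega>" for \<omega>
      by (rule Quotient_rel_abs[OF Quotient_birooted_net],
          rule birooted_isoI[OF network_iso_mark_vertices[OF *(9)]])
        (use * in simp_all)
  qed
  then show "(case x of (G, u, v) \<Rightarrow> distr (coins p (verts G)) borel (?m G u v)) =
      (case y of (G, u, v) \<Rightarrow> distr (coins p (verts G)) borel (?m G u v))"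
    using *(1,2) by simp
qed

lemma iid_marking2_abs:
  assumes "is_network G" "u \<in> verts G" "v \<in> verts G"
  shows "iid_marking2 p (abs_birooted_net (G, u, v)) =
    distr (coins p (verts G)) borel (\<lambda>m. abs_birooted_net (mark_vertices G m, u, v))"
  by (simp only: iid_marking2.abs_eq[OF birooted_iso_refl[OF assms]] prod.case)

lemma iid_marking_abs:
  assumes "is_network G" "u \<in> verts G"
  shows "iid_marking p (abs_rooted_net (G, u)) =
    distr (coins p (verts G)) borel (\<lambda>m. abs_rooted_net (mark_vertices G m, u))"
  by (simp only: iid_marking.abs_eq[OF rooted_iso_refl[OF assms]] prod.case)

lemma local_set_mark_vertices:
  assumes A: "local_set r A"
    and iso: "network_iso R (net_cball G u r) (net_cball H (\<phi> u) r) \<phi> \<psi>"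
    and G: "is_network G" "u \<in> verts G" "v \<in> verts (net_cball G u r)"
    and H: "is_network H" "\<phi> u \<in> verts H"
    and m: "\<And>v. v \<in> verts (net_cball G u r) \<Longrightarrow> m v = m' (\<phi> v)"
  shows "abs_birooted_net (mark_vertices G m, u, v) \<in> A \<longleftrightarrow>
    abs_birooted_net (mark_vertices H m', \<phi> u, \<phi> v) \<in> A" (is "?x \<in> A \<longleftrightarrow> ?y \<in> A")
proof -
  have v: "v \<in> verts G" using G net_cball_subset by blast
  have t: "\<phi> v \<in> verts H" using network_isoD(3)[OF iso G(3)] net_cball_subset[OF H] by blast
  have "network_iso (=) (mark_vertices (net_cball G u r) m) (mark_vertices (net_cball H (\<phi> u) r) m') \<phi> \<psi>"
    by (rule network_iso_mark_vertices[OF iso]) (rule m)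
  then have "network_iso (\<lambda>x y. dist x y < 1) (net_cball (mark_vertices G m) u r)
      (net_cball (mark_vertices H m') (\<phi> u) r) \<phi> \<psi>"
    by (simp only: net_cball_mark_vertices dist_bool_less_1)
  then have "ball_near2 r 1 ?x ?y"
    using G H v t by (subst ball_near2_abs) auto
  moreover have "near_roots r ?x"
    using G v by (subst near_roots_abs) (auto simp: net_cball_mark_vertices simp del: net_cball_simps)
  ultimately show ?thesis
    using A ball_near2_sym unfolding local_set_def by blast
qed

text \<open>
  Membership in a local set depends only on the marks in a ball. Hence its probability is computed on the
  finite product over the ball of \<open>G\<close>, whichever network \<open>H\<close> with an isomorphic ball is marked.
\<close>

lemma cylinder_local_set:
  fixes p :: real
  assumes A: "local_set r A"
    and G: "is_network G" "u \<in> verts G" "v \<in> verts (net_cball G u r)"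
    and H: "is_network H" "\<phi> u \<in> verts H"
    and iso: "network_iso R (net_cball G u r) (net_cball H (\<phi> u) r) \<phi> \<psi>"
  defines "B \<equiv> verts (net_cball G u r)"
  defines "E \<equiv> {m \<in> space (coins p (verts H)). abs_birooted_net (mark_vertices H m, \<phi> u, \<phi> v) \<in> A}"
    and "S \<equiv> {m \<in> space (coins p B). abs_birooted_net (mark_vertices G m, u, v) \<in> A}"
  shows "E \<in> sets (coins p (verts H))" "emeasure (coins p (verts H)) E = emeasure (coins p B) S"
proof -
  let ?t = "\<lambda>m. \<lambda>v\<in>B. m (\<phi> v)"
  have \<phi>: "inj_on \<phi> B" "\<phi> ` B \<subseteq> verts H"
    using network_isoD(1)[OF iso] net_cball_subset[OF H, of r] by (auto simp: bij_betw_def B_def simp del: net_cball_simps)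
  have t: "?t \<in> measurable (coins p (verts H)) (coins p B)" by (rule measurable_coins_reindex[OF \<phi>(2)])
  have "finite B" unfolding B_def by (rule finite_cball(1)[OF G(1,2)])
  then have S: "S \<in> sets (coins p B)" by (rule sets_coins_finite) (auto simp: S_def)
  have "abs_birooted_net (mark_vertices G (?t m), u, v) \<in> A \<longleftrightarrow>
      abs_birooted_net (mark_vertices H m, \<phi> u, \<phi> v) \<in> A" for m
    by (rule local_set_mark_vertices[OF A iso G H]) (simp add: B_def del: net_cball_simps)
  then have E: "E = ?t -` S \<inter> space (coins p (verts H))"
    using measurable_space[OF t] unfolding E_def S_def by auto
  show "E \<in> sets (coins p (verts H))" unfolding E by (rule measurable_sets[OF t S])
  have "emeasure (coins p B) S = emeasure (distr (coins p (verts H)) (coins p B) ?t) S"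
    by (simp only: distr_coins_reindex[OF \<phi>])
  also have "\<dots> = emeasure (coins p (verts H)) E" unfolding E by (rule emeasure_distr[OF t S])
  finally show "emeasure (coins p (verts H)) E = emeasure (coins p B) S" by simp
qed

lemma network_iso_True_id: "network_iso (\<lambda>_ _. True) K K id id"
  by (auto simp: network_iso_def)

lemma measurable_mark_birooted:
  assumes G: "is_network G" "u \<in> verts G" "v \<in> verts G"
  shows "(\<lambda>m. abs_birooted_net (mark_vertices G m, u, v)) \<in> measurable (coins p (verts G)) borel"
proof (rule measurable_sigma_sets[OF sets_borel_local])
  fix A assume "A \<in> {A. \<exists>r. local_set r A}"
  then obtain r where A: "local_set r A" by blast
  let ?f = "\<lambda>m. abs_birooted_net (mark_vertices G m, u, v)"
  have *: "?f -` A \<inter> space (coins p (verts G)) = {m \<in> space (coins p (verts G)). ?f m \<in> A}" by auto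
  show "?f -` A \<inter> space (coins p (verts G)) \<in> sets (coins p (verts G))"
  proof (cases "v \<in> verts (net_cball G u r)")
    case True
    show ?thesis
      unfolding * using cylinder_local_set(1)[OF A G(1,2) True G(1), of id "\<lambda>_ _. True" id p] G(2) network_iso_True_id[of "net_cball G u r"]
      by (simp del: net_cball_simps)
  next
    case False
    have "?f m \<notin> A" for m
    proof
      assume "?f m \<in> A"
      then have "near_roots r (?f m)" using A unfolding local_set_def by blast
      then show False
        using False G near_roots_abs[of "mark_vertices G m" u v r]
        by (simp add: net_cball_mark_vertices del: net_cball_simps)
    qed
    then have "?f -` A = {}" by blast
    then show ?thesis by simp
  qed
qed auto

lemma sets_iid_marking2 [simp, measurable_cong]: "sets (iid_marking2 p d) = sets borel"
  by (cases d rule: birooted_net_cases) (simp add: iid_marking2_abs)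

lemma space_iid_marking2 [simp]: "space (iid_marking2 p d) = UNIV"
  using sets_eq_imp_space_eq[OF sets_iid_marking2] by simp

lemma prob_space_iid_marking2: "prob_space (iid_marking2 p d)"
  by (cases d rule: birooted_net_cases)
    (simp add: iid_marking2_abs prob_space.prob_space_distr[OF prob_space_coins] measurable_mark_birooted)

lemma emeasure_iid_marking2_local_set:
  assumes A: "local_set r A" and near: "ball_near2 r 1 d d'" "near_roots r d"
  shows "emeasure (iid_marking2 p d) A = emeasure (iid_marking2 p d') A"
  using near
proof (cases rule: ball_near2_cases)
  case (1 G u v H \<phi> \<psi>)
  have A': "A \<in> sets borel" by (rule borel_open[OF open_local_set[OF A]])
  have distr: "emeasure (iid_marking2 p (abs_birooted_net (H, w, t))) A =
      emeasure (coins p (verts H)) {m \<in> space (coins p (verts H)). abs_birooted_net (mark_vertices H m, w, t) \<in> A}"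
    if "is_network H" "w \<in> verts H" "t \<in> verts H" for H w t
    unfolding iid_marking2_abs[OF that]
    by (subst emeasure_distr[OF measurable_mark_birooted[OF that] A']) (auto intro: arg_cong[where f = "emeasure _"])
  show ?thesis
    unfolding 1(1,5) distr[OF 1(2-4)] distr[OF 1(6-8)]
    using cylinder_local_set(2)[OF A 1(2,3,9) 1(6,7,10), of p]
      cylinder_local_set(2)[OF A 1(2,3,9) 1(2), of id "\<lambda>_ _. True" id p] 1(3) network_iso_True_id[of "net_cball G u r"]
    by (simp del: net_cball_simps)
qed

lemma emeasure_iid_marking2_not_near:
  assumes A: "local_set r A" and "\<not> near_roots r d"
  shows "emeasure (iid_marking2 p d) A = 0"
proof (cases d rule: birooted_net_cases)
  case (1 G u v)
  have A': "A \<in> sets borel" by (rule borel_open[OF open_local_set[OF A]])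
  have "abs_birooted_net (mark_vertices G m, u, v) \<notin> A" for m
  proof
    assume "abs_birooted_net (mark_vertices G m, u, v) \<in> A"
    then have "near_roots r (abs_birooted_net (mark_vertices G m, u, v))"
      using A unfolding local_set_def by blast
    then show False
      using assms(2) 1 near_roots_abs[of "mark_vertices G m" u v r]
      by (simp add: net_cball_mark_vertices near_roots_abs del: net_cball_simps)
  qed
  then show ?thesis
    unfolding 1(1) iid_marking2_abs[OF 1(2-4)]
    by (subst emeasure_distr[OF measurable_mark_birooted[OF 1(2-4)] A']) (simp add: vimage_def)
qed

text \<open>
  On local sets the kernel is constant on the classes of \<open>ball_near2 r 1\<close>; local sets generate.
\<close>

lemma measurable_iid_marking2 [measurable]: "iid_marking2 p \<in> measurable borel (subprob_algebra borel)"
proof (rule measurable_subprob_algebra_generated[OF sets_borel_local Int_stable_local_sets])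
  show "subprob_space (iid_marking2 p d)" for d
    by (rule prob_space_imp_subprob_space[OF prob_space_iid_marking2])
  show "(\<lambda>d. emeasure (iid_marking2 p d) UNIV) \<in> borel_measurable borel"
    using prob_space.emeasure_space_1[OF prob_space_iid_marking2] by simp
  show "(\<lambda>d. emeasure (iid_marking2 p d) A) \<in> borel_measurable borel"
    if "A \<in> {A. \<exists>r. local_set r A}" for A
  proof (rule borel_measurableI)
    from that obtain r where A: "local_set r A" by blast
    fix S :: "ennreal set"
    let ?g = "\<lambda>d. emeasure (iid_marking2 p d) A" and ?D = "{d :: unit birooted_net. near_roots r d}"
    have "open (?g -` S \<inter> ?D)"
      by (rule open_birooted_localI)
        (use emeasure_iid_marking2_local_set[OF A] ball_near2_near_roots in \<open>auto intro!: exI[of _ r]\<close>)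
    \<comment> \<open>outside \<open>?D\<close> the probability of \<open>A\<close> is \<open>0\<close>\<close>
    moreover have "?g -` S = (?g -` S \<inter> ?D) \<union> (if 0 \<in> S then - ?D else {})"
    proof -
      have "?g d = 0" if "d \<notin> ?D" for d using that emeasure_iid_marking2_not_near[OF A] by simp
      then show ?thesis by (cases "0 \<in> S") (simp_all add: set_eq_iff, metis+)
    qed
    moreover have "?D \<in> sets borel" using measurable_near_roots by (simp add: pred_def)
    moreover have "(if 0 \<in> S then - ?D else {}) \<in> sets borel"
      using \<open>?D \<in> sets borel\<close> by simp
    ultimately have "?g -` S \<in> sets borel"
      using sets.Un[of "?g -` S \<inter> ?D" borel "if 0 \<in> S then - ?D else {}"] borel_open by simp
    then show "?g -` S \<inter> space borel \<in> sets borel" by simp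
  qed
qed auto

lemma iid_marking2_swap_roots:
  "iid_marking2 p (swap_roots d) = distr (iid_marking2 p d) borel swap_roots"
proof (cases d rule: birooted_net_cases)
  case (1 G u v)
  show ?thesis
    unfolding 1(1) swap_roots_abs[OF 1(2-4)] iid_marking2_abs[OF 1(2-4)] iid_marking2_abs[OF 1(2,4,3)]
    using 1 by (subst distr_distr) (simp_all add: measurable_mark_birooted comp_def swap_roots_abs)
qed

lemma iid_marking_eq_distr:
  "iid_marking p (first_rooted d) = distr (iid_marking2 p d) borel first_rooted"
proof (cases d rule: birooted_net_cases)
  case (1 G u v)
  show ?thesis
    unfolding 1(1) first_rooted_abs[OF 1(2-4)] iid_marking2_abs[OF 1(2-4)] iid_marking_abs[OF 1(2,3)]
    using 1 by (subst distr_distr) (simp_all add: measurable_mark_birooted comp_def first_rooted_abs)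
qed

lemma measurable_iid_marking [measurable]: "iid_marking p \<in> measurable borel (subprob_algebra borel)"
proof -
  have "iid_marking p = (\<lambda>x. distr (iid_marking2 p (double_root x)) borel first_rooted)"
    using iid_marking_eq_distr[of p "double_root _"] by (simp add: fun_eq_iff)
  moreover have "(\<lambda>x. distr (iid_marking2 p (double_root x)) borel first_rooted)
      \<in> measurable borel (subprob_algebra borel)"
    by (rule measurable_compose[OF _ measurable_distr[of _ borel]]) measurable
  ultimately show ?thesis by simp
qed

lemma sets_iid_marking [simp, measurable_cong]: "sets (iid_marking p x) = sets borel"
  using iid_marking_eq_distr[of p "double_root x"] by simp

lemma prob_space_iid_marking: "prob_space (iid_marking p x)"
  using iid_marking_eq_distr[of p "double_root x"]
  by (simp add: prob_space.prob_space_distr[OF prob_space_iid_marking2])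

lemma measurable_mark_rooted:
  assumes "is_network G" "u \<in> verts G"
  shows "(\<lambda>m. abs_rooted_net (mark_vertices G m, u)) \<in> measurable (coins p (verts G)) borel"
  using measurable_compose[OF measurable_mark_birooted[OF assms assms(2), of p] measurable_first_rooted] assms
  by (simp add: first_rooted_abs)

text \<open>
  Marking leaves the vertex set unchanged, so the mean over the marks and the sum over vertices
  commute (Tonelli).
\<close>

lemma nn_integral_root_sum_iid_marking:
  assumes g [measurable]: "g \<in> borel_measurable borel"
  shows "(\<integral>\<^sup>+ y. root_sum g y \<partial>iid_marking p x) = root_sum (\<lambda>d. \<integral>\<^sup>+ d'. g d' \<partial>iid_marking2 p d) x"
proof (cases x rule: rooted_net_cases)
  case (1 G u)
  let ?V = "verts G" and ?f = "\<lambda>v m. abs_birooted_net (mark_vertices G m, u, v)"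
  have f: "?f v \<in> measurable (coins p ?V) borel" if "v \<in> ?V" for v
    by (rule measurable_mark_birooted[OF 1(2,3) that])
  have "(\<integral>\<^sup>+ y. root_sum g y \<partial>iid_marking p x) =
      (\<integral>\<^sup>+ m. root_sum g (abs_rooted_net (mark_vertices G m, u)) \<partial>coins p ?V)"
    unfolding 1(1) iid_marking_abs[OF 1(2,3)]
    by (rule nn_integral_distr[OF measurable_mark_rooted[OF 1(2,3)]]) (simp add: measurable_root_sum)
  also have "\<dots> = (\<integral>\<^sup>+ m. (\<Sum>v. g (?f v m) * indicator ?V v) \<partial>coins p ?V)"
    using 1 by (intro nn_integral_cong)
      (simp add: root_sum_abs nn_integral_count_space_indicator nn_integral_count_space_nat)
  also have "\<dots> = (\<Sum>v. \<integral>\<^sup>+ m. g (?f v m) * indicator ?V v \<partial>coins p ?V)"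
  proof (rule nn_integral_suminf)
    show "(\<lambda>m. g (?f v m) * indicator ?V v) \<in> borel_measurable (coins p ?V)" for v
      using measurable_compose[OF f g] by (cases "v \<in> ?V") simp_all
  qed
  also have "\<dots> = (\<Sum>v. (\<integral>\<^sup>+ d'. g d' \<partial>iid_marking2 p (abs_birooted_net (G, u, v))) * indicator ?V v)"
  proof (rule suminf_cong)
    show "(\<integral>\<^sup>+ m. g (?f v m) * indicator ?V v \<partial>coins p ?V) =
        (\<integral>\<^sup>+ d'. g d' \<partial>iid_marking2 p (abs_birooted_net (G, u, v))) * indicator ?V v" for v
    proof (cases "v \<in> ?V")
      case True
      then show ?thesis
        unfolding iid_marking2_abs[OF 1(2,3) True] by (simp add: nn_integral_distr[OF f[OF True]])
    qed simp
  qed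
  also have "\<dots> = root_sum (\<lambda>d. \<integral>\<^sup>+ d'. g d' \<partial>iid_marking2 p d) x"
    unfolding 1(1) root_sum_abs[OF 1(2,3)]
    by (simp add: nn_integral_count_space_indicator nn_integral_count_space_nat)
  finally show ?thesis .
qed

section \<open>Unimodularity of the marked network\<close>

lemma sets_iid_marked [simp, measurable_cong]:
  "sets \<mu> = sets borel \<Longrightarrow> sets (iid_marked p \<mu>) = sets borel"
  unfolding iid_marked_def using sets_eq_imp_space_eq[of \<mu> borel] by (intro sets_bind) auto

lemma measurable_iid_marking':
  "sets \<mu> = sets borel \<Longrightarrow> iid_marking p \<in> measurable \<mu> (subprob_algebra borel)"
  using measurable_iid_marking[of p] by (simp cong: measurable_cong_sets)

lemma nn_integral_iid_marked:
  assumes "sets \<mu> = sets borel" "f \<in> borel_measurable borel"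
  shows "(\<integral>\<^sup>+ y. f y \<partial>iid_marked p \<mu>) = (\<integral>\<^sup>+ x. (\<integral>\<^sup>+ y. f y \<partial>iid_marking p x) \<partial>\<mu>)"
  unfolding iid_marked_def by (rule nn_integral_bind[OF assms(2) measurable_iid_marking'[OF assms(1)]])

lemma emeasure_iid_marked:
  assumes "sets \<mu> = sets borel" "A \<in> sets borel"
  shows "emeasure (iid_marked p \<mu>) A = (\<integral>\<^sup>+ x. emeasure (iid_marking p x) A \<partial>\<mu>)"
  using nn_integral_iid_marked[OF assms(1), of "indicator A" p] assms by simp

lemma prob_space_iid_marked:
  assumes "prob_space \<mu>" "sets \<mu> = sets borel"
  shows "prob_space (iid_marked p \<mu>)"
proof
  have "space (iid_marked p \<mu>) = UNIV" using sets_eq_imp_space_eq[OF sets_iid_marked[OF assms(2)]] by simp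
  moreover have "emeasure (iid_marking p x) UNIV = 1" for x
    using prob_space.emeasure_space_1[OF prob_space_iid_marking, of p x]
      sets_eq_imp_space_eq[OF sets_iid_marking, of p x] by simp
  ultimately show "emeasure (iid_marked p \<mu>) (space (iid_marked p \<mu>)) = 1"
    using prob_space.emeasure_space_1[OF assms(1)] by (simp add: emeasure_iid_marked[OF assms(2)])
qed

text \<open>
  Averaging a transport over the marks gives a transport on the unmarked graph, and averaging commutes
  with exchanging the roots. Boundedness makes the averaged transport real-valued, as
  \<^const>\<open>unimodular\<close> requires.
\<close>

lemma mass_transport_iid_marked_bounded:
  assumes \<mu>: "sets \<mu> = sets borel" "unimodular \<mu>"
    and g [measurable]: "g \<in> borel_measurable borel" and c: "\<And>d. g d \<le> c" "c < \<infinity>"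
  shows "(\<integral>\<^sup>+ y. root_sum g y \<partial>iid_marked p \<mu>) =
    (\<integral>\<^sup>+ y. root_sum (\<lambda>d. g (swap_roots d)) y \<partial>iid_marked p \<mu>)"
proof -
  let ?g = "\<lambda>d. \<integral>\<^sup>+ d'. g d' \<partial>iid_marking2 p d"
  have "?g d \<le> (\<integral>\<^sup>+ d'. c \<partial>iid_marking2 p d)" for d
    by (intro nn_integral_mono c)
  moreover have "emeasure (iid_marking2 p d) UNIV = 1" for d
    using prob_space.emeasure_space_1[OF prob_space_iid_marking2, of p d] by simp
  ultimately have "?g d \<le> c" for d by simp
  then have fin: "?g d < \<infinity>" for d
    using c(2) by (rule order_le_less_trans)
  have [measurable]: "?g \<in> borel_measurable borel"
    by (rule measurable_compose[OF measurable_iid_marking2 nn_integral_measurable_subprob_algebra[OF g]])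
  have swap: "?g (swap_roots d) = (\<integral>\<^sup>+ d'. g (swap_roots d') \<partial>iid_marking2 p d)" for d
    unfolding iid_marking2_swap_roots by (rule nn_integral_distr) simp_all
  have "(\<integral>\<^sup>+ y. root_sum g y \<partial>iid_marked p \<mu>) = (\<integral>\<^sup>+ x. root_sum ?g x \<partial>\<mu>)"
    by (simp add: nn_integral_iid_marked \<mu> measurable_root_sum nn_integral_root_sum_iid_marking)
  also have "\<dots> = (\<integral>\<^sup>+ x. root_sum (\<lambda>d. ennreal (enn2real (?g d))) x \<partial>\<mu>)"
    using fin by simp
  also have "\<dots> = (\<integral>\<^sup>+ x. root_sum (\<lambda>d. ennreal (enn2real (?g (swap_roots d)))) x \<partial>\<mu>)"
    by (rule \<mu>(2)[unfolded unimodular_def, rule_format]) simp_all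
  also have "\<dots> = (\<integral>\<^sup>+ x. root_sum (\<lambda>d. \<integral>\<^sup>+ d'. g (swap_roots d') \<partial>iid_marking2 p d) x \<partial>\<mu>)"
    using fin by (simp add: swap[symmetric])
  also have "\<dots> = (\<integral>\<^sup>+ y. root_sum (\<lambda>d. g (swap_roots d)) y \<partial>iid_marked p \<mu>)"
    by (simp add: nn_integral_iid_marked \<mu> measurable_root_sum nn_integral_root_sum_iid_marking)
  finally show ?thesis .
qed

lemma mass_transport_iid_marked:
  assumes \<mu>: "sets \<mu> = sets borel" "unimodular \<mu>" and g [measurable]: "g \<in> borel_measurable borel"
  shows "(\<integral>\<^sup>+ y. root_sum g y \<partial>iid_marked p \<mu>) =
    (\<integral>\<^sup>+ y. root_sum (\<lambda>d. g (swap_roots d)) y \<partial>iid_marked p \<mu>)"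
proof -
  let ?P = "iid_marked p \<mu>"
  have lim: "(\<integral>\<^sup>+ y. root_sum h y \<partial>?P) = (SUP n. \<integral>\<^sup>+ y. root_sum (\<lambda>d. min (h d) (of_nat n)) y \<partial>?P)"
    if h [measurable]: "h \<in> borel_measurable borel" for h
  proof -
    have inc: "incseq (\<lambda>n. min (h d) (of_nat n))" for d
      by (auto simp: incseq_def intro: min.coboundedI2)
    have "(SUP n. min (h d) (of_nat n)) = h d" for d
    proof -
      have "(SUP n. inf (h d) (of_nat n)) = inf (h d) (SUP n. of_nat n)"
        by (rule inf_SUP[symmetric])
      then show ?thesis by (simp add: ennreal_SUP_of_nat_eq_top inf_min)
    qed
    then have "root_sum h y = (SUP n. root_sum (\<lambda>d. min (h d) (of_nat n)) y)" for y
      using root_sum_SUP[OF inc, where x = y] by simp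
    then have "(\<integral>\<^sup>+ y. root_sum h y \<partial>?P) = (\<integral>\<^sup>+ y. (SUP n. root_sum (\<lambda>d. min (h d) (of_nat n)) y) \<partial>?P)"
      by simp
    also have "\<dots> = (SUP n. \<integral>\<^sup>+ y. root_sum (\<lambda>d. min (h d) (of_nat n)) y \<partial>?P)"
    proof (rule nn_integral_monotone_convergence_SUP)
      show "incseq (\<lambda>n. root_sum (\<lambda>d. min (h d) (of_nat n)))"
        using inc by (auto simp: incseq_def le_fun_def intro!: root_sum_mono)
      have "root_sum (\<lambda>d. min (h d) (of_nat n)) \<in> borel_measurable borel" for n
        by (rule measurable_root_sum) measurable
      then show "root_sum (\<lambda>d. min (h d) (of_nat n)) \<in> borel_measurable ?P" for n
        using \<mu>(1) by (simp cong: measurable_cong_sets)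
    qed
    finally show ?thesis .
  qed
  have "(\<integral>\<^sup>+ y. root_sum (\<lambda>d. min (g d) (of_nat n)) y \<partial>?P) =
      (\<integral>\<^sup>+ y. root_sum (\<lambda>d. min (g (swap_roots d)) (of_nat n)) y \<partial>?P)" for n :: nat
    by (rule mass_transport_iid_marked_bounded[OF \<mu>, where c = "of_nat n"]) (simp_all add: of_nat_less_top)
  then show ?thesis
    using lim[of g] lim[of "\<lambda>d. g (swap_roots d)"] by simp
qed

section \<open>Independence of invariant events and the root mark\<close>

text \<open>
  Bessel's inequality for the indicator of \<open>J\<close> and the centred indicators \<open>X v\<close> of the events \<open>E v\<close>:
  these are orthogonal with variance \<open>p - p\<^sup>2 \<le> 1\<close>. The proof expands \<open>0 \<le> E (1\<^sub>J - Y)\<^sup>2\<close>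
  for \<open>Y = \<Sum>v. D v * X v\<close>, where \<open>D v = E (1\<^sub>J * X v)\<close>.
\<close>

lemma (in prob_space) bessel_independent_events:
  assumes F: "finite F" "\<And>v. v \<in> F \<Longrightarrow> E v \<in> events" "J \<in> events"
    and p: "\<And>v. v \<in> F \<Longrightarrow> prob (E v) = p"
    and indep: "\<And>v w. v \<in> F \<Longrightarrow> w \<in> F \<Longrightarrow> v \<noteq> w \<Longrightarrow> prob (E v \<inter> E w) = p * p"
  shows "(\<Sum>v\<in>F. (prob (J \<inter> E v) - p * prob J)\<^sup>2) \<le> 1"
proof -
  define X where "X v \<omega> = indicator (E v) \<omega> - p" for v \<omega>
  define D where "D v = prob (J \<inter> E v) - p * prob J" for v
  define Y where "Y \<omega> = (\<Sum>v\<in>F. D v * X v \<omega>)" for \<omega>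
  have EX: "expectation (\<lambda>\<omega>. X v \<omega> * X w \<omega>) = (if v = w then p - p\<^sup>2 else 0)" if "v \<in> F" "w \<in> F" for v w
  proof -
    have [measurable]: "E v \<in> events" "E w \<in> events" using F that by auto
    have "expectation (\<lambda>\<omega>. X v \<omega> * X w \<omega>) =
        expectation (\<lambda>\<omega>. indicator (E v \<inter> E w) \<omega> - p * indicator (E v) \<omega> - p * indicator (E w) \<omega> + p * p)"
      unfolding X_def by (intro Bochner_Integration.integral_cong refl) (simp add: algebra_simps indicator_inter_arith)
    also have "\<dots> = prob (E v \<inter> E w) - p * prob (E v) - p * prob (E w) + p * p"
      by (simp add: prob_space emeasure_eq_measure)
    finally show ?thesis using p that indep by (auto simp: power2_eq_square)
  qed
  have intX: "integrable M (\<lambda>\<omega>. X v \<omega> * X w \<omega>)" "integrable M (\<lambda>\<omega>. indicator J \<omega> * X v \<omega>)"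
    if "v \<in> F" "w \<in> F" for v w
  proof -
    have [measurable]: "E v \<in> events" "E w \<in> events" "J \<in> events" using F that by auto
    have X: "\<bar>X v \<omega>\<bar> \<le> 1 + \<bar>p\<bar>" for v \<omega>
      unfolding X_def indicator_def by (simp add: abs_if)
    show "integrable M (\<lambda>\<omega>. X v \<omega> * X w \<omega>)"
    proof (rule integrable_const_bound[where B = "(1 + \<bar>p\<bar>) * (1 + \<bar>p\<bar>)"])
      show "AE \<omega> in M. norm (X v \<omega> * X w \<omega>) \<le> (1 + \<bar>p\<bar>) * (1 + \<bar>p\<bar>)"
        using X by (auto simp: abs_mult intro!: mult_mono)
    qed (simp add: X_def)
    show "integrable M (\<lambda>\<omega>. indicator J \<omega> * X v \<omega>)"
    proof (rule integrable_const_bound[where B = "1 + \<bar>p\<bar>"])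
      show "AE \<omega> in M. norm (indicator J \<omega> * X v \<omega>) \<le> 1 + \<bar>p\<bar>"
        using X by (auto simp: indicator_def)
    qed (simp add: X_def)
  qed
  have EJ: "expectation (\<lambda>\<omega>. indicator J \<omega> * X v \<omega>) = D v" if "v \<in> F" for v
  proof -
    have [measurable]: "E v \<in> events" "J \<in> events" using F that by auto
    have "expectation (\<lambda>\<omega>. indicator J \<omega> * X v \<omega>) =
        expectation (\<lambda>\<omega>. indicator (J \<inter> E v) \<omega> - p * indicator J \<omega>)"
      unfolding X_def by (intro Bochner_Integration.integral_cong refl) (simp add: algebra_simps indicator_inter_arith)
    then show ?thesis by (simp add: D_def emeasure_eq_measure)
  qed
  let ?S = "\<Sum>v\<in>F. (D v)\<^sup>2"
  have JY: "(\<lambda>\<omega>. indicator J \<omega> * Y \<omega>) = (\<lambda>\<omega>. \<Sum>v\<in>F. D v * (indicator J \<omega> * X v \<omega>))"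
    unfolding Y_def by (simp add: fun_eq_iff sum_distrib_left mult_ac)
  have YY: "(\<lambda>\<omega>. Y \<omega> * Y \<omega>) = (\<lambda>\<omega>. \<Sum>v\<in>F. \<Sum>w\<in>F. D v * D w * (X v \<omega> * X w \<omega>))"
    unfolding Y_def by (simp add: fun_eq_iff sum_product mult_ac)
  have "expectation (\<lambda>\<omega>. indicator J \<omega> * Y \<omega>) = (\<Sum>v\<in>F. D v * expectation (\<lambda>\<omega>. indicator J \<omega> * X v \<omega>))"
    unfolding JY using intX by (simp add: Bochner_Integration.integral_sum)
  then have eJY: "expectation (\<lambda>\<omega>. indicator J \<omega> * Y \<omega>) = ?S"
    by (simp add: EJ power2_eq_square)
  have "expectation (\<lambda>\<omega>. Y \<omega> * Y \<omega>) = (\<Sum>v\<in>F. \<Sum>w\<in>F. D v * D w * expectation (\<lambda>\<omega>. X v \<omega> * X w \<omega>))"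
    unfolding YY using intX by (simp add: Bochner_Integration.integral_sum)
  also have "\<dots> = (\<Sum>v\<in>F. \<Sum>w\<in>F. if w = v then (D v)\<^sup>2 * (p - p\<^sup>2) else 0)"
    by (intro sum.cong refl) (auto simp: EX power2_eq_square)
  also have "\<dots> = ?S * (p - p\<^sup>2)"
    using F(1) by (simp add: sum_distrib_right)
  finally have eYY: "expectation (\<lambda>\<omega>. Y \<omega> * Y \<omega>) = ?S * (p - p\<^sup>2)" .
  have iJY: "integrable M (\<lambda>\<omega>. indicator J \<omega> * Y \<omega>)" and iYY: "integrable M (\<lambda>\<omega>. Y \<omega> * Y \<omega>)"
    unfolding JY YY using intX by (auto intro!: Bochner_Integration.integrable_sum)
  have "0 \<le> expectation (\<lambda>\<omega>. (indicator J \<omega> - Y \<omega>) * (indicator J \<omega> - Y \<omega>))"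
    by (rule integral_nonneg_AE) simp
  also have "\<dots> = expectation (\<lambda>\<omega>. indicator J \<omega> - 2 * (indicator J \<omega> * Y \<omega>) + Y \<omega> * Y \<omega>)"
    by (intro Bochner_Integration.integral_cong refl) (auto simp: algebra_simps indicator_def)
  also have "\<dots> = prob J - 2 * ?S + ?S * (p - p\<^sup>2)"
    using F(3) iJY iYY by (simp add: eJY eYY emeasure_eq_measure)
  finally have "?S * (2 - (p - p\<^sup>2)) \<le> prob J" by (simp add: algebra_simps)
  moreover have "p - p\<^sup>2 \<le> 1"
    using zero_le_power2[of "p - 1/2"] by (simp add: power2_eq_square algebra_simps)
  then have "?S * 1 \<le> ?S * (2 - (p - p\<^sup>2))"
    by (intro mult_left_mono) (auto intro: sum_nonneg)
  ultimately show ?thesis using prob_le_1[of J] unfolding D_def by linarith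
qed

lemma prob_coins:
  assumes "0 \<le> p" "p \<le> 1" "finite F" "F \<subseteq> V"
  shows "measure (coins p V) {m \<in> space (coins p V). \<forall>v\<in>F. m v} = p ^ card F"
proof -
  interpret product_prob_space "\<lambda>_. measure_pmf (bernoulli_pmf p)" V
    by unfold_locales
  have "emeasure (coins p V) {m \<in> space (coins p V). \<forall>v\<in>F. m v \<in> {True}} =
      (\<Prod>v\<in>F. emeasure (measure_pmf (bernoulli_pmf p)) {True})"
    by (rule emeasure_PiM_Collect) (use assms in auto)
  also have "\<dots> = ennreal (p ^ card F)"
    using assms by (simp add: emeasure_pmf_single ennreal_power)
  finally show ?thesis using assms by (simp add: measure_def)
qed

lemma rooted_abs_mark_vertices:
  assumes "is_network G" "u \<in> verts G" "v \<in> verts G"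
  shows "first_rooted (abs_birooted_net (mark_vertices G m, u, v)) = abs_rooted_net (mark_vertices G m, u)"
    "second_rooted (abs_birooted_net (mark_vertices G m, u, v)) = abs_rooted_net (mark_vertices G m, v)"
  using assms by (simp_all add: first_rooted_abs second_rooted_abs)

text \<open>
  The conditional covariance, given the graph \<open>x\<close>, of the event \<open>I\<close> with the mark of the root being \<open>1\<close>.
\<close>

definition mark_correlation :: "real \<Rightarrow> bool rooted_net set \<Rightarrow> unit rooted_net \<Rightarrow> real" where
  "mark_correlation p I x =
     measure (iid_marking p x) (I \<inter> {y. root_mark y}) - p * measure (iid_marking p x) I"

lemma root_mark_sets [measurable]: "{y :: bool rooted_net. root_mark y} \<in> sets borel"
  using measurable_root_mark by (simp add: pred_def)

lemma measurable_mark_correlation [measurable]: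
  assumes I [measurable]: "I \<in> sets borel"
  shows "mark_correlation p I \<in> borel_measurable borel"
proof -
  have "(\<lambda>x. measure (iid_marking p x) A) \<in> borel_measurable borel" if "A \<in> sets borel" for A
    using measurable_compose[OF measurable_iid_marking measurable_measure_subprob_algebra[OF that]] .
  then show ?thesis unfolding mark_correlation_def[abs_def] by simp
qed

text \<open>
  Since \<open>I\<close> does not depend on the root, on a fixed graph all summands refer to one and the same event
  of the marks, correlated with the marks of the different vertices. So Bessel's inequality bounds
  their sum.
\<close>

lemma root_sum_mark_correlation_le_1:
  assumes p: "0 \<le> p" "p \<le> 1" and I: "I \<in> sets borel"
    and inv: "\<And>d. first_rooted d \<in> I \<longleftrightarrow> second_rooted d \<in> I"
  shows "root_sum (\<lambda>d. ennreal ((mark_correlation p I (second_rooted d))\<^sup>2)) x \<le> 1"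
proof (cases x rule: rooted_net_cases)
  case (1 G u)
  let ?V = "verts G" and ?f = "\<lambda>v m. abs_rooted_net (mark_vertices G m, v)"
  let ?M = "coins p ?V"
  interpret prob_space ?M by (rule prob_space_coins)
  define J where "J = {m \<in> space ?M. ?f u m \<in> I}"
  define E where "E v = {m \<in> space ?M. m v}" for v
  have f: "?f v \<in> measurable ?M borel" if "v \<in> ?V" for v
    by (rule measurable_mark_rooted[OF 1(2) that])
  have J: "J \<in> events"
    using measurable_sets[OF f[OF 1(3)] I] by (simp add: J_def vimage_def Int_def conj_commute)
  have E: "E v \<in> events" if "v \<in> ?V" for v
    using measurable_coins_component[OF that, of p] by (simp add: pred_def E_def)
  have D: "mark_correlation p I (abs_rooted_net (G, v)) = prob (J \<inter> E v) - p * prob J" if v: "v \<in> ?V" for v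
  proof -
    have "?f v m \<in> I \<longleftrightarrow> ?f u m \<in> I" for m
      using inv[of "abs_birooted_net (mark_vertices G m, u, v)"] rooted_abs_mark_vertices[OF 1(2,3) v] by simp
    then have "?f v -` I \<inter> space ?M = J" "?f v -` (I \<inter> {y. root_mark y}) \<inter> space ?M = J \<inter> E v"
      using 1(2) v by (auto simp: J_def E_def root_mark_abs)
    then show ?thesis
      using I f[OF v] unfolding mark_correlation_def iid_marking_abs[OF 1(2) v]
      by (simp add: measure_distr)
  qed
  have bound: "(\<Sum>v\<in>F. (prob (J \<inter> E v) - p * prob J)\<^sup>2) \<le> 1" if F: "finite F" "F \<subseteq> ?V" for F
  proof (rule bessel_independent_events[OF F(1) _ J])
    show "E v \<in> events" "prob (E v) = p" if "v \<in> F" for v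
      using that F(2) E prob_coins[OF p, of "{v}" ?V] by (auto simp: E_def)
    show "prob (E v \<inter> E w) = p * p" if "v \<in> F" "w \<in> F" "v \<noteq> w" for v w
    proof -
      have "E v \<inter> E w = {m \<in> space ?M. \<forall>i\<in>{v, w}. m i}" by (auto simp: E_def)
      then show ?thesis using that F(2) prob_coins[OF p, of "{v, w}" ?V] by (simp add: power2_eq_square subset_iff)
    qed
  qed
  let ?h = "\<lambda>v. ennreal ((prob (J \<inter> E v) - p * prob J)\<^sup>2)"
  have "root_sum (\<lambda>d. ennreal ((mark_correlation p I (second_rooted d))\<^sup>2)) x =
      (\<integral>\<^sup>+ v. ?h v \<partial>count_space ?V)"
    unfolding 1(1) root_sum_abs[OF 1(2,3)]
    using 1 by (intro nn_integral_cong) (simp add: second_rooted_abs D)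
  also have "\<dots> = (\<Sum>v. ?h v * indicator ?V v)"
    by (simp add: nn_integral_count_space_indicator nn_integral_count_space_nat)
  also have "\<dots> = (SUP n. \<Sum>v<n. ?h v * indicator ?V v)" by (rule suminf_eq_SUP)
  also have "\<dots> \<le> 1"
  proof (rule SUP_least)
    fix n :: nat
    have "(\<Sum>v<n. ?h v * indicator ?V v) = (\<Sum>v\<in>{..<n} \<inter> ?V. ?h v)"
      unfolding sum.inter_restrict[OF finite_lessThan]
      by (intro sum.cong refl) (simp add: indicator_def)
    also have "\<dots> = ennreal (\<Sum>v\<in>{..<n} \<inter> ?V. (prob (J \<inter> E v) - p * prob J)\<^sup>2)"
      by (rule sum_ennreal) simp
    also have "\<dots> \<le> 1" using bound[of "{..<n} \<inter> ?V"] by simp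
    finally show "(\<Sum>v<n. ?h v * indicator ?V v) \<le> 1" .
  qed
  finally show ?thesis .
qed

text \<open>
  Transport the squared correlation at \<open>v\<close> from every vertex to \<open>v\<close>. At most \<open>1\<close> leaves the root, but on
  an infinite graph the root receives its own squared correlation from infinitely many vertices. So the
  correlation vanishes almost surely. If \<open>0 < p < 1\<close>, the conclusion fails on finite graphs: take the event
  that all marks are \<open>1\<close>.
\<close>

lemma invariant_indep_root_mark:
  assumes \<mu>: "sets \<mu> = sets borel" "unimodular \<mu>" and inf: "AE x in \<mu>. infinite_net x"
    and p: "0 \<le> p" "p \<le> 1" and I: "I \<in> sets borel"
    and inv: "\<And>d. first_rooted d \<in> I \<longleftrightarrow> second_rooted d \<in> I"
    and prob: "prob_space \<mu>"
  shows "emeasure (iid_marked p \<mu>) (I \<inter> {y. root_mark y}) = ennreal p * emeasure (iid_marked p \<mu>) I"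
proof -
  let ?F = "\<lambda>x. (mark_correlation p I x)\<^sup>2"
  have [measurable]: "?F \<in> borel_measurable borel" using I by simp
  have F\<mu>: "(\<lambda>x. ennreal (?F x)) \<in> borel_measurable \<mu>"
    using I \<mu>(1) by (simp cong: measurable_cong_sets)
  have "(\<integral>\<^sup>+ x. ennreal (?F x) * \<infinity> \<partial>\<mu>) = (\<integral>\<^sup>+ x. ennreal (?F x) * root_sum (\<lambda>_. 1) x \<partial>\<mu>)"
    by (rule nn_integral_cong_AE, rule AE_mp[OF inf], rule AE_I2) (simp add: infinite_net_iff)
  also have "\<dots> = (\<integral>\<^sup>+ x. root_sum (\<lambda>d. ennreal (?F (first_rooted d))) x \<partial>\<mu>)"
    using root_sum_first_mult[of "\<lambda>x. ennreal (?F x)" "\<lambda>_. 1"] by simp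
  also have "\<dots> = (\<integral>\<^sup>+ x. root_sum (\<lambda>d. ennreal (?F (second_rooted (swap_roots d)))) x \<partial>\<mu>)"
    by simp
  also have "\<dots> = (\<integral>\<^sup>+ x. root_sum (\<lambda>d. ennreal (?F (second_rooted d))) x \<partial>\<mu>)"
    by (rule \<mu>(2)[unfolded unimodular_def, rule_format, symmetric]) (use I in simp_all)
  also have "\<dots> \<le> (\<integral>\<^sup>+ x. 1 \<partial>\<mu>)"
    by (intro nn_integral_mono root_sum_mark_correlation_le_1[OF p I inv])
  also have "\<dots> < \<infinity>" using prob_space.emeasure_space_1[OF prob] by simp
  finally have "(\<integral>\<^sup>+ x. ennreal (?F x) * \<infinity> \<partial>\<mu>) \<noteq> \<infinity>" by simp
  then have "AE x in \<mu>. ennreal (?F x) * \<infinity> \<noteq> \<infinity>"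
    using F\<mu> by (intro nn_integral_noteq_infinite) simp_all
  then have "AE x in \<mu>. mark_correlation p I x = 0"
    by (rule AE_mp) (auto intro!: AE_I2 simp: ennreal_mult_eq_top_iff)
  then have eq: "AE x in \<mu>. emeasure (iid_marking p x) (I \<inter> {y. root_mark y}) =
      ennreal p * emeasure (iid_marking p x) I"
  proof (rule AE_mp, intro AE_I2 impI)
    fix x assume "mark_correlation p I x = 0"
    interpret prob_space "iid_marking p x" by (rule prob_space_iid_marking)
    have "measure (iid_marking p x) (I \<inter> {y. root_mark y}) = p * measure (iid_marking p x) I"
      using \<open>mark_correlation p I x = 0\<close> by (simp add: mark_correlation_def)
    then show "emeasure (iid_marking p x) (I \<inter> {y. root_mark y}) =
        ennreal p * emeasure (iid_marking p x) I"
      using p(1) by (simp add: emeasure_eq_measure ennreal_mult)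
  qed
  have "emeasure (iid_marked p \<mu>) (I \<inter> {y. root_mark y}) =
      (\<integral>\<^sup>+ x. emeasure (iid_marking p x) (I \<inter> {y. root_mark y}) \<partial>\<mu>)"
    using I by (intro emeasure_iid_marked \<mu>) simp
  also have "\<dots> = (\<integral>\<^sup>+ x. ennreal p * emeasure (iid_marking p x) I \<partial>\<mu>)"
    by (rule nn_integral_cong_AE[OF eq])
  also have "\<dots> = ennreal p * (\<integral>\<^sup>+ x. emeasure (iid_marking p x) I \<partial>\<mu>)"
    by (intro nn_integral_cmult measurable_compose[OF measurable_iid_marking'[OF \<mu>(1)]
      measurable_emeasure_subprob_algebra[OF I]])
  finally show ?thesis using I by (simp add: emeasure_iid_marked \<mu>)
qed

section \<open>Forcing the root mark\<close>

lemma force_root_mark_mark_vertices: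
  assumes "is_network G" "u \<in> verts G"
  shows "force_root_mark (abs_rooted_net (mark_vertices G m, u)) =
    abs_rooted_net (mark_vertices G (m(u := True)), u)"
proof -
  have "force_mark (mark_vertices G m) u = mark_vertices G (m(u := True))"
    by (simp add: mark_vertices_def)
  then show ?thesis using assms by (simp only: force_root_mark_abs is_network_mark_vertices mark_vertices_simps)
qed

text \<open>
  Resampling the mark of the root preserves the product measure. After resampling, the event that the
  mark is \<open>1\<close> is independent of all old marks, and on it the network is the one with forced root mark.
\<close>

lemma emeasure_iid_marking_root_mark:
  assumes p: "0 \<le> p" "p \<le> 1" and A [measurable]: "A \<in> sets borel"
  shows "emeasure (iid_marking p x) (A \<inter> {y. root_mark y}) =
    ennreal p * emeasure (iid_marking p x) (force_root_mark -` A)"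
proof (cases x rule: rooted_net_cases)
  case (1 G u)
  let ?V = "verts G" and ?f = "\<lambda>m. abs_rooted_net (mark_vertices G m, u)" and ?b = "measure_pmf (bernoulli_pmf p)"
  let ?M = "coins p ?V"
  interpret b: prob_space ?b by (rule measure_pmf.prob_space_axioms)
  interpret M: prob_space ?M by (rule prob_space_coins)
  have f [measurable]: "?f \<in> measurable ?M borel" by (rule measurable_mark_rooted[OF 1(2,3)])
  \<comment> \<open>since \<open>u\<close> is already an index, this overwrites the old mark at \<open>u\<close>\<close>
  have upd: "?M = distr (?b \<Otimes>\<^sub>M ?M) ?M (\<lambda>(a, m). m(u := a))"
    using distr_pair_PiM_eq_PiM[of ?V "\<lambda>_. ?b" u] 1(3)
    by (simp add: insert_absorb measure_pmf.prob_space_axioms)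
  have upd_meas [measurable]: "(\<lambda>(a, m). m(u := a)) \<in> measurable (?b \<Otimes>\<^sub>M ?M) ?M"
    using measurable_fun_upd[of ?V ?V u "\<lambda>w. snd w" "?b \<Otimes>\<^sub>M ?M" "\<lambda>_. ?b" "\<lambda>w. fst w"] 1(3)
    by (simp add: case_prod_beta' insert_absorb)
  have B [measurable]: "A \<inter> {y. root_mark y} \<in> sets borel" "force_root_mark -` A \<in> sets borel"
    using measurable_sets[OF measurable_force_root_mark A] by simp_all
  have ind: "indicator (A \<inter> {y. root_mark y}) (?f (m(u := a))) =
      (if a then indicator (force_root_mark -` A) (?f m) else 0 :: ennreal)" for a m
    using 1(2,3) by (simp add: indicator_def root_mark_abs force_root_mark_mark_vertices)
  have emeasure_eq: "emeasure (iid_marking p x) S = (\<integral>\<^sup>+ m. indicator S (?f m) \<partial>?M)"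
    if S: "S \<in> sets borel" for S
  proof -
    have "emeasure (iid_marking p x) S = (\<integral>\<^sup>+ y. indicator S y \<partial>iid_marking p x)"
      using S by simp
    also have "\<dots> = (\<integral>\<^sup>+ m. indicator S (?f m) \<partial>?M)"
      unfolding 1(1) iid_marking_abs[OF 1(2,3)]
      by (rule nn_integral_distr[OF f], simp, rule borel_measurable_indicator[OF S])
    finally show ?thesis .
  qed
  have "emeasure (iid_marking p x) (A \<inter> {y. root_mark y}) =
      (\<integral>\<^sup>+ m. indicator (A \<inter> {y. root_mark y}) (?f m) \<partial>?M)"
    by (rule emeasure_eq[OF B(1)])
  also have "\<dots> = (\<integral>\<^sup>+ (a, m). indicator (A \<inter> {y. root_mark y}) (?f (m(u := a))) \<partial>(?b \<Otimes>\<^sub>M ?M))"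
    by (subst upd, subst nn_integral_distr[OF upd_meas]) (simp_all add: case_prod_beta')
  also have "\<dots> = (\<integral>\<^sup>+ a. (\<integral>\<^sup>+ m. indicator (A \<inter> {y. root_mark y}) (?f (m(u := a))) \<partial>?M) \<partial>?b)"
    by (subst M.nn_integral_fst[symmetric]) (simp_all add: case_prod_beta')
  also have "\<dots> = ennreal p * (\<integral>\<^sup>+ m. indicator (force_root_mark -` A) (?f m) \<partial>?M)"
    unfolding ind using p by (simp add: mult.commute)
  also have "\<dots> = ennreal p * emeasure (iid_marking p x) (force_root_mark -` A)"
    by (simp only: emeasure_eq[OF B(2)])
  finally show ?thesis .
qed

lemma emeasure_iid_marked_root_mark:
  assumes \<mu>: "sets \<mu> = sets borel" and p: "0 \<le> p" "p \<le> 1" and A: "A \<in> sets borel"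
  shows "emeasure (iid_marked p \<mu>) (A \<inter> {y. root_mark y}) =
    ennreal p * emeasure (distr (iid_marked p \<mu>) borel force_root_mark) A"
proof -
  have F: "force_root_mark -` A \<in> sets borel"
    using measurable_sets[OF measurable_force_root_mark A] by simp
  have "emeasure (iid_marked p \<mu>) (A \<inter> {y. root_mark y}) =
      (\<integral>\<^sup>+ x. ennreal p * emeasure (iid_marking p x) (force_root_mark -` A) \<partial>\<mu>)"
    using A by (simp add: emeasure_iid_marked[OF \<mu>] emeasure_iid_marking_root_mark[OF p])
  also have "\<dots> = ennreal p * (\<integral>\<^sup>+ x. emeasure (iid_marking p x) (force_root_mark -` A) \<partial>\<mu>)"
    by (intro nn_integral_cmult measurable_compose[OF measurable_iid_marking'[OF \<mu>]
      measurable_emeasure_subprob_algebra[OF F]])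
  also have "\<dots> = ennreal p * emeasure (distr (iid_marked p \<mu>) borel force_root_mark) A"
    using A F \<mu> sets_eq_imp_space_eq[OF sets_iid_marked[OF \<mu>], of p]
    by (subst emeasure_distr) (simp_all add: emeasure_iid_marked[OF \<mu>] cong: measurable_cong_sets)
  finally show ?thesis .
qed

section \<open>Greedy transport\<close>

definition inflow :: "('m birooted_net \<Rightarrow> ennreal) \<Rightarrow> 'm rooted_net \<Rightarrow> ennreal" where
  "inflow f = root_sum (\<lambda>d. f (swap_roots d))"

lemma measurable_inflow [measurable (raw)]:
  fixes f :: "bool birooted_net \<Rightarrow> ennreal"
  assumes [measurable]: "f \<in> borel_measurable borel"
  shows "inflow f \<in> borel_measurable borel"
  unfolding inflow_def by (rule measurable_root_sum) measurable

text \<open>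
  The mass moved in the first \<open>n\<close> rounds, for supply \<open>s\<close> and demand \<open>c\<close>. The differences are what is
  left; mass once moved stays moved, so the transports increase with \<open>n\<close>.
\<close>

primrec greedy_transport ::
  "('m birooted_net \<Rightarrow> ennreal) \<Rightarrow> ('m rooted_net \<Rightarrow> ennreal) \<Rightarrow> ('m rooted_net \<Rightarrow> ennreal) \<Rightarrow>
    nat \<Rightarrow> 'm birooted_net \<Rightarrow> ennreal"
where
  "greedy_transport K s c 0 = (\<lambda>d. 0)"
| "greedy_transport K s c (Suc n) = (\<lambda>d. greedy_transport K s c n d +
     K d * min (s (first_rooted d) - root_sum (greedy_transport K s c n) (first_rooted d))
               (c (second_rooted d) - inflow (greedy_transport K s c n) (second_rooted d)))"

lemma measurable_greedy_transport [measurable]: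
  assumes [measurable]: "K \<in> borel_measurable borel" "s \<in> borel_measurable borel" "c \<in> borel_measurable borel"
  shows "greedy_transport K s c n \<in> borel_measurable (borel :: bool birooted_net measure)"
proof (induction n)
  case (Suc n)
  note [measurable] = Suc measurable_root_sum[OF Suc] measurable_inflow[OF Suc]
  show ?case by simp
qed simp

text \<open>
  In one round a vertex distributes at most the fraction \<open>root_sum K x \<le> 1\<close> of its remaining supply.
\<close>

lemma root_sum_greedy_transport_le:
  assumes K: "\<And>x. root_sum K x \<le> 1"
  shows "root_sum (greedy_transport K s c n) x \<le> s x"
proof (induction n)
  case 0
  show ?case using root_sum_cmult[of 0 "\<lambda>_. 0" x] by simp
next
  case (Suc n)
  let ?a = "root_sum (greedy_transport K s c n)"
  have "root_sum (greedy_transport K s c (Suc n)) x \<le>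
      root_sum (\<lambda>d. greedy_transport K s c n d + (s (first_rooted d) - ?a (first_rooted d)) * K d) x"
    unfolding greedy_transport.simps
    by (intro root_sum_mono add_left_mono) (simp add: mult.commute[of "K _"] mult_right_mono)
  also have "\<dots> = ?a x + (s x - ?a x) * root_sum K x"
    using root_sum_first_mult[of "\<lambda>x. s x - ?a x" K x] by (simp add: root_sum_add)
  also have "\<dots> \<le> ?a x + (s x - ?a x) * 1"
    by (intro add_left_mono mult_left_mono K) simp
  also have "\<dots> = s x" using Suc by (simp add: add_diff_inverse_ennreal)
  finally show ?case .
qed

text \<open>
  As for the supply: by symmetry of \<open>K\<close>, a vertex receives in one round at most its remaining demand.
\<close>

lemma inflow_greedy_transport_le:
  assumes K: "\<And>x. root_sum K x \<le> 1" "\<And>d. K (swap_roots d) = K d"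
  shows "inflow (greedy_transport K s c n) x \<le> c x"
proof (induction n)
  case 0
  show ?case using root_sum_cmult[of 0 "\<lambda>_. 0" x] by (simp add: inflow_def)
next
  case (Suc n)
  let ?b = "inflow (greedy_transport K s c n)"
  have "inflow (greedy_transport K s c (Suc n)) x \<le>
      root_sum (\<lambda>d. greedy_transport K s c n (swap_roots d) + (c (first_rooted d) - ?b (first_rooted d)) * K d) x"
    unfolding inflow_def[of "greedy_transport K s c (Suc n)"]
    unfolding greedy_transport.simps K(2) rooted_swap_roots
    by (intro root_sum_mono add_left_mono) (simp add: mult.commute[of "K _"] mult_right_mono)
  also have "\<dots> = ?b x + (c x - ?b x) * root_sum K x"
    using root_sum_first_mult[of "\<lambda>x. c x - ?b x" K x] by (simp add: root_sum_add inflow_def)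
  also have "\<dots> \<le> ?b x + (c x - ?b x) * 1"
    by (intro add_left_mono mult_left_mono K) simp
  also have "\<dots> = c x" using Suc by (simp add: add_diff_inverse_ennreal)
  finally show ?case .
qed

lemma ennreal_of_nat_mult_bounded:
  fixes a b :: ennreal
  assumes "\<And>n. of_nat n * a \<le> b" "b < \<infinity>"
  shows "a = 0"
proof (rule ccontr)
  assume "a \<noteq> 0"
  have "\<infinity> = (SUP n. of_nat n) * a"
    using \<open>a \<noteq> 0\<close> by (simp add: ennreal_SUP_of_nat_eq_top ennreal_top_mult)
  also have "\<dots> = (SUP n. of_nat n * a)" by (simp add: SUP_mult_right_ennreal)
  also have "\<dots> \<le> b" by (rule SUP_least) (rule assms(1))
  finally show False using assms(2) by simp
qed

text \<open>
  If supply were left at the first root of \<open>d\<close> and demand at the second one, then every round would move at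
  least a fixed positive amount, and the total would be infinite. As \<open>K\<close> is positive on all pairs,
  this applies to any two vertices of a network.
\<close>

lemma maximal_transport_exists:
  fixes K :: "bool birooted_net \<Rightarrow> ennreal" and s c :: "bool rooted_net \<Rightarrow> ennreal"
  assumes meas: "K \<in> borel_measurable borel" "s \<in> borel_measurable borel" "c \<in> borel_measurable borel"
    and K: "\<And>x. root_sum K x \<le> 1" "\<And>d. K (swap_roots d) = K d" "\<And>d. K d > 0"
    and fin: "\<And>x. s x < \<infinity>"
  obtains T where "T \<in> borel_measurable borel" "\<And>x. root_sum T x \<le> s x" "\<And>x. inflow T x \<le> c x"
    "\<And>d. root_sum T (first_rooted d) = s (first_rooted d) \<or> inflow T (second_rooted d) = c (second_rooted d)"
proof -
  define G where "G = greedy_transport K s c"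
  define T where "T d = (SUP n. G n d)" for d
  have inc: "incseq (\<lambda>n. G n d)" for d
    by (rule incseq_SucI) (simp add: G_def)
  have out_eq: "root_sum T x = (SUP n. root_sum (G n) x)" for x
    unfolding T_def[abs_def] by (rule root_sum_SUP[OF inc])
  have inflow_eq: "inflow T x = (SUP n. inflow (G n) x)" for x
    unfolding T_def[abs_def] inflow_def by (rule root_sum_SUP[OF inc])
  have out_le: "root_sum T x \<le> s x" for x
    unfolding out_eq G_def by (rule SUP_least) (rule root_sum_greedy_transport_le[OF K(1)])
  have in_le: "inflow T x \<le> c x" for x
    unfolding inflow_eq G_def by (rule SUP_least) (rule inflow_greedy_transport_le[OF K(1,2)])
  have "root_sum T (first_rooted d) = s (first_rooted d) \<or> inflow T (second_rooted d) = c (second_rooted d)" for d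
  proof -
    let ?x = "first_rooted d" and ?y = "second_rooted d"
    let ?a = "K d * min (s ?x - root_sum T ?x) (c ?y - inflow T ?y)"
    have "of_nat n * ?a \<le> G n d" for n
    proof (induction n)
      case (Suc n)
      have "root_sum (G n) ?x \<le> root_sum T ?x" "inflow (G n) ?y \<le> inflow T ?y"
        unfolding out_eq inflow_eq by (auto intro: SUP_upper)
      then have "?a \<le> K d * min (s ?x - root_sum (G n) ?x) (c ?y - inflow (G n) ?y)"
        by (intro mult_left_mono min.mono ennreal_mono_minus) simp_all
      then have "of_nat n * ?a + ?a \<le> G (Suc n) d"
        using Suc unfolding G_def by (simp add: add_mono)
      then show ?case by (simp add: distrib_right add.commute)
    qed simp
    also have "G n d \<le> T d" for n unfolding T_def by (rule SUP_upper) simp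
    finally have "of_nat n * ?a \<le> T d" for n .
    moreover have "T d < \<infinity>"
      using root_sum_ge[of T d] out_le[of ?x] fin[of ?x] by (meson order_le_less_trans order_trans)
    ultimately have "?a = 0" by (rule ennreal_of_nat_mult_bounded)
    then have "s ?x - root_sum T ?x = 0 \<or> c ?y - inflow T ?y = 0"
      using K(3)[of d] by (auto simp: min_def split: if_splits)
    then show ?thesis
      using out_le[of ?x] in_le[of ?y] by (auto simp: diff_eq_0_iff_ennreal)
  qed
  moreover have "T \<in> borel_measurable borel"
    unfolding T_def[abs_def] G_def using meas by measurable
  ultimately show thesis using that out_le in_le by blast
qed

text \<open>
  For each radius \<open>r\<close>, weight \<open>1/2^(r+1)\<close> is given to pairs at distance at most \<open>r\<close>, divided by the sizes
  of both balls of radius \<open>r\<close>. One of these divisors normalises the sum, the other one makes the kernel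
  symmetric.
\<close>

lemma positive_symmetric_kernel_exists:
  obtains K :: "bool birooted_net \<Rightarrow> ennreal" where "K \<in> borel_measurable borel"
    "\<And>x. root_sum K x \<le> 1" "\<And>d. K (swap_roots d) = K d" "\<And>d. K d > 0"
proof -
  define L where "L r d = indicator {d. near_roots r d} d *
      (inverse (ball_size r (first_rooted d)) * inverse (ball_size r (second_rooted d)))"
    for r and d :: "bool birooted_net"
  define K where "K d = (\<Sum>r. ennreal ((1/2) ^ Suc r) * L r d)" for d
  have L_le: "root_sum (L r) x \<le> 1" for r x
  proof -
    have N: "1 \<le> ball_size r y" "ball_size r y < \<infinity>" for y :: "bool rooted_net"
      by (rule ball_size_bounds)+
    have N0: "ball_size r y \<noteq> 0" for y :: "bool rooted_net"
      using N(1)[of y] by auto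
    then have "inverse (ball_size r y) \<le> 1" for y :: "bool rooted_net"
      using divide_right_mono_ennreal[OF N(1)[of y], of "ball_size r y"] N[of y]
        ennreal_divide_self[of "ball_size r y"] by (auto simp: divide_ennreal_def)
    then have "L r d \<le> inverse (ball_size r (first_rooted d)) * indicator {d. near_roots r d} d" for d
      unfolding L_def by (auto simp: indicator_def intro!: mult_left_le)
    then have "root_sum (L r) x \<le>
        root_sum (\<lambda>d. inverse (ball_size r (first_rooted d)) * indicator {d. near_roots r d} d) x"
      by (rule root_sum_mono)
    also have "\<dots> = inverse (ball_size r x) * ball_size r x"
      using root_sum_first_mult[of "\<lambda>x. inverse (ball_size r x)" "indicator {d. near_roots r d}" x]
      by (simp add: ball_size_def)
    also have "\<dots> = 1"
      using N[of x] N0[of x] ennreal_divide_self[of "ball_size r x"] by (auto simp: divide_ennreal_def mult.commute)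
    finally show ?thesis .
  qed
  have "{d :: bool birooted_net. near_roots r d} \<in> sets borel" for r
    using measurable_near_roots[of r] by (simp add: pred_def)
  note [measurable] = this
  have "L r \<in> borel_measurable borel" for r unfolding L_def[abs_def] by simp
  then have "K \<in> borel_measurable borel" unfolding K_def[abs_def] by simp
  moreover have "root_sum K x \<le> 1" for x
  proof -
    have "root_sum K x = (\<Sum>r. ennreal ((1/2) ^ Suc r) * root_sum (L r) x)"
      unfolding K_def[abs_def] root_sum_suminf root_sum_cmult ..
    also have "\<dots> \<le> (\<Sum>r. ennreal ((1/2) ^ Suc r))"
      by (intro suminf_le) (simp_all add: mult_left_le L_le)
    also have "\<dots> = 1" by (subst suminf_ennreal_eq[OF zero_le_power power_half_series]) auto
    finally show ?thesis .
  qed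
  moreover have "K (swap_roots d) = K d" for d
    unfolding K_def L_def by (simp add: mult.commute indicator_def)
  moreover have "K d > 0" for d
  proof -
    obtain r where r: "near_roots r d" using near_roots_exists by blast
    have "L r d > 0"
      using r ball_size_bounds(2)[of r "first_rooted d"] ball_size_bounds(2)[of r "second_rooted d"]
      unfolding L_def
      by (simp add: ennreal_zero_less_mult_iff ennreal_inverse_positive less_top)
    then have "0 < ennreal ((1/2) ^ Suc r) * L r d"
      by (simp add: ennreal_zero_less_mult_iff)
    also have "\<dots> \<le> K d"
      unfolding K_def using sum_le_suminf[of "\<lambda>r. ennreal ((1/2) ^ Suc r) * L r d" "{r}"] by simp
    finally show ?thesis .
  qed
  ultimately show thesis using that by blast
qed

section \<open>The root-change\<close>

lemma AE_eq_if_nn_integral_eq: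
  assumes [measurable]: "f \<in> borel_measurable M" "g \<in> borel_measurable M"
    and le: "\<And>x. f x \<le> g x" and eq: "(\<integral>\<^sup>+ x. f x \<partial>M) = (\<integral>\<^sup>+ x. g x \<partial>M)"
    and fin: "(\<integral>\<^sup>+ x. g x \<partial>M) < \<infinity>"
  shows "AE x in M. f x = g x"
proof -
  have "(\<integral>\<^sup>+ x. g x - f x \<partial>M) = (\<integral>\<^sup>+ x. g x \<partial>M) - (\<integral>\<^sup>+ x. f x \<partial>M)"
    using le eq fin by (intro nn_integral_diff) auto
  also have "\<dots> = 0" using eq fin by simp
  finally have "AE x in M. g x - f x = 0"
    by (subst (asm) nn_integral_0_iff_AE) simp_all
  then show ?thesis
    by (rule AE_mp) (auto intro!: AE_I2 antisym le simp: diff_eq_0_iff_ennreal)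
qed

theorem proposition3:
  fixes M :: "'w measure" and X :: "'w \<Rightarrow> unit rooted_net" and p :: real
  assumes "prob_space M" and "X \<in> borel_measurable M"
    and "unimodular (distr M borel X)"
    and "0 < p" and "p \<le> 1"
    and "AE \<omega> in M. infinite_net (X \<omega>)"
  shows "\<exists>T. root_change T
    (iid_marked p (distr M borel X))
    (distr (iid_marked p (distr M borel X)) borel force_root_mark)"
proof -
  define \<mu> where "\<mu> = distr M borel X"
  define P where "P = iid_marked p \<mu>"
  define \<nu> where "\<nu> = distr P borel force_root_mark"
  have \<mu>: "sets \<mu> = sets borel" "unimodular \<mu>" "prob_space \<mu>"
    using assms(1-3) by (auto simp: \<mu>_def prob_space.prob_space_distr)
  have p: "0 \<le> p" "p \<le> 1" using assms(4,5) by auto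
  have inf: "AE x in \<mu>. infinite_net x"
    unfolding \<mu>_def using assms(2,6) by (subst AE_distr_iff) simp_all
  interpret P: prob_space P unfolding P_def by (rule prob_space_iid_marked[OF \<mu>(3,1)])
  have sets_P [measurable_cong]: "sets P = sets borel" unfolding P_def by (rule sets_iid_marked[OF \<mu>(1)])
  have transport: "(\<integral>\<^sup>+ y. root_sum g y \<partial>P) = (\<integral>\<^sup>+ y. root_sum (\<lambda>d. g (swap_roots d)) y \<partial>P)"
    if "g \<in> borel_measurable borel" for g
    unfolding P_def by (rule mass_transport_iid_marked[OF \<mu>(1,2) that])
  define c :: "bool rooted_net \<Rightarrow> ennreal" where
    "c x = inverse (ennreal p) * indicator {y. root_mark y} x" for x
  have c [measurable]: "c \<in> borel_measurable borel" unfolding c_def[abs_def] by simp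
  have inv_p: "inverse (ennreal p) * (ennreal p * a) = a" for a
    using assms(4) ennreal_divide_self[of "ennreal p"]
    by (simp add: divide_ennreal_def mult.assoc[symmetric] mult.commute[of "inverse _"])
  have int_c: "(\<integral>\<^sup>+ x. indicator A x * c x \<partial>P) = inverse (ennreal p) * emeasure P (A \<inter> {y. root_mark y})"
    if [measurable]: "A \<in> sets borel" for A
  proof -
    have "(\<integral>\<^sup>+ x. indicator A x * c x \<partial>P) =
        (\<integral>\<^sup>+ x. inverse (ennreal p) * indicator (A \<inter> {y. root_mark y}) x \<partial>P)"
      by (intro nn_integral_cong) (simp add: c_def indicator_def)
    then show ?thesis by (simp add: nn_integral_cmult sets_P)
  qed
  obtain K :: "bool birooted_net \<Rightarrow> ennreal" where K: "K \<in> borel_measurable borel"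
    "\<And>x. root_sum K x \<le> 1" "\<And>d. K (swap_roots d) = K d" "\<And>d. K d > 0"
    using positive_symmetric_kernel_exists by blast
  obtain T :: "bool birooted_net \<Rightarrow> ennreal" where T [measurable]: "T \<in> borel_measurable borel"
    and out_le: "\<And>x. root_sum T x \<le> 1" and in_le: "\<And>x. inflow T x \<le> c x"
    and alt: "\<And>d. root_sum T (first_rooted d) = 1 \<or> inflow T (second_rooted d) = c (second_rooted d)"
    by (rule maximal_transport_exists[OF K(1) _ c K(2-4), where s = "\<lambda>_. 1"]) auto
  have restricted_inflow: "root_sum (\<lambda>d. indicator A (first_rooted d) * T (swap_roots d)) x = indicator A x * inflow T x"
    for A x
    using root_sum_first_mult[of "indicator A" "\<lambda>d. T (swap_roots d)" x] by (simp add: inflow_def)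
  note [measurable] = measurable_root_sum[OF T] measurable_inflow[OF T]
  \<comment> \<open>all vertices, not only the root, send out their whole mass: an event that ignores the root\<close>
  define I where "I = {x. root_sum (\<lambda>d. 1 - root_sum T (second_rooted d)) x = 0}"
  have "root_sum (\<lambda>d. 1 - root_sum T (second_rooted d)) \<in> borel_measurable borel"
    by (rule measurable_root_sum) measurable
  then have I [measurable]: "I \<in> sets borel"
    unfolding I_def using measurable_sets[of _ borel borel "{0}"] by (simp add: vimage_def)
  have I_iff: "x \<in> I \<longleftrightarrow> (\<forall>d. first_rooted d = x \<longrightarrow> root_sum T (second_rooted d) = 1)" for x
    unfolding I_def mem_Collect_eq root_sum_eq_0_iff diff_eq_0_iff_ennreal
    using out_le by (auto intro: antisym)
  have inv_imp: "second_rooted d \<in> I" if "first_rooted d \<in> I" for d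
    unfolding I_iff
  proof (intro allI impI)
    fix e :: "bool birooted_net" assume "first_rooted e = second_rooted d"
    then obtain d' where "first_rooted d' = first_rooted d" "second_rooted d' = second_rooted e"
      using same_network_trans[of "swap_roots d" e] by auto
    then show "root_sum T (second_rooted e) = 1" using that I_iff by metis
  qed
  have inv: "first_rooted d \<in> I \<longleftrightarrow> second_rooted d \<in> I" for d
    using inv_imp[of d] inv_imp[of "swap_roots d"] by auto
  have mass: "(\<integral>\<^sup>+ x. indicator J x * root_sum T x \<partial>P) = (\<integral>\<^sup>+ x. indicator J x * inflow T x \<partial>P)"
    "(\<integral>\<^sup>+ x. indicator J x * c x \<partial>P) = emeasure P J"
    if J: "J = I \<or> J = - I" for J
  proof -
    have [measurable]: "J \<in> sets borel" using J I by auto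
    have invJ: "first_rooted d \<in> J \<longleftrightarrow> second_rooted d \<in> J" for d using J inv by auto
    have "(\<integral>\<^sup>+ x. indicator J x * root_sum T x \<partial>P) =
        (\<integral>\<^sup>+ x. root_sum (\<lambda>d. indicator J (first_rooted d) * T d) x \<partial>P)"
      by (simp add: root_sum_first_mult)
    also have "\<dots> = (\<integral>\<^sup>+ x. root_sum (\<lambda>d. indicator J (second_rooted d) * T (swap_roots d)) x \<partial>P)"
      by (subst transport) simp_all
    also have "\<dots> = (\<integral>\<^sup>+ x. root_sum (\<lambda>d. indicator J (first_rooted d) * T (swap_roots d)) x \<partial>P)"
      using invJ by (simp add: indicator_def)
    also have "\<dots> = (\<integral>\<^sup>+ x. indicator J x * inflow T x \<partial>P)"
      by (simp only: restricted_inflow)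
    finally show "(\<integral>\<^sup>+ x. indicator J x * root_sum T x \<partial>P) = (\<integral>\<^sup>+ x. indicator J x * inflow T x \<partial>P)" .
    have "emeasure P (J \<inter> {y. root_mark y}) = ennreal p * emeasure P J"
      unfolding P_def by (rule invariant_indep_root_mark[OF \<mu>(1,2) inf p _ invJ \<mu>(3)]) simp
    then show "(\<integral>\<^sup>+ x. indicator J x * c x \<partial>P) = emeasure P J"
      by (simp add: int_c inv_p)
  qed
  have int1: "(\<integral>\<^sup>+ x. indicator J x * 1 \<partial>P) = emeasure P J" if "J \<in> sets borel" for J
    using that by (simp add: sets_P)
  have on_I: "root_sum T x = 1" if "x \<in> I" for x
    using that I_iff[of x] first_double_root[of x] second_double_root[of x] by metis
  \<comment> \<open>a vertex with supply left exists somewhere, so no demand is left anywhere, in particular not at \<open>x\<close>\<close>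
  have off_I: "inflow T x = c x" if "x \<notin> I" for x
  proof -
    obtain d where "first_rooted d = x" "root_sum T (second_rooted d) \<noteq> 1"
      using \<open>x \<notin> I\<close> I_iff by blast
    then show ?thesis using alt[of "swap_roots d"] by simp
  qed
  \<comment> \<open>on \<open>I\<close>, supply \<open>1\<close> is used up, so the mean mass received equals the mean demand\<close>
  have "AE x in P. indicator I x * inflow T x = indicator I x * c x"
  proof (rule AE_eq_if_nn_integral_eq)
    have "(\<integral>\<^sup>+ x. indicator I x * inflow T x \<partial>P) = (\<integral>\<^sup>+ x. indicator I x * root_sum T x \<partial>P)"
      by (simp add: mass(1))
    also have "\<dots> = (\<integral>\<^sup>+ x. indicator I x * 1 \<partial>P)"
      by (intro nn_integral_cong) (simp add: on_I indicator_def)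
    also have "\<dots> = (\<integral>\<^sup>+ x. indicator I x * c x \<partial>P)" by (simp only: int1[OF I] mass(2)[of I] simp_thms)
    finally show "(\<integral>\<^sup>+ x. indicator I x * inflow T x \<partial>P) = (\<integral>\<^sup>+ x. indicator I x * c x \<partial>P)" .
    show "(\<integral>\<^sup>+ x. indicator I x * c x \<partial>P) < \<infinity>"
      by (simp add: mass(2) P.emeasure_finite less_top[symmetric])
  qed (simp_all add: in_le mult_left_mono)
  then have in_eq: "AE x in P. inflow T x = c x"
    by (rule AE_mp) (auto intro!: AE_I2 simp: off_I indicator_def split: if_splits)
  \<comment> \<open>off \<open>I\<close>, demand is met, so the mean mass sent equals the mean supply\<close>
  have "AE x in P. indicator (- I) x * root_sum T x = indicator (- I) x * 1"
  proof (rule AE_eq_if_nn_integral_eq)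
    have "(\<integral>\<^sup>+ x. indicator (- I) x * root_sum T x \<partial>P) = (\<integral>\<^sup>+ x. indicator (- I) x * inflow T x \<partial>P)"
      by (simp add: mass(1))
    also have "\<dots> = (\<integral>\<^sup>+ x. indicator (- I) x * c x \<partial>P)"
      by (intro nn_integral_cong) (simp add: off_I indicator_def)
    also have "\<dots> = emeasure P (- I)" by (rule mass(2)) simp
    also have "\<dots> = (\<integral>\<^sup>+ x. indicator (- I) x * 1 \<partial>P)" using I by (simp add: int1)
    finally show "(\<integral>\<^sup>+ x. indicator (- I) x * root_sum T x \<partial>P) = (\<integral>\<^sup>+ x. indicator (- I) x * 1 \<partial>P)" .
    show "(\<integral>\<^sup>+ x. indicator (- I) x * 1 \<partial>P) < \<infinity>"
      using I by (subst int1) (simp_all add: P.emeasure_finite less_top[symmetric])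
  qed (simp_all add: out_le mult_left_le)
  then have out_eq: "AE x in P. root_sum T x = 1"
    by (rule AE_mp) (auto intro!: AE_I2 simp: on_I indicator_def split: if_splits)
  have T_fin: "T d < \<infinity>" for d
    using order_trans[OF root_sum_ge[of T d] out_le] by (simp add: order_le_less_trans[of _ 1])
  \<comment> \<open>receiving \<open>c\<close> at the root is, by mass transport, having density \<open>c\<close> with respect to \<open>P\<close>\<close>
  have "root_change (\<lambda>d. enn2real (T d)) P \<nu>"
    unfolding root_change_def
  proof (intro conjI allI ballI)
    show "AE x in P. root_sum (\<lambda>d. ennreal (enn2real (T d))) x = 1"
      using out_eq T_fin by simp
    show "sets \<nu> = sets borel" by (simp add: \<nu>_def)
    fix A :: "bool rooted_net set" assume A [measurable]: "A \<in> sets borel"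
    have "emeasure \<nu> A = inverse (ennreal p) * emeasure P (A \<inter> {y. root_mark y})"
      unfolding \<nu>_def P_def using emeasure_iid_marked_root_mark[OF \<mu>(1) p A] inv_p by simp
    also have "\<dots> = (\<integral>\<^sup>+ x. indicator A x * c x \<partial>P)" by (simp add: int_c)
    also have "\<dots> = (\<integral>\<^sup>+ x. indicator A x * inflow T x \<partial>P)"
      by (rule nn_integral_cong_AE) (use in_eq in \<open>auto elim!: eventually_mono\<close>)
    also have "\<dots> = (\<integral>\<^sup>+ x. root_sum (\<lambda>d. indicator A (first_rooted d) * T (swap_roots d)) x \<partial>P)"
      by (simp only: restricted_inflow)
    also have "\<dots> = (\<integral>\<^sup>+ x. root_sum (\<lambda>d. indicator A (second_rooted d) * T d) x \<partial>P)"
      by (subst transport) simp_all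
    finally show "emeasure \<nu> A = (\<integral>\<^sup>+ x. root_sum (\<lambda>d. ennreal (enn2real (T d)) * indicator A (second_rooted d)) x \<partial>P)"
      using T_fin by (simp add: mult.commute)
  qed simp_all
  then show ?thesis unfolding \<nu>_def P_def \<mu>_def by blast
qed

end
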